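(* Let $L$ be a field. Then any Galois $L$-bimodule $P$ of rank $d$ is a multiple of $L\otimes_{\mathcal{Z}(P)}L$, i.e. $P\cong (L\otimes_{\mathcal{Z}(P)}L)^r$ as an $L$-bimodule for some positive integer $r$. In particular, $[L:\mathcal{Z}(P)]$ is finite and divides $d$.
   Context: An $L$-bimodule is an abelian group with commuting unital left and right actions of $L$ (the two actions are not assumed to agree on any subfield other than the prime one). The center of an $L$-bimodule $P$ is $\mathcal{Z}(P)=\{z\in L: zx=xz \text{ for all } x\in P\}$, a subfield of $L$ when $P\neq 0$. A Galois $L$-bimodule of rank $d\ge 1$ is an $L$-bimodule $P$ which is of dimension $d$ both as a left and as a right $L$-vector space, and such that $P\otimes_L P\cong P^d$ as $L$-bimodules. *)

theory Defs
  imports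
    "HOL-Algebra.Algebra"
    "Jordan_Normal_Form.Missing_VectorSpace"
begin

record ('a, 'b) bimodule = "('a, 'b) module" +
  rsmult :: "['b, 'a] \<Rightarrow> 'b"  (infixl \<open>\<odot>\<^sup>r\<index>\<close> 70)

text \<open>The right action, presented as a module structure. Since the scalars are commutative
  (\<^locale>\<open>module\<close> requires a \<^locale>\<open>cring\<close>), no opposite ring is needed.\<close>

definition right_module :: "('a, 'b, 'm) bimodule_scheme \<Rightarrow> ('a, 'b, 'm) bimodule_scheme" where
  "right_module P = P\<lparr>smult := (\<lambda>a x. x \<odot>\<^sup>r\<^bsub>P\<^esub> a)\<rparr>"

locale bimodule = left: module L P + right: module L "right_module P"
  for L :: "('a, 'k) ring_scheme" (structure) and P :: "('a, 'b, 'm) bimodule_scheme" (structure) +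
  assumes smult_rsmult: "\<lbrakk>a \<in> carrier L; b \<in> carrier L; x \<in> carrier P\<rbrakk> \<Longrightarrow>
    (a \<odot>\<^bsub>P\<^esub> x) \<odot>\<^sup>r\<^bsub>P\<^esub> b = a \<odot>\<^bsub>P\<^esub> (x \<odot>\<^sup>r\<^bsub>P\<^esub> b)"

definition bimodule_iso ::
  "[('a, 'k) ring_scheme, ('a, 'b, 'm) bimodule_scheme, ('a, 'c, 'n) bimodule_scheme] \<Rightarrow> ('b \<Rightarrow> 'c) set"
  where "bimodule_iso L P Q =
    {f \<in> module_hom L P Q \<inter> module_hom L (right_module P) (right_module Q).
       bij_betw f (carrier P) (carrier Q)}"

definition bimodule_isomorphic ::
  "[('a, 'k) ring_scheme, ('a, 'b, 'm) bimodule_scheme, ('a, 'c, 'n) bimodule_scheme] \<Rightarrow> bool"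
  where "bimodule_isomorphic L P Q \<longleftrightarrow> bimodule_iso L P Q \<noteq> {}"

text \<open>In the bimodules constructed below the ring-multiplication fields of the underlying
  \<^type>\<open>module\<close> record carry no meaning and are left undefined.\<close>

definition bimodule_power :: "[('a, 'b, 'm) bimodule_scheme, nat] \<Rightarrow> ('a, nat \<Rightarrow> 'b) bimodule"
  where "bimodule_power P n =
    \<lparr>carrier = {..<n} \<rightarrow>\<^sub>E carrier P, monoid.mult = undefined, one = undefined,
     ring.zero = (\<lambda>i\<in>{..<n}. \<zero>\<^bsub>P\<^esub>),
     add = (\<lambda>x y. \<lambda>i\<in>{..<n}. x i \<oplus>\<^bsub>P\<^esub> y i),
     smult = (\<lambda>a x. \<lambda>i\<in>{..<n}. a \<odot>\<^bsub>P\<^esub> x i),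
     rsmult = (\<lambda>x a. \<lambda>i\<in>{..<n}. x i \<odot>\<^sup>r\<^bsub>P\<^esub> a)\<rparr>"

definition regular_bimodule :: "('a, 'k) ring_scheme \<Rightarrow> ('a, 'a) bimodule"
  where "regular_bimodule L =
    \<lparr>carrier = carrier L, monoid.mult = undefined, one = undefined,
     ring.zero = \<zero>\<^bsub>L\<^esub>, add = add L, smult = monoid.mult L, rsmult = monoid.mult L\<rparr>"

text \<open>The tensor product of \<open>P\<close> and \<open>Q\<close> over a subring \<open>K\<close> of the scalars, acting on the right of
  \<open>P\<close> and on the left of \<open>Q\<close>: the free abelian group on pairs modulo the subgroup generated by the
  relations of biadditivity and \<open>K\<close>-balancedness.\<close>

definition tensor_relations ::
  "['a set, ('a, 'b, 'm) bimodule_scheme, ('a, 'c, 'n) bimodule_scheme] \<Rightarrow> (('b \<times> 'c) \<Rightarrow>\<^sub>0 int) set"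
  where "tensor_relations K P Q =
    {frag_of (x \<oplus>\<^bsub>P\<^esub> x', y) - frag_of (x, y) - frag_of (x', y) | x x' y.
       x \<in> carrier P \<and> x' \<in> carrier P \<and> y \<in> carrier Q} \<union>
    {frag_of (x, y \<oplus>\<^bsub>Q\<^esub> y') - frag_of (x, y) - frag_of (x, y') | x y y'.
       x \<in> carrier P \<and> y \<in> carrier Q \<and> y' \<in> carrier Q} \<union>
    {frag_of (x \<odot>\<^sup>r\<^bsub>P\<^esub> k, y) - frag_of (x, k \<odot>\<^bsub>Q\<^esub> y) | x k y.
       x \<in> carrier P \<and> k \<in> K \<and> y \<in> carrier Q}"

text \<open>An outer scalar acts on pairs in one component; it preserves the relation subgroup \<open>H\<close>, so it
  sends a coset \<open>C\<close> into a single coset, namely \<open>H\<close> plus the image of \<open>C\<close>.\<close>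

definition bimodule_tensor ::
  "['a set, ('a, 'b, 'm) bimodule_scheme, ('a, 'c, 'n) bimodule_scheme]
     \<Rightarrow> ('a, (('b \<times> 'c) \<Rightarrow>\<^sub>0 int) set) bimodule"
  where "bimodule_tensor K P Q =
    (let F = free_Abelian_group (carrier P \<times> carrier Q);
         H = generate F (tensor_relations K P Q)
     in \<lparr>carrier = carrier (F Mod H), monoid.mult = undefined, one = undefined,
         ring.zero = one (F Mod H), add = monoid.mult (F Mod H),
         smult = (\<lambda>a C. H <#>\<^bsub>F\<^esub> frag_extend (\<lambda>(x, y). frag_of (a \<odot>\<^bsub>P\<^esub> x, y)) ` C),
         rsmult = (\<lambda>C a. H <#>\<^bsub>F\<^esub> frag_extend (\<lambda>(x, y). frag_of (x, y \<odot>\<^sup>r\<^bsub>Q\<^esub> a)) ` C)\<rparr>)"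

definition bimodule_center :: "[('a, 'k) ring_scheme, ('a, 'b, 'm) bimodule_scheme] \<Rightarrow> 'a set"
  where "bimodule_center L P =
    {z \<in> carrier L. \<forall>x \<in> carrier P. z \<odot>\<^bsub>P\<^esub> x = x \<odot>\<^sup>r\<^bsub>P\<^esub> z}"

text \<open>\<^const>\<open>vectorspace.dim\<close> is only meaningful together with \<^const>\<open>vectorspace.fin_dim\<close>.\<close>

definition has_dimension :: "[('a, 'k) ring_scheme, ('a, 'b, 'm) module_scheme, nat] \<Rightarrow> bool"
  where "has_dimension L V d \<longleftrightarrow> vectorspace.fin_dim L V \<and> vectorspace.dim L V = d"

definition galois_bimodule ::
  "[('a, 'k) ring_scheme, ('a, 'b, 'm) bimodule_scheme, nat] \<Rightarrow> bool"
  where "galois_bimodule L P d \<longleftrightarrow>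
    1 \<le> d \<and> bimodule L P \<and> has_dimension L P d \<and> has_dimension L (right_module P) d \<and>
    bimodule_isomorphic L (bimodule_tensor (carrier L) P P) (bimodule_power P d)"

end

theory Submission
  imports Defs
begin

text \<open>Let \<open>K\<close> be the center of \<open>P\<close>. The bimodules with center containing \<open>K\<close> are the modules over the
  commutative ring \<open>E = L \<otimes>\<^sub>K L\<close>, so the claim is that \<open>[L : K]\<close> is finite and that \<open>P\<close> is a free
  \<open>E\<close>-module of positive rank. The isomorphism \<open>P \<otimes>\<^sub>L P \<cong> P\<^sup>d\<close> is used in the following form: it has components
  \<open>\<beta>\<^sub>t : P \<times> P \<rightarrow> P\<close>, and every balanced form \<open>G : P \<times> P \<rightarrow> L\<close> can be written as
  \<open>G(p, q) = \<Sum>\<^sub>t g\<^sub>t(\<beta>\<^sub>t(p, q))\<close> with left linear forms \<open>g\<^sub>t\<close> on \<open>P\<close> (\<open>balanced_lift_of_iso\<close>).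

  \<^bold>\<open>Finiteness.\<close> The matrix coefficients \<open>y \<mapsto> g(p y)\<close> of the right action span a space of additive maps
  \<open>L \<rightarrow> L\<close> of finite dimension over \<open>L\<close>. It is closed under composition, since \<open>(p, q) \<mapsto> g(p g'(q))\<close> is a
  balanced form (\<open>coeff_maps_comp\<close>). As in the Jacobson-Bourbaki theorem it follows that the space contains a
  nonzero \<open>\<tau>\<close> with values in \<open>K\<close> (\<open>ex_trace_form\<close>). The forms \<open>\<tau>(x _)\<close> then provide finite \<open>K\<close>-bases \<open>u\<close> and
  \<open>v\<close> of \<open>L\<close>, dual for the pairing \<open>\<tau>(x y)\<close> (\<open>ex_dual_bases\<close>). With their help \<open>E\<close> becomes a ring of
  \<open>K\<close>-linear maps \<open>L \<rightarrow> L\<close>, where \<open>x \<otimes> y\<close> is the map \<open>x \<tau>(y _)\<close>, and each left linear form \<open>g\<close> on \<open>P\<close> induces an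
  \<open>E\<close>-linear form \<open>p \<mapsto> (y \<mapsto> g(p y))\<close> from \<open>P\<close> to \<open>E\<close>. These forms separate the points of \<open>P\<close>, and \<open>P\<close> is
  faithful over \<open>E\<close>.

  \<^bold>\<open>Freeness.\<close> Principal ideals of \<open>E\<close> satisfy the descending chain condition. Over such a ring, a faithful
  module whose forms separate points has a form with value \<open>1\<close> (\<open>ex_unimodular\<close>). A maximal system of elements
  \<open>p\<^sub>i\<close> and \<open>E\<close>-linear forms \<open>\<alpha>\<^sub>i\<close> with \<open>\<alpha>\<^sub>i(p\<^sub>j) = \<delta>\<^sub>i\<^sub>j\<close> therefore splits \<open>P\<close> into a free part \<open>E\<^sup>m\<close> and a
  complement \<open>N\<close> that is killed by some \<open>e \<noteq> 0\<close>, where \<open>eE\<close> can be taken minimal. Here \<open>m > 0\<close> as \<open>P\<close> is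
  faithful. Modulo the annihilator of \<open>e\<close>, the module \<open>P\<^sup>d\<close> has rank \<open>m d\<close>. But in \<open>P \<otimes>\<^sub>L P\<close> the \<open>m d\<close>
  tensors \<open>p\<^sub>l \<otimes> c\<^sub>k\<close>, with \<open>c\<close> a right basis of \<open>P\<close>, stay independent over \<open>E\<close> when a tensor \<open>\<nu> \<otimes> p\<^sub>0\<close>
  with \<open>0 \<noteq> \<nu> \<in> N\<close> is added (\<open>killed_kernel_trivial\<close>). So \<open>N = 0\<close> and \<open>P \<cong> E\<^sup>m\<close>. Counting dimensions over
  \<open>L\<close> gives \<open>d = m [L : K]\<close> (\<open>rank_eq\<close>).\<close>

section \<open>Linear systems and dual systems of functions\<close>

lemma additive_finsum:
  assumes "abelian_group M" "abelian_group N"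
    and add: "\<And>x y. x \<in> carrier M \<Longrightarrow> y \<in> carrier M \<Longrightarrow> h (x \<oplus>\<^bsub>M\<^esub> y) = h x \<oplus>\<^bsub>N\<^esub> h y"
    and cl: "\<And>x. x \<in> carrier M \<Longrightarrow> h x \<in> carrier N"
    and f: "\<And>i. i \<in> I \<Longrightarrow> f i \<in> carrier M"
  shows "h (\<Oplus>\<^bsub>M\<^esub>i\<in>I. f i) = (\<Oplus>\<^bsub>N\<^esub>i\<in>I. h (f i))"
proof -
  interpret M: abelian_group M by fact
  interpret N: abelian_group N by fact
  have "h \<zero>\<^bsub>M\<^esub> \<oplus>\<^bsub>N\<^esub> h \<zero>\<^bsub>M\<^esub> = h \<zero>\<^bsub>M\<^esub>"
    using add[of "\<zero>\<^bsub>M\<^esub>" "\<zero>\<^bsub>M\<^esub>"] by simp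
  then have z: "h \<zero>\<^bsub>M\<^esub> = \<zero>\<^bsub>N\<^esub>"
    using cl[of "\<zero>\<^bsub>M\<^esub>"] by (metis M.zero_closed N.add.r_cancel_one')
  show ?thesis
  proof (cases "finite I")
    case True
    then show ?thesis using f
    proof (induction I rule: finite_induct)
      case empty
      then show ?case by (simp add: z)
    next
      case (insert i I)
      have "h (\<Oplus>\<^bsub>M\<^esub>i\<in>insert i I. f i) = h (f i \<oplus>\<^bsub>M\<^esub> (\<Oplus>\<^bsub>M\<^esub>i\<in>I. f i))"
        using insert by (subst M.finsum_insert) auto
      also have "\<dots> = h (f i) \<oplus>\<^bsub>N\<^esub> (\<Oplus>\<^bsub>N\<^esub>i\<in>I. h (f i))"
        using insert by (subst add) (auto intro!: M.finsum_closed)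
      also have "\<dots> = (\<Oplus>\<^bsub>N\<^esub>i\<in>insert i I. h (f i))"
        using insert cl by (subst N.finsum_insert) auto
      finally show ?case .
    qed
  qed (simp add: z M.finsum_infinite N.finsum_infinite)
qed

context abelian_group
begin

lemma finsum_delta:
  assumes "finite I" "j \<in> I" "c \<in> carrier G"
  shows "(\<Oplus>i\<in>I. if i = j then c else \<zero>) = c"
  using finsum_singleton[of j I "\<lambda>_. c"] assms by (simp add: eq_commute)

lemma finsum_swap:
  assumes "finite I" "finite J" "\<And>i j. i \<in> I \<Longrightarrow> j \<in> J \<Longrightarrow> f i j \<in> carrier G"
  shows "(\<Oplus>i\<in>I. \<Oplus>j\<in>J. f i j) = (\<Oplus>j\<in>J. \<Oplus>i\<in>I. f i j)"
  using assms(1,3)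
proof (induction I rule: finite_induct)
  case empty
  then show ?case by simp
next
  case (insert a I)
  have "(\<Oplus>i\<in>insert a I. \<Oplus>j\<in>J. f i j) = (\<Oplus>j\<in>J. f a j) \<oplus> (\<Oplus>j\<in>J. \<Oplus>i\<in>I. f i j)"
    using insert by (subst finsum_insert) (auto intro!: finsum_closed)
  also have "\<dots> = (\<Oplus>j\<in>J. f a j \<oplus> (\<Oplus>i\<in>I. f i j))"
    using insert by (intro finsum_addf[symmetric]) (auto intro!: finsum_closed)
  also have "\<dots> = (\<Oplus>j\<in>J. \<Oplus>i\<in>insert a I. f i j)"
    using insert by (intro finsum_cong') (auto intro!: finsum_closed)
  finally show ?case .
qed

lemma finsum_eq_zero:
  assumes "\<And>i. i \<in> I \<Longrightarrow> f i = \<zero>"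
  shows "(\<Oplus>i\<in>I. f i) = \<zero>"
  using assms finsum_zero[of I] by (metis (no_types, lifting) finsum_cong' Pi_I' zero_closed)

end

text \<open>Gauss elimination modulo the annihilator of \<open>e\<close>. When every nonzero multiple of \<open>e\<close> generates \<open>e\<close>
  again, an entry \<open>M i k\<close> not killed by \<open>e\<close> is as good a pivot as a unit: some \<open>b\<close> satisfies
  \<open>e M\<^sub>i\<^sub>k b = e\<close>, so \<open>b\<close> inverts it modulo the annihilator. The choice \<open>e = \<one>\<close> is the case of a
  field.\<close>

lemma (in cring) homogeneous_system:
  fixes M :: "'i \<Rightarrow> 'j \<Rightarrow> 'a"
  assumes e: "e \<in> carrier R" "e \<noteq> \<zero>"
    and simple: "\<And>a. a \<in> carrier R \<Longrightarrow> e \<otimes> a \<noteq> \<zero> \<Longrightarrow> \<exists>b\<in>carrier R. e \<otimes> a \<otimes> b = e"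
    and "finite I" "finite J" "card I < card J"
    and "\<And>i j. i \<in> I \<Longrightarrow> j \<in> J \<Longrightarrow> M i j \<in> carrier R"
  shows "\<exists>w\<in>J \<rightarrow> carrier R. (\<exists>j\<in>J. e \<otimes> w j \<noteq> \<zero>) \<and> (\<forall>i\<in>I. e \<otimes> (\<Oplus>j\<in>J. M i j \<otimes> w j) = \<zero>)"
  using assms(4-7)
proof (induction I arbitrary: J M rule: finite_induct)
  case empty
  then show ?case using e by (intro bexI[of _ "\<lambda>_. \<one>"]) (auto simp: card_gt_0_iff)
next
  case (insert i I)
  show ?case
  proof (cases "\<exists>j\<in>J. e \<otimes> M i j \<noteq> \<zero>")
    case False
    have "\<exists>w\<in>J \<rightarrow> carrier R. (\<exists>j\<in>J. e \<otimes> w j \<noteq> \<zero>) \<and> (\<forall>i\<in>I. e \<otimes> (\<Oplus>j\<in>J. M i j \<otimes> w j) = \<zero>)"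
      by (rule insert.IH) (use insert.prems insert.hyps in auto)
    then obtain w where w: "w \<in> J \<rightarrow> carrier R" "\<exists>j\<in>J. e \<otimes> w j \<noteq> \<zero>"
      "\<forall>i\<in>I. e \<otimes> (\<Oplus>j\<in>J. M i j \<otimes> w j) = \<zero>"
      by blast
    have "e \<otimes> (\<Oplus>j\<in>J. M i j \<otimes> w j) = (\<Oplus>j\<in>J. e \<otimes> (M i j \<otimes> w j))"
      using insert.prems w e by (intro finsum_rdistr) auto
    also have "\<dots> = \<zero>"
    proof (rule finsum_eq_zero)
      fix j assume "j \<in> J"
      then have "e \<otimes> (M i j \<otimes> w j) = (e \<otimes> M i j) \<otimes> w j"
        using insert.prems(3)[of i j] funcset_mem[OF w(1), of j] e by (simp add: m_assoc)
      then show "e \<otimes> (M i j \<otimes> w j) = \<zero>"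
        using False \<open>j \<in> J\<close> funcset_mem[OF w(1), of j] by simp
    qed
    finally show ?thesis using w by auto
  next
    case True
    then obtain k where k: "k \<in> J" "e \<otimes> M i k \<noteq> \<zero>" by blast
    then obtain b where b: "b \<in> carrier R" "e \<otimes> M i k \<otimes> b = e"
      using simple insert.prems by blast
    define c where "c = (\<lambda>i'. \<ominus> (M i' k \<otimes> b))"
    have M: "M i' j \<in> carrier R" if "i' \<in> insert i I" "j \<in> J" for i' j using insert.prems that by blast
    have c: "c i' \<in> carrier R" if "i' \<in> insert i I" for i' using M k b that by (auto simp: c_def)
    have card': "card I < card (J - {k})"
      using insert k by simp
    have "\<exists>w\<in>(J - {k}) \<rightarrow> carrier R. (\<exists>j\<in>J - {k}. e \<otimes> w j \<noteq> \<zero>) \<and>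
        (\<forall>i'\<in>I. e \<otimes> (\<Oplus>j\<in>J - {k}. (M i' j \<oplus> c i' \<otimes> M i j) \<otimes> w j) = \<zero>)"
      by (rule insert.IH) (use insert.prems card' M c in auto)
    then obtain w where w: "w \<in> (J - {k}) \<rightarrow> carrier R" "\<exists>j\<in>J - {k}. e \<otimes> w j \<noteq> \<zero>"
      "\<And>i'. i' \<in> I \<Longrightarrow> e \<otimes> (\<Oplus>j\<in>J - {k}. (M i' j \<oplus> c i' \<otimes> M i j) \<otimes> w j) = \<zero>"
      by blast
    define T where "T = (\<lambda>i'. \<Oplus>j\<in>J - {k}. M i' j \<otimes> w j)"
    have Tcl: "T i' \<in> carrier R" if "i' \<in> insert i I" for i'
      unfolding T_def using that M w(1) by (intro finsum_closed) (auto simp: Pi_iff)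
    define v where "v = (\<lambda>j. if j = k then \<ominus> (b \<otimes> T i) else w j)"
    have v: "v \<in> J \<rightarrow> carrier R" using w(1) b Tcl by (auto simp: v_def Pi_iff)
    have row: "(\<Oplus>j\<in>J. M i' j \<otimes> v j) = M i' k \<otimes> (\<ominus> (b \<otimes> T i)) \<oplus> T i'" if i': "i' \<in> insert i I" for i'
    proof -
      have "(\<Oplus>j\<in>J. M i' j \<otimes> v j) = (\<Oplus>j\<in>insert k (J - {k}). M i' j \<otimes> v j)"
        using k by (simp add: insert_absorb)
      also have "\<dots> = M i' k \<otimes> v k \<oplus> (\<Oplus>j\<in>J - {k}. M i' j \<otimes> v j)"
        using v M[OF i'] insert.prems k by (intro finsum_insert) (auto simp: Pi_iff)
      also have "(\<Oplus>j\<in>J - {k}. M i' j \<otimes> v j) = T i'"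
        unfolding T_def using w(1) M[OF i'] by (intro finsum_cong') (auto simp: v_def Pi_iff)
      finally show ?thesis by (simp add: v_def)
    qed
    have "e \<otimes> (\<Oplus>j\<in>J. M i' j \<otimes> v j) = \<zero>" if i': "i' \<in> insert i I" for i'
    proof (cases "i' = i")
      case True
      have "e \<otimes> (M i k \<otimes> (\<ominus> (b \<otimes> T i)) \<oplus> T i) = e \<otimes> T i \<oplus> \<ominus> ((e \<otimes> M i k \<otimes> b) \<otimes> T i)"
        using b(1) M[of i k] k(1) e(1) Tcl[of i] by (simp add: r_distr r_minus m_assoc a_comm)
      also have "\<dots> = e \<otimes> T i \<oplus> \<ominus> (e \<otimes> T i)"
        by (simp only: b(2))
      also have "\<dots> = \<zero>" using e Tcl[of i] by (simp add: r_neg)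
      finally have "e \<otimes> (M i k \<otimes> (\<ominus> (b \<otimes> T i)) \<oplus> T i) = \<zero>" .
      then show ?thesis using True row[OF i'] by simp
    next
      case False
      then have I: "i' \<in> I" using i' by simp
      have "(\<Oplus>j\<in>J - {k}. (M i' j \<oplus> c i' \<otimes> M i j) \<otimes> w j)
          = (\<Oplus>j\<in>J - {k}. M i' j \<otimes> w j \<oplus> c i' \<otimes> (M i j \<otimes> w j))"
        using w(1) M i' c by (intro finsum_cong') (auto simp: Pi_iff l_distr m_assoc)
      also have "\<dots> = T i' \<oplus> (\<Oplus>j\<in>J - {k}. c i' \<otimes> (M i j \<otimes> w j))"
        unfolding T_def using w(1) M i' c by (intro finsum_addf) (auto simp: Pi_iff)
      also have "(\<Oplus>j\<in>J - {k}. c i' \<otimes> (M i j \<otimes> w j)) = c i' \<otimes> T i"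
        unfolding T_def using w(1) M c[OF i'] insert.prems
        by (intro finsum_rdistr[symmetric]) (auto simp: Pi_iff)
      finally have "e \<otimes> (T i' \<oplus> c i' \<otimes> T i) = \<zero>" using w(3)[OF I] by simp
      moreover have "M i' k \<otimes> (\<ominus> (b \<otimes> T i)) \<oplus> T i' = T i' \<oplus> c i' \<otimes> T i"
        using b M[OF i'] k Tcl[of i] Tcl[OF i'] unfolding c_def by simp algebra
      ultimately show ?thesis using row[OF i'] by simp
    qed
    moreover have "\<exists>j\<in>J. e \<otimes> v j \<noteq> \<zero>" using w(2) by (auto simp: v_def)
    ultimately show ?thesis using v by blast
  qed
qed

context field
begin

lemma homogeneous_system_field:
  fixes M :: "'i \<Rightarrow> 'j \<Rightarrow> 'a"
  assumes "finite I" "finite J" "card I < card J"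
    and M: "\<And>i j. i \<in> I \<Longrightarrow> j \<in> J \<Longrightarrow> M i j \<in> carrier R"
  obtains w where "w \<in> J \<rightarrow> carrier R" "\<exists>j\<in>J. w j \<noteq> \<zero>" "\<And>i. i \<in> I \<Longrightarrow> (\<Oplus>j\<in>J. M i j \<otimes> w j) = \<zero>"
proof -
  have "\<exists>b\<in>carrier R. \<one> \<otimes> a \<otimes> b = \<one>" if "a \<in> carrier R" "\<one> \<otimes> a \<noteq> \<zero>" for a
    using that field_Units by (intro bexI[of _ "inv a"]) auto
  then have "\<exists>w\<in>J \<rightarrow> carrier R. (\<exists>j\<in>J. \<one> \<otimes> w j \<noteq> \<zero>) \<and> (\<forall>i\<in>I. \<one> \<otimes> (\<Oplus>j\<in>J. M i j \<otimes> w j) = \<zero>)"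
    using assms by (intro homogeneous_system) auto
  then obtain w where w: "w\<in>J \<rightarrow> carrier R" "\<exists>j\<in>J. \<one> \<otimes> w j \<noteq> \<zero>" "\<forall>i\<in>I. \<one> \<otimes> (\<Oplus>j\<in>J. M i j \<otimes> w j) = \<zero>"
    by blast
  show ?thesis
  proof (rule that)
    show "\<exists>j\<in>J. w j \<noteq> \<zero>" using w(1,2) by (metis PiE l_one)
    show "(\<Oplus>j\<in>J. M i j \<otimes> w j) = \<zero>" if "i \<in> I" for i
      using w that M l_one[OF finsum_closed[of "\<lambda>j. M i j \<otimes> w j" J]] by (auto simp: Pi_iff)
  qed fact
qed

text \<open>A finite family of functions on \<open>D\<close>, taken from \<open>F\<close>, together with points at which it takes the
  values of the identity matrix. Such pairs replace bases of spaces of functions: both the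
  independence of the functions and the coefficients of an expansion can be read off at the points.\<close>

definition dual_system :: "'x set \<Rightarrow> ('x \<Rightarrow> 'a) set \<Rightarrow> nat \<Rightarrow> (nat \<Rightarrow> 'x \<Rightarrow> 'a) \<Rightarrow> (nat \<Rightarrow> 'x) \<Rightarrow> bool"
  where "dual_system D F t \<phi> u \<longleftrightarrow> (\<forall>i<t. \<phi> i \<in> F \<and> u i \<in> D) \<and>
    (\<forall>i<t. \<forall>j<t. \<phi> i (u j) = (if i = j then \<one> else \<zero>))"

text \<open>The functions of a dual system are linearly independent over \<open>R\<close>, whereas more than \<open>card I\<close>
  combinations of the \<open>b k\<close> are dependent.\<close>

lemma dual_system_bound:
  assumes "dual_system D F t \<phi> u" "finite I"
    and span: "\<And>\<psi>. \<psi> \<in> F \<Longrightarrow> \<exists>c\<in>I \<rightarrow> carrier R. \<forall>x\<in>D. \<psi> x = (\<Oplus>k\<in>I. c k \<otimes> b k x)"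
    and b: "\<And>k x. k \<in> I \<Longrightarrow> x \<in> D \<Longrightarrow> b k x \<in> carrier R"
  shows "t \<le> card I"
proof (rule ccontr)
  assume "\<not> t \<le> card I"
  then have lt: "card I < card {..<t}" by simp
  note ds = assms(1)[unfolded dual_system_def]
  have "\<forall>i\<in>{..<t}. \<exists>c. c \<in> I \<rightarrow> carrier R \<and> (\<forall>x\<in>D. \<phi> i x = (\<Oplus>k\<in>I. c k \<otimes> b k x))"
    using ds span by (metis lessThan_iff)
  from bchoice[OF this] obtain c where c: "\<And>i. i < t \<Longrightarrow> c i \<in> I \<rightarrow> carrier R"
    "\<And>i x. i < t \<Longrightarrow> x \<in> D \<Longrightarrow> \<phi> i x = (\<Oplus>k\<in>I. c i k \<otimes> b k x)"
    by auto
  have c': "c i k \<in> carrier R" if "i < t" "k \<in> I" for i k using c(1) that by blast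
  obtain w where w: "w \<in> {..<t} \<rightarrow> carrier R" "\<exists>j\<in>{..<t}. w j \<noteq> \<zero>"
    "\<And>k. k \<in> I \<Longrightarrow> (\<Oplus>j\<in>{..<t}. c j k \<otimes> w j) = \<zero>"
    using homogeneous_system_field[OF \<open>finite I\<close> finite_lessThan lt, of "\<lambda>k j. c j k"] c' by auto
  then obtain j where j: "j < t" "w j \<noteq> \<zero>" by auto
  have w': "w i \<in> carrier R" if "i < t" for i using w(1) that by auto
  have bj: "b k (u j) \<in> carrier R" if "k \<in> I" for k using b ds j that by blast
  have "w j = (\<Oplus>i\<in>{..<t}. if i = j then w j else \<zero>)"
    using j w' by (subst finsum_delta) auto
  also have "\<dots> = (\<Oplus>i\<in>{..<t}. \<phi> i (u j) \<otimes> w i)"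
    using ds j w' by (intro finsum_cong') auto
  also have "\<dots> = (\<Oplus>i\<in>{..<t}. \<Oplus>k\<in>I. b k (u j) \<otimes> (c i k \<otimes> w i))"
  proof (rule finsum_cong')
    fix i assume "i \<in> {..<t}"
    then have i: "i < t" by simp
    have "\<phi> i (u j) \<otimes> w i = (\<Oplus>k\<in>I. c i k \<otimes> b k (u j)) \<otimes> w i" using c(2)[OF i] ds j by simp
    also have "\<dots> = (\<Oplus>k\<in>I. c i k \<otimes> b k (u j) \<otimes> w i)"
      using c'[OF i] bj w'[OF i] \<open>finite I\<close> by (intro finsum_ldistr) auto
    also have "\<dots> = (\<Oplus>k\<in>I. b k (u j) \<otimes> (c i k \<otimes> w i))"
      using c'[OF i] bj w'[OF i] by (intro finsum_cong') (auto simp: m_ac)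
    finally show "\<phi> i (u j) \<otimes> w i = (\<Oplus>k\<in>I. b k (u j) \<otimes> (c i k \<otimes> w i))" .
  qed (use c' bj w' in \<open>auto intro!: finsum_closed\<close>)
  also have "\<dots> = (\<Oplus>k\<in>I. \<Oplus>i\<in>{..<t}. b k (u j) \<otimes> (c i k \<otimes> w i))"
    using c' bj w' \<open>finite I\<close> by (intro finsum_swap) auto
  also have "\<dots> = \<zero>"
  proof (rule finsum_eq_zero)
    fix k assume k: "k \<in> I"
    have "(\<Oplus>i\<in>{..<t}. b k (u j) \<otimes> (c i k \<otimes> w i)) = b k (u j) \<otimes> (\<Oplus>i\<in>{..<t}. c i k \<otimes> w i)"
      using k c' bj w' by (intro finsum_rdistr[symmetric]) auto
    then show "(\<Oplus>i\<in>{..<t}. b k (u j) \<otimes> (c i k \<otimes> w i)) = \<zero>" using w(3)[OF k] bj[OF k] by simp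
  qed
  finally show False using j by simp
qed

text \<open>Take a dual system of maximal length. Subtracting from \<open>\<psi>\<close> its expansion leaves a function that
  vanishes at all \<open>u i\<close>; if it were nonzero at some \<open>y\<close>, a multiple of it together with \<open>y\<close> would
  prolong the system. The scalars \<open>K\<close> may be smaller than \<open>R\<close> as long as the functions take their
  values in \<open>K\<close>.\<close>

lemma dual_system_spanning:
  assumes K: "subfield K R"
    and val: "\<And>\<psi> x. \<psi> \<in> F \<Longrightarrow> x \<in> D \<Longrightarrow> \<psi> x \<in> K"
    and diff: "\<And>\<psi> \<chi>. \<psi> \<in> F \<Longrightarrow> \<chi> \<in> F \<Longrightarrow> (\<lambda>x. \<psi> x \<ominus> \<chi> x) \<in> F"
    and scale: "\<And>c \<psi>. c \<in> K \<Longrightarrow> \<psi> \<in> F \<Longrightarrow> (\<lambda>x. c \<otimes> \<psi> x) \<in> F"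
    and ext: "\<And>\<psi> \<chi>. \<psi> \<in> F \<Longrightarrow> (\<And>x. x \<in> D \<Longrightarrow> \<chi> x = \<psi> x) \<Longrightarrow> \<chi> \<in> F"
    and bound: "\<And>t \<phi> u. dual_system D F t \<phi> u \<Longrightarrow> t \<le> N"
  obtains t \<phi> u where "dual_system D F t \<phi> u"
    "\<And>\<psi> x. \<psi> \<in> F \<Longrightarrow> x \<in> D \<Longrightarrow> \<psi> x = (\<Oplus>i\<in>{..<t}. \<psi> (u i) \<otimes> \<phi> i x)"
proof -
  interpret K: subfield K R by fact
  have KR: "c \<in> carrier R" if "c \<in> K" for c using that K.subset by blast
  define P where "P = (\<lambda>t. \<exists>\<phi> u. dual_system D F t \<phi> u)"
  have "P 0" by (simp add: P_def dual_system_def)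
  moreover have "\<And>t. P t \<Longrightarrow> t \<le> N" using bound by (auto simp: P_def)
  ultimately have "\<exists>t. P t \<and> (\<forall>s. P s \<longrightarrow> s \<le> t)"
    by (metis GreatestI_nat Greatest_le_nat)
  then obtain t \<phi> u where ds: "dual_system D F t \<phi> u" and max: "\<And>s. P s \<Longrightarrow> s \<le> t"
    by (auto simp: P_def)
  note d = ds[unfolded dual_system_def]
  show ?thesis
  proof (rule that[OF ds], rule ccontr)
    fix \<psi> y assume \<psi>: "\<psi> \<in> F" and y: "y \<in> D" and ne: "\<psi> y \<noteq> (\<Oplus>i\<in>{..<t}. \<psi> (u i) \<otimes> \<phi> i y)"
    have \<phi>K: "\<phi> i x \<in> K" if "i < t" "x \<in> D" for i x using val d that by blast
    have \<psi>K: "\<psi> x \<in> K" if "x \<in> D" for x using val \<psi> that by blast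
    define S where "S = (\<lambda>n x. \<Oplus>i\<in>{..<n::nat}. \<psi> (u i) \<otimes> \<phi> i x)"
    have Scl: "S n x \<in> carrier R" if "n \<le> t" "x \<in> D" for n x
      unfolding S_def using that \<phi>K \<psi>K d KR by (intro finsum_closed) auto
    have "n \<le> t \<Longrightarrow> (\<lambda>x. \<psi> x \<ominus> S n x) \<in> F" for n
    proof (induction n)
      case 0
      show ?case by (rule ext[OF \<psi>]) (use \<psi>K KR in \<open>simp add: S_def minus_eq\<close>)
    next
      case (Suc n)
      have "(\<lambda>x. (\<psi> x \<ominus> S n x) \<ominus> \<psi> (u n) \<otimes> \<phi> n x) \<in> F"
        using Suc d \<psi>K
        by (intro diff[of "\<lambda>x. \<psi> x \<ominus> S n x" "\<lambda>x. \<psi> (u n) \<otimes> \<phi> n x"] scale) auto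
      then show ?case
      proof (rule ext)
        fix x assume x: "x \<in> D"
        have "S (Suc n) x = \<psi> (u n) \<otimes> \<phi> n x \<oplus> S n x"
          unfolding S_def lessThan_Suc using Suc.prems x \<phi>K \<psi>K KR d
          by (subst finsum_insert) auto
        moreover have "\<psi> (u n) \<otimes> \<phi> n x \<in> carrier R" "\<psi> x \<in> carrier R" "S n x \<in> carrier R"
          using Suc.prems x \<phi>K \<psi>K KR d Scl by auto
        ultimately show "\<psi> x \<ominus> S (Suc n) x = (\<psi> x \<ominus> S n x) \<ominus> \<psi> (u n) \<otimes> \<phi> n x"
          by (simp add: minus_eq minus_add a_ac)
      qed
    qed
    then have rF: "(\<lambda>x. \<psi> x \<ominus> S t x) \<in> F" by simp
    define \<rho> where "\<rho> = (\<lambda>x. \<psi> x \<ominus> S t x)"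
    have \<rho>F: "\<rho> \<in> F" using rF by (simp add: \<rho>_def)
    have \<rho>u: "\<rho> (u j) = \<zero>" if j: "j < t" for j
    proof -
      have "S t (u j) = (\<Oplus>i\<in>{..<t}. if i = j then \<psi> (u j) else \<zero>)"
        unfolding S_def using d j \<psi>K KR by (intro finsum_cong') auto
      also have "\<dots> = \<psi> (u j)" using d j \<psi>K KR by (intro finsum_delta) auto
      finally show ?thesis using d j \<psi>K KR by (simp add: \<rho>_def minus_eq r_neg)
    qed
    have \<rho>y: "\<rho> y \<noteq> \<zero>" "\<rho> y \<in> K"
      using ne \<psi>K y KR Scl[of t y] val[OF \<rho>F y] by (auto simp: \<rho>_def S_def)
    define c where "c = inv (\<rho> y)"
    have c: "c \<in> K" "c \<otimes> \<rho> y = \<one>"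
      using subfield_m_inv[OF K, of "\<rho> y"] \<rho>y by (auto simp: c_def)
    define \<sigma> where "\<sigma> = (\<lambda>x. c \<otimes> \<rho> x)"
    have \<sigma>F: "\<sigma> \<in> F" unfolding \<sigma>_def by (rule scale) (use c \<rho>F in auto)
    have \<sigma>y: "\<sigma> y = \<one>" using c by (simp add: \<sigma>_def)
    have \<sigma>u: "\<sigma> (u j) = \<zero>" if "j < t" for j using \<rho>u[OF that] c KR by (simp add: \<sigma>_def)
    \<comment> \<open>The old functions are corrected so that they vanish at the new point.\<close>
    define \<phi>' where "\<phi>' = (\<lambda>i. if i = t then \<sigma> else (\<lambda>x. \<phi> i x \<ominus> \<phi> i y \<otimes> \<sigma> x))"
    define u' where "u' = (\<lambda>i. if i = t then y else u i)"
    have "dual_system D F (Suc t) \<phi>' u'"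
      unfolding dual_system_def
    proof (intro conjI allI impI)
      fix i assume i: "i < Suc t"
      show "\<phi>' i \<in> F"
        unfolding \<phi>'_def using i d \<sigma>F \<phi>K y by (auto intro!: diff scale)
      show "u' i \<in> D" unfolding u'_def using i d y by auto
      fix j assume j: "j < Suc t"
      show "\<phi>' i (u' j) = (if i = j then \<one> else \<zero>)"
        using i j d \<sigma>y \<sigma>u \<phi>K[of i] y KR by (auto simp: \<phi>'_def u'_def less_Suc_eq minus_eq r_neg)
    qed
    then have "Suc t \<le> t" by (intro max) (auto simp: P_def)
    then show False by simp
  qed
qed

end

section \<open>Rings with descending chains of principal ideals\<close>

context cring
begin

text \<open>The descending chain condition on principal ideals, as existence of minimal members: \<open>xR\<close> is minimal
  among the ideals generated by elements of \<open>S\<close> when each multiple of \<open>x\<close> lying in \<open>S\<close> divides \<open>x\<close>.\<close>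

definition principal_dcc :: bool
  where "principal_dcc \<longleftrightarrow> (\<forall>S. S \<subseteq> carrier R \<longrightarrow> S \<noteq> {} \<longrightarrow>
    (\<exists>x\<in>S. \<forall>y\<in>carrier R. x \<otimes> y \<in> S \<longrightarrow> (\<exists>z\<in>carrier R. x \<otimes> y \<otimes> z = x)))"

lemma principal_dccD:
  assumes "principal_dcc" "S \<subseteq> carrier R" "S \<noteq> {}"
  obtains x where "x \<in> S" "\<And>y. y \<in> carrier R \<Longrightarrow> x \<otimes> y \<in> S \<Longrightarrow> \<exists>z\<in>carrier R. x \<otimes> y \<otimes> z = x"
  using assms unfolding principal_dcc_def by meson

text \<open>In a strictly descending chain \<open>x\<^sub>0 R \<supset> x\<^sub>1 R \<supset> \<dots>\<close>, a relation whose first nonzero coefficient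
  \<open>c\<^sub>k\<close> is a unit would express \<open>x\<^sub>k\<close> as a multiple of \<open>x\<^sub>k\<^sub>+\<^sub>1\<close>. Relations of this kind exist when
  \<open>R\<close> is an algebra of dimension at most \<open>N\<close> over a field.\<close>

lemma principal_dccI:
  fixes N :: nat
  assumes dep: "\<And>x. (\<And>i::nat. x i \<in> carrier R) \<Longrightarrow> \<exists>k c. k \<le> N \<and> c k \<in> Units R \<and>
    (\<forall>i<k. c i = \<zero>) \<and> (\<forall>i\<le>N. c i \<in> carrier R) \<and> (\<Oplus>i\<in>{..N}. c i \<otimes> x i) = \<zero>"
  shows "principal_dcc"
  unfolding principal_dcc_def
proof (intro allI impI, rule ccontr)
  fix S assume S: "S \<subseteq> carrier R" "S \<noteq> {}"
    and neg: "\<not> (\<exists>x\<in>S. \<forall>y\<in>carrier R. x \<otimes> y \<in> S \<longrightarrow> (\<exists>z\<in>carrier R. x \<otimes> y \<otimes> z = x))"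
  have step: "\<exists>y. y \<in> carrier R \<and> x \<otimes> y \<in> S \<and> (\<forall>z\<in>carrier R. x \<otimes> y \<otimes> z \<noteq> x)" if x: "x \<in> S" for x
  proof -
    have "\<not> (\<forall>y\<in>carrier R. x \<otimes> y \<in> S \<longrightarrow> (\<exists>z\<in>carrier R. x \<otimes> y \<otimes> z = x))"
      by (rule contrapos_nn[OF neg]) (rule bexI[OF _ x])
    then show ?thesis unfolding Ball_def Bex_def by meson
  qed
  obtain x0 where x0: "x0 \<in> S" using S by blast
  have "\<exists>x. \<forall>i::nat. x i \<in> S \<and> (\<exists>y. y \<in> carrier R \<and> x (Suc i) = x i \<otimes> y \<and> (\<forall>z\<in>carrier R. x i \<otimes> y \<otimes> z \<noteq> x i))"
  proof (rule dependent_nat_choice[of "\<lambda>i x. x \<in> S"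
        "\<lambda>i x x'. \<exists>y. y \<in> carrier R \<and> x' = x \<otimes> y \<and> (\<forall>z\<in>carrier R. x \<otimes> y \<otimes> z \<noteq> x)"])
    show "\<exists>x. x \<in> S" using x0 by (rule exI)
    fix x and i :: nat assume "x \<in> S"
    from step[OF this] show "\<exists>x'. x' \<in> S \<and> (\<exists>y. y \<in> carrier R \<and> x' = x \<otimes> y \<and> (\<forall>z\<in>carrier R. x \<otimes> y \<otimes> z \<noteq> x))"
      by metis
  qed
  then obtain x where xS: "\<And>i::nat. x i \<in> S"
    and x: "\<And>i. \<exists>y. y \<in> carrier R \<and> x (Suc i) = x i \<otimes> y \<and> (\<forall>z\<in>carrier R. x i \<otimes> y \<otimes> z \<noteq> x i)"
    by auto
  have xR: "x i \<in> carrier R" for i using xS S by blast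
  have strict: "x (Suc i) \<otimes> z \<noteq> x i" if "z \<in> carrier R" for i z
    using x[of i] that by metis
  have desc: "\<exists>y\<in>carrier R. x (i + j) = x i \<otimes> y" for i j
  proof (induction j)
    case 0
    then show ?case using xR[of i] by (intro bexI[of _ \<one>]) auto
  next
    case (Suc j)
    then obtain y where y: "y \<in> carrier R" "x (i + j) = x i \<otimes> y" by blast
    obtain y' where y': "y' \<in> carrier R" "x (Suc (i + j)) = x (i + j) \<otimes> y'" using x[of "i + j"] by blast
    show ?case using y y' xR[of i] by (intro bexI[of _ "y \<otimes> y'"]) (auto simp: m_assoc)
  qed
  obtain k c where k: "k \<le> N" "c k \<in> Units R" "\<And>i. i < k \<Longrightarrow> c i = \<zero>" "\<And>i. i \<le> N \<Longrightarrow> c i \<in> carrier R"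
    and sum: "(\<Oplus>i\<in>{..N}. c i \<otimes> x i) = \<zero>"
    using dep[of x] xR by auto
  have "\<exists>y. y \<in> carrier R \<and> c i \<otimes> x i = x (Suc k) \<otimes> y" if i: "i \<in> {..N} - {k}" for i
  proof (cases "i < k")
    case True
    then show ?thesis using k(3) xR by (intro exI[of _ \<zero>]) simp
  next
    case False
    then have "i = Suc k + (i - Suc k)" using i by auto
    then obtain y where "y \<in> carrier R" "x i = x (Suc k) \<otimes> y" using desc[of "Suc k" "i - Suc k"] by metis
    then show ?thesis using xR[of "Suc k"] k(4)[of i] i
      by (intro exI[of _ "c i \<otimes> y"]) (simp add: m_ac)
  qed
  then have "\<forall>i\<in>{..N} - {k}. \<exists>y. y \<in> carrier R \<and> c i \<otimes> x i = x (Suc k) \<otimes> y" by blast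
  from bchoice[OF this] obtain y where y: "\<And>i. i \<in> {..N} - {k} \<Longrightarrow> y i \<in> carrier R"
    "\<And>i. i \<in> {..N} - {k} \<Longrightarrow> c i \<otimes> x i = x (Suc k) \<otimes> y i" by blast
  define s where "s = (\<Oplus>i\<in>{..N} - {k}. y i)"
  have s: "s \<in> carrier R" unfolding s_def using y by (intro finsum_closed) auto
  have "(\<Oplus>i\<in>{..N} - {k}. c i \<otimes> x i) = (\<Oplus>i\<in>{..N} - {k}. x (Suc k) \<otimes> y i)"
    using y xR by (intro finsum_cong') auto
  also have "\<dots> = x (Suc k) \<otimes> s"
    unfolding s_def using y xR by (intro finsum_rdistr[symmetric]) auto
  finally have rest: "(\<Oplus>i\<in>{..N} - {k}. c i \<otimes> x i) = x (Suc k) \<otimes> s" .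
  have "(\<Oplus>i\<in>insert k ({..N} - {k}). c i \<otimes> x i) = c k \<otimes> x k \<oplus> (\<Oplus>i\<in>{..N} - {k}. c i \<otimes> x i)"
    using xR k by (intro finsum_insert) auto
  moreover have "insert k ({..N} - {k}) = {..N}" using k by auto
  ultimately have eq: "c k \<otimes> x k \<oplus> x (Suc k) \<otimes> s = \<zero>" using sum rest by simp
  have ck: "c k \<in> carrier R" "inv (c k) \<in> carrier R" "inv (c k) \<otimes> c k = \<one>"
    using k(1,2,4) by auto
  have "c k \<otimes> x k = \<ominus> (x (Suc k) \<otimes> s)"
    using eq ck(1) xR s by (metis m_closed minus_equality minus_minus)
  then have "x k = inv (c k) \<otimes> (\<ominus> (x (Suc k) \<otimes> s))"
    using ck xR[of k] by (metis l_one m_assoc)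
  also have "\<dots> = x (Suc k) \<otimes> (\<ominus> (inv (c k) \<otimes> s))"
    using ck(2) xR[of "Suc k"] s by (simp add: r_minus m_lcomm)
  finally show False using strict[of "\<ominus> (inv (c k) \<otimes> s)" k] ck(2) s by simp
qed

text \<open>Every nonzero principal ideal contains a minimal one; its generator satisfies the hypothesis
  on \<open>e\<close> in \<open>homogeneous_system\<close>.\<close>

lemma ex_minimal_multiple:
  assumes "principal_dcc" and f: "f \<in> carrier R" "f \<noteq> \<zero>"
  obtains y where "y \<in> carrier R" "f \<otimes> y \<noteq> \<zero>"
    "\<And>a. a \<in> carrier R \<Longrightarrow> f \<otimes> y \<otimes> a \<noteq> \<zero> \<Longrightarrow> \<exists>b\<in>carrier R. f \<otimes> y \<otimes> a \<otimes> b = f \<otimes> y"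
proof -
  define S where "S = {f \<otimes> y | y. y \<in> carrier R \<and> f \<otimes> y \<noteq> \<zero>}"
  have "f \<in> S" unfolding S_def using f by (intro CollectI exI[of _ \<one>]) auto
  then have "S \<noteq> {}" by blast
  moreover have "S \<subseteq> carrier R" unfolding S_def using f by auto
  ultimately obtain g where g: "g \<in> S"
    "\<And>a. a \<in> carrier R \<Longrightarrow> g \<otimes> a \<in> S \<Longrightarrow> \<exists>b\<in>carrier R. g \<otimes> a \<otimes> b = g"
    using principal_dccD[OF assms(1)] by metis
  from g(1) obtain y where y: "y \<in> carrier R" "f \<otimes> y \<noteq> \<zero>" "g = f \<otimes> y" unfolding S_def by blast
  show ?thesis
  proof (rule that)
    fix a assume a: "a \<in> carrier R" "f \<otimes> y \<otimes> a \<noteq> \<zero>"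
    have "g \<otimes> a \<in> S" unfolding S_def using a y f
      by (intro CollectI exI[of _ "y \<otimes> a"]) (auto simp: m_assoc)
    then show "\<exists>b\<in>carrier R. f \<otimes> y \<otimes> a \<otimes> b = f \<otimes> y" using g(2)[OF a(1)] y(3) by simp
  qed (use y in auto)
qed

text \<open>The powers of \<open>a\<close> stabilise: \<open>a\<^sup>n = a\<^sup>n a z\<close> for some \<open>n\<close> and \<open>z\<close>. Hence multiplication by \<open>w = a z\<close>
  fixes \<open>a\<^sup>n\<close>, and \<open>w\<^sup>n\<^sup>+\<^sup>1\<close> is an idempotent multiple of \<open>a\<close> that fixes \<open>a\<^sup>n\<^sup>+\<^sup>1\<close>.\<close>

lemma fitting_idempotent:
  assumes "principal_dcc" and a: "a \<in> carrier R"
  obtains b k where "b \<in> carrier R" "(a \<otimes> b) \<otimes> (a \<otimes> b) = a \<otimes> b"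
    "a [^] (k::nat) \<otimes> (a \<otimes> b) = a [^] k"
proof -
  define S where "S = range (\<lambda>k::nat. a [^] k)"
  have "S \<subseteq> carrier R" "S \<noteq> {}" unfolding S_def using a by auto
  then obtain x where x: "x \<in> S" "\<And>y. y \<in> carrier R \<Longrightarrow> x \<otimes> y \<in> S \<Longrightarrow> \<exists>z\<in>carrier R. x \<otimes> y \<otimes> z = x"
    using principal_dccD[OF assms(1)] by metis
  from x(1) obtain n :: nat where n: "x = a [^] n" unfolding S_def by auto
  have "x \<otimes> a \<in> S" unfolding S_def n by (intro range_eqI[of _ _ "Suc n"]) simp
  then obtain z where z: "z \<in> carrier R" "a [^] n \<otimes> a \<otimes> z = a [^] n"
    using x(2)[OF a] unfolding n by auto
  define k where "k = Suc n"
  define w where "w = a \<otimes> z"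
  have w: "w \<in> carrier R" using a z by (simp add: w_def)
  have pw: "a [^] n \<otimes> w [^] j = a [^] n" for j :: nat
  proof (induction j)
    case (Suc j)
    have "a [^] n \<otimes> w [^] Suc j = (a [^] n \<otimes> w [^] j) \<otimes> w" using a w by (simp add: m_assoc)
    also have "\<dots> = a [^] n" using Suc z a by (simp add: w_def m_assoc)
    finally show ?case .
  qed (use a in simp)
  have pw': "a [^] k \<otimes> w [^] j = a [^] k" for j :: nat
  proof -
    have "a [^] k \<otimes> w [^] j = a \<otimes> (a [^] n \<otimes> w [^] j)"
      using a w by (simp add: k_def m_ac)
    then show ?thesis using pw a by (simp add: k_def m_comm)
  qed
  define b where "b = z \<otimes> w [^] n"
  have b: "b \<in> carrier R" using z w by (simp add: b_def)
  have ab: "a \<otimes> b = w [^] k" using a z w by (simp add: b_def k_def w_def m_ac)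
  have ab': "w [^] k = a [^] k \<otimes> z [^] k" using a z by (simp add: w_def nat_pow_distrib)
  show ?thesis
  proof (rule that[OF b])
    have "w [^] k \<otimes> w [^] k = (a [^] k \<otimes> w [^] k) \<otimes> z [^] k"
      using a z w by (subst ab') (simp add: m_ac)
    also have "\<dots> = w [^] k" by (simp only: pw' ab'[symmetric])
    finally show "(a \<otimes> b) \<otimes> (a \<otimes> b) = a \<otimes> b" by (simp only: ab)
    show "a [^] k \<otimes> (a \<otimes> b) = a [^] k" by (simp only: ab pw')
  qed
qed

text \<open>Choose an idempotent \<open>e\<close> in \<open>S\<close> for which the ideal of \<open>f = \<one> \<ominus> e\<close> is minimal. If \<open>f \<noteq> \<zero>\<close>, some element
  of \<open>S\<close> acts nontrivially on a minimal ideal \<open>gR\<close> inside \<open>fR\<close>, so that a multiple \<open>a\<close> of it in \<open>fR\<close> fixes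
  \<open>g\<close>. This \<open>a\<close> is not nilpotent, and its Fitting idempotent \<open>e'\<close> is nonzero, lies in \<open>S\<close> and is orthogonal
  to \<open>e\<close>. Then \<open>e \<oplus> e' = e e \<oplus> (\<one> \<ominus> e) e'\<close> is a larger idempotent of \<open>S\<close>, against the choice
  of \<open>e\<close>.\<close>

lemma one_mem_of_idempotent_mixing:
  assumes dcc: "principal_dcc"
    and S: "S \<subseteq> carrier R"
    and mult: "\<And>r s. r \<in> carrier R \<Longrightarrow> s \<in> S \<Longrightarrow> r \<otimes> s \<in> S"
    and mix: "\<And>e s s'. e \<in> carrier R \<Longrightarrow> e \<otimes> e = e \<Longrightarrow> s \<in> S \<Longrightarrow> s' \<in> S \<Longrightarrow>
      e \<otimes> s \<oplus> (\<one> \<ominus> e) \<otimes> s' \<in> S"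
    and ann: "\<And>g. g \<in> carrier R \<Longrightarrow> (\<And>s. s \<in> S \<Longrightarrow> g \<otimes> s = \<zero>) \<Longrightarrow> g = \<zero>"
    and ne: "S \<noteq> {}"
  shows "\<one> \<in> S"
proof -
  have SR: "x \<in> carrier R" if "x \<in> S" for x using S that by blast
  define T where "T = {\<one> \<ominus> e | e. e \<in> S \<and> e \<otimes> e = e}"
  obtain s0 where "s0 \<in> S" using ne by blast
  then have "\<zero> \<in> S" using mult[of \<zero> s0] SR by simp
  then have "\<one> \<ominus> \<zero> \<in> T" unfolding T_def by (intro CollectI exI[of _ \<zero>]) auto
  moreover have "T \<subseteq> carrier R" unfolding T_def using SR by auto
  ultimately obtain f where f: "f \<in> T"
    "\<And>y. y \<in> carrier R \<Longrightarrow> f \<otimes> y \<in> T \<Longrightarrow> \<exists>z\<in>carrier R. f \<otimes> y \<otimes> z = f"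
    using principal_dccD[OF dcc, of T] by (metis empty_iff)
  from f(1) obtain e where e: "e \<in> S" "e \<otimes> e = e" "f = \<one> \<ominus> e" unfolding T_def by blast
  have eR: "e \<in> carrier R" using e SR by blast
  have fR: "f \<in> carrier R" using eR e by simp
  have fe: "f \<otimes> e = \<zero>"
  proof -
    have "f \<otimes> e = e \<ominus> e \<otimes> e" using eR unfolding e(3) by algebra
    then show ?thesis using e(2) eR by (simp add: minus_eq r_neg)
  qed
  have ff: "f \<otimes> f = f"
  proof -
    have "f \<otimes> f = f \<ominus> f \<otimes> e" using eR unfolding e(3) by algebra
    then show ?thesis using fe fR by (simp add: minus_eq)
  qed
  show ?thesis
  proof (cases "f = \<zero>")
    case True
    then have "e = \<one>" using e(3) eR by (metis minus_eq minus_equality add.inv_closed a_comm one_closed minus_minus)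
    then show ?thesis using e by simp
  next
    case False
    then obtain y where y: "y \<in> carrier R" "f \<otimes> y \<noteq> \<zero>"
      "\<And>a. a \<in> carrier R \<Longrightarrow> f \<otimes> y \<otimes> a \<noteq> \<zero> \<Longrightarrow> \<exists>b\<in>carrier R. f \<otimes> y \<otimes> a \<otimes> b = f \<otimes> y"
      using ex_minimal_multiple[OF dcc fR] by metis
    define g where "g = f \<otimes> y"
    have gR: "g \<in> carrier R" using y fR by (simp add: g_def)
    have gf: "g \<otimes> f = g"
    proof -
      have "g \<otimes> f = f \<otimes> f \<otimes> y" using y fR by (simp add: g_def m_ac)
      then show ?thesis by (simp add: ff g_def)
    qed
    have "g \<noteq> \<zero>" using y(2) by (simp add: g_def)
    then obtain s where s: "s \<in> S" "g \<otimes> s \<noteq> \<zero>" using ann[OF gR] by blast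
    have sR: "s \<in> carrier R" using s SR by blast
    obtain z where z: "z \<in> carrier R" "g \<otimes> s \<otimes> z = g"
      using y(3)[OF sR] s by (auto simp: g_def)
    define a where "a = f \<otimes> (s \<otimes> z)"
    have aR: "a \<in> carrier R" using fR sR z by (simp add: a_def)
    have ga: "g \<otimes> a = g"
    proof -
      have "g \<otimes> a = (g \<otimes> f) \<otimes> s \<otimes> z" using gR fR sR z by (simp add: a_def m_assoc)
      then show ?thesis by (simp add: gf z)
    qed
    have gak: "g \<otimes> a [^] k = g" for k :: nat
    proof (induction k)
      case (Suc k)
      have "g \<otimes> a [^] Suc k = (g \<otimes> a [^] k) \<otimes> a" using gR aR by (simp add: m_assoc)
      then show ?case by (simp add: Suc ga)
    qed (use gR in simp)
    obtain b k where b: "b \<in> carrier R" "(a \<otimes> b) \<otimes> (a \<otimes> b) = a \<otimes> b" "a [^] (k::nat) \<otimes> (a \<otimes> b) = a [^] k"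
      using fitting_idempotent[OF dcc aR] by metis
    define e' where "e' = a \<otimes> b"
    have e'R: "e' \<in> carrier R" using aR b by (simp add: e'_def)
    have e'0: "e' \<noteq> \<zero>"
    proof
      assume "e' = \<zero>"
      then have "a [^] k = \<zero>" using b(3) aR by (simp add: e'_def)
      then have "g = \<zero>" using gak[of k] gR by simp
      then show False using y by (simp add: g_def)
    qed
    have e'S: "e' \<in> S"
    proof -
      have "e' = (f \<otimes> z \<otimes> b) \<otimes> s" using fR sR z b by (simp add: e'_def a_def m_ac)
      then show ?thesis using mult s(1) fR z b by simp
    qed
    have fe': "f \<otimes> e' = e'"
    proof -
      have "f \<otimes> e' = (f \<otimes> f) \<otimes> (s \<otimes> z \<otimes> b)" using fR sR z b by (simp add: e'_def a_def m_ac)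
      also have "\<dots> = e'" using fR sR z b by (simp only: ff) (simp add: e'_def a_def m_ac)
      finally show ?thesis .
    qed
    have ee': "e \<otimes> e' = \<zero>"
    proof -
      have "e \<otimes> e' = (f \<otimes> e) \<otimes> e'" using fe' eR fR e'R by (metis m_assoc m_comm)
      then show ?thesis using fe e'R by simp
    qed
    define d where "d = e \<oplus> e'"
    have dR: "d \<in> carrier R" using eR e'R by (simp add: d_def)
    have "d = e \<otimes> e \<oplus> (\<one> \<ominus> e) \<otimes> e'" using fe' by (simp add: d_def e(2) flip: e(3))
    then have dS: "d \<in> S" using mix[OF eR e(2) e(1) e'S] by simp
    have dd: "d \<otimes> d = d"
    proof -
      have "d \<otimes> d = e \<otimes> e \<oplus> e \<otimes> e' \<oplus> (e \<otimes> e' \<oplus> e' \<otimes> e')"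
        unfolding d_def using eR e'R by (simp add: l_distr r_distr m_comm a_assoc)
      then show ?thesis using ee' e(2) b(2) eR e'R by (simp add: d_def e'_def[symmetric])
    qed
    have "f \<otimes> (\<one> \<ominus> e') = \<one> \<ominus> d"
    proof -
      have "f \<otimes> (\<one> \<ominus> e') = f \<ominus> f \<otimes> e'" using fR e'R by algebra
      also have "\<dots> = \<one> \<ominus> d" unfolding fe' unfolding e(3) d_def using eR e'R by algebra
      finally show ?thesis .
    qed
    then have "f \<otimes> (\<one> \<ominus> e') \<in> T" unfolding T_def using dS dd by auto
    then obtain w where w: "w \<in> carrier R" "f \<otimes> (\<one> \<ominus> e') \<otimes> w = f"
      using f(2)[of "\<one> \<ominus> e'"] e'R by auto
    have "e' = (f \<otimes> (\<one> \<ominus> e') \<otimes> w) \<otimes> e'" using w fe' by simp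
    also have "\<dots> = f \<otimes> w \<otimes> (e' \<ominus> e' \<otimes> e')" using fR w(1) e'R by algebra
    also have "\<dots> = \<zero>" using b(2) e'R fR w(1) by (simp add: e'_def[symmetric] minus_eq r_neg)
    finally show ?thesis using e'0 by simp
  qed
qed

end

section \<open>Free systems in a module\<close>

context module
begin

definition linear_form :: "('c \<Rightarrow> 'a) \<Rightarrow> bool"
  where "linear_form f \<longleftrightarrow> f \<in> carrier M \<rightarrow> carrier R \<and>
    (\<forall>x\<in>carrier M. \<forall>y\<in>carrier M. f (x \<oplus>\<^bsub>M\<^esub> y) = f x \<oplus> f y) \<and>
    (\<forall>a\<in>carrier R. \<forall>x\<in>carrier M. f (a \<odot>\<^bsub>M\<^esub> x) = a \<otimes> f x)"

lemma linear_form_closed [intro, simp]: "linear_form f \<Longrightarrow> x \<in> carrier M \<Longrightarrow> f x \<in> carrier R"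
  by (auto simp: linear_form_def)

lemma linear_form_add: "linear_form f \<Longrightarrow> x \<in> carrier M \<Longrightarrow> y \<in> carrier M \<Longrightarrow> f (x \<oplus>\<^bsub>M\<^esub> y) = f x \<oplus> f y"
  by (auto simp: linear_form_def)

lemma linear_form_smult: "linear_form f \<Longrightarrow> a \<in> carrier R \<Longrightarrow> x \<in> carrier M \<Longrightarrow> f (a \<odot>\<^bsub>M\<^esub> x) = a \<otimes> f x"
  by (auto simp: linear_form_def)

lemma linear_form_zero: "linear_form f \<Longrightarrow> f \<zero>\<^bsub>M\<^esub> = \<zero>"
  using linear_form_smult[of f \<zero> "\<zero>\<^bsub>M\<^esub>"] by simp

lemma linear_form_finsum:
  assumes "linear_form f" "\<And>i. i \<in> I \<Longrightarrow> x i \<in> carrier M"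
  shows "f (\<Oplus>\<^bsub>M\<^esub>i\<in>I. x i) = (\<Oplus>i\<in>I. f (x i))"
  using assms by (intro additive_finsum R.abelian_group_axioms M.abelian_group_axioms)
    (auto simp: linear_form_add)

lemma linear_form_minus:
  assumes "linear_form f" "x \<in> carrier M" "y \<in> carrier M"
  shows "f (x \<ominus>\<^bsub>M\<^esub> y) = f x \<ominus> f y"
proof -
  have "f (\<ominus>\<^bsub>M\<^esub> y) = \<ominus> f y"
    using linear_form_smult[OF assms(1), of "\<ominus> \<one>" y] assms
    by (simp add: smult_l_minus R.l_minus)
  then show ?thesis using assms by (simp add: M.minus_eq R.minus_eq linear_form_add)
qed

text \<open>The set of values of linear forms on \<open>N\<close> is closed under multiples, and it can be mixed along
  an idempotent \<open>e\<close>: with \<open>f = \<one> \<ominus> e\<close>, the form \<open>e \<beta> + f \<beta>'\<close> takes at \<open>e q + f q'\<close> the value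
  \<open>e \<beta>(q) + f \<beta>'(q')\<close>. An element that annihilates all these values kills \<open>N\<close>, because forms
  separate the points of \<open>M\<close>, and so it is zero.\<close>

lemma ex_unimodular:
  assumes dcc: "principal_dcc"
    and N: "Module.submodule N R M"
    and sep: "\<And>x. x \<in> carrier M \<Longrightarrow> (\<And>\<beta>. linear_form \<beta> \<Longrightarrow> \<beta> x = \<zero>) \<Longrightarrow> x = \<zero>\<^bsub>M\<^esub>"
    and faithful: "\<And>a. a \<in> carrier R \<Longrightarrow> (\<And>x. x \<in> N \<Longrightarrow> a \<odot>\<^bsub>M\<^esub> x = \<zero>\<^bsub>M\<^esub>) \<Longrightarrow> a = \<zero>"
  obtains \<beta> q where "linear_form \<beta>" "q \<in> N" "\<beta> q = \<one>"
proof -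
  note Nr = submoduleE[OF N]
  have NM: "x \<in> carrier M" if "x \<in> N" for x using Nr(1) that by blast
  define S where "S = {\<beta> q | \<beta> q. linear_form \<beta> \<and> q \<in> N}"
  have "\<one> \<in> S"
  proof (rule R.one_mem_of_idempotent_mixing[OF dcc])
    show "S \<subseteq> carrier R" unfolding S_def using NM by auto
    show "S \<noteq> {}"
    proof -
      have "linear_form (\<lambda>_. \<zero>)" by (auto simp: linear_form_def)
      then show ?thesis using Nr(2) unfolding S_def by auto
    qed
    fix r s assume rs: "r \<in> carrier R" "s \<in> S"
    then obtain \<beta> q where q: "linear_form \<beta>" "q \<in> N" "s = \<beta> q" unfolding S_def by blast
    then have "r \<otimes> s = \<beta> (r \<odot>\<^bsub>M\<^esub> q)" using rs NM by (simp add: linear_form_smult)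
    then show "r \<otimes> s \<in> S" unfolding S_def using q Nr(4)[OF rs(1) q(2)] by blast
  next
    fix e s s' assume e: "e \<in> carrier R" "e \<otimes> e = e" and s: "s \<in> S" "s' \<in> S"
    then obtain \<beta> q \<beta>' q' where q: "linear_form \<beta>" "q \<in> N" "s = \<beta> q"
      "linear_form \<beta>'" "q' \<in> N" "s' = \<beta>' q'" unfolding S_def by blast
    define f where "f = \<one> \<ominus> e"
    have f: "f \<in> carrier R" "e \<otimes> f = \<zero>" "f \<otimes> f = f"
    proof -
      show fR: "f \<in> carrier R" using e by (simp add: f_def)
      have "e \<otimes> f = e \<ominus> e \<otimes> e" using e(1) unfolding f_def by algebra
      then show ef: "e \<otimes> f = \<zero>" using e by (simp add: R.minus_eq R.r_neg)
      have "f \<otimes> f = f \<ominus> e \<otimes> f" using e(1) unfolding f_def by algebra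
      then show "f \<otimes> f = f" using ef fR by (simp add: R.minus_eq)
    qed
    define \<gamma> where "\<gamma> = (\<lambda>x. e \<otimes> \<beta> x \<oplus> f \<otimes> \<beta>' x)"
    have \<gamma>: "linear_form \<gamma>"
      unfolding linear_form_def
    proof (intro conjI ballI funcsetI)
      fix x assume x: "x \<in> carrier M"
      show "\<gamma> x \<in> carrier R" using x q e f by (simp add: \<gamma>_def)
      { fix y assume y: "y \<in> carrier M"
        have "\<beta> x \<in> carrier R" "\<beta> y \<in> carrier R" "\<beta>' x \<in> carrier R" "\<beta>' y \<in> carrier R" using x y q by auto
        then show "\<gamma> (x \<oplus>\<^bsub>M\<^esub> y) = \<gamma> x \<oplus> \<gamma> y"
          using x y q e(1) f(1) by (simp add: \<gamma>_def linear_form_add R.r_distr R.a_ac) }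
      { fix a assume a: "a \<in> carrier R"
        have "\<beta> x \<in> carrier R" "\<beta>' x \<in> carrier R" using x q by auto
        then show "\<gamma> (a \<odot>\<^bsub>M\<^esub> x) = a \<otimes> \<gamma> x"
          using x a q e(1) f(1) by (simp add: \<gamma>_def linear_form_smult R.r_distr R.m_ac) }
    qed
    define r where "r = e \<odot>\<^bsub>M\<^esub> q \<oplus>\<^bsub>M\<^esub> f \<odot>\<^bsub>M\<^esub> q'"
    have r: "r \<in> N" unfolding r_def using Nr(4,5) e(1) f(1) q by blast
    have \<beta>R: "\<beta> q \<in> carrier R" "\<beta> q' \<in> carrier R" "\<beta>' q \<in> carrier R" "\<beta>' q' \<in> carrier R" using NM q by auto
    have "\<gamma> r = e \<otimes> (e \<otimes> \<beta> q \<oplus> f \<otimes> \<beta> q') \<oplus> f \<otimes> (e \<otimes> \<beta>' q \<oplus> f \<otimes> \<beta>' q')"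
      unfolding \<gamma>_def r_def using q NM e f by (simp add: linear_form_add linear_form_smult)
    also have "\<dots> = (e \<otimes> e) \<otimes> \<beta> q \<oplus> (e \<otimes> f) \<otimes> \<beta> q' \<oplus> ((e \<otimes> f) \<otimes> \<beta>' q \<oplus> (f \<otimes> f) \<otimes> \<beta>' q')"
      using \<beta>R e(1) f(1) by algebra
    also have "\<dots> = e \<otimes> s \<oplus> f \<otimes> s'" unfolding e(2) f(2,3) using \<beta>R q e f by simp
    finally show "e \<otimes> s \<oplus> (\<one> \<ominus> e) \<otimes> s' \<in> S" unfolding S_def f_def[symmetric] using \<gamma> r by (metis (mono_tags, lifting) CollectI)
  next
    fix g assume g: "g \<in> carrier R" "\<And>s. s \<in> S \<Longrightarrow> g \<otimes> s = \<zero>"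
    show "g = \<zero>"
    proof (rule faithful[OF g(1)])
      fix x assume x: "x \<in> N"
      show "g \<odot>\<^bsub>M\<^esub> x = \<zero>\<^bsub>M\<^esub>"
      proof (rule sep)
        fix \<beta> assume \<beta>: "linear_form \<beta>"
        have "\<beta> x \<in> S" unfolding S_def using \<beta> x by blast
        then show "\<beta> (g \<odot>\<^bsub>M\<^esub> x) = \<zero>" using g \<beta> NM[OF x] by (simp add: linear_form_smult)
      qed (use g NM[OF x] in simp)
    qed
  qed
  then obtain \<beta> q where "linear_form \<beta>" "q \<in> N" "\<beta> q = \<one>" unfolding S_def by auto
  then show ?thesis by (rule that)
qed

text \<open>Elements together with forms dual to them: the data that splits off a free submodule of rank \<open>m\<close>,
  with projection \<open>system_proj\<close> onto it.\<close>

definition free_system :: "nat \<Rightarrow> (nat \<Rightarrow> 'c) \<Rightarrow> (nat \<Rightarrow> 'c \<Rightarrow> 'a) \<Rightarrow> bool"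
  where "free_system m p \<alpha> \<longleftrightarrow> (\<forall>i<m. p i \<in> carrier M \<and> linear_form (\<alpha> i)) \<and>
    (\<forall>i<m. \<forall>j<m. \<alpha> i (p j) = (if i = j then \<one> else \<zero>))"

definition system_proj :: "nat \<Rightarrow> (nat \<Rightarrow> 'c) \<Rightarrow> (nat \<Rightarrow> 'c \<Rightarrow> 'a) \<Rightarrow> 'c \<Rightarrow> 'c"
  where "system_proj m p \<alpha> x = (\<Oplus>\<^bsub>M\<^esub>i\<in>{..<m}. \<alpha> i x \<odot>\<^bsub>M\<^esub> p i)"

context
  fixes m p \<alpha>
  assumes fs: "free_system m p \<alpha>"
begin

lemma free_systemD: "i < m \<Longrightarrow> p i \<in> carrier M" "i < m \<Longrightarrow> linear_form (\<alpha> i)"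
  "i < m \<Longrightarrow> j < m \<Longrightarrow> \<alpha> i (p j) = (if i = j then \<one> else \<zero>)"
  using fs by (auto simp: free_system_def)

lemma system_proj_closed: "x \<in> carrier M \<Longrightarrow> system_proj m p \<alpha> x \<in> carrier M"
  unfolding system_proj_def using free_systemD by (intro M.finsum_closed) auto

lemma system_proj_add:
  assumes "x \<in> carrier M" "y \<in> carrier M"
  shows "system_proj m p \<alpha> (x \<oplus>\<^bsub>M\<^esub> y) = system_proj m p \<alpha> x \<oplus>\<^bsub>M\<^esub> system_proj m p \<alpha> y"
proof -
  have "system_proj m p \<alpha> (x \<oplus>\<^bsub>M\<^esub> y) = (\<Oplus>\<^bsub>M\<^esub>i\<in>{..<m}. \<alpha> i x \<odot>\<^bsub>M\<^esub> p i \<oplus>\<^bsub>M\<^esub> \<alpha> i y \<odot>\<^bsub>M\<^esub> p i)"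
    unfolding system_proj_def using free_systemD assms
    by (intro M.finsum_cong') (auto simp: linear_form_add smult_l_distr)
  also have "\<dots> = system_proj m p \<alpha> x \<oplus>\<^bsub>M\<^esub> system_proj m p \<alpha> y"
    unfolding system_proj_def using free_systemD assms by (intro M.finsum_addf) auto
  finally show ?thesis .
qed

lemma system_proj_smult:
  assumes "x \<in> carrier M" "a \<in> carrier R"
  shows "system_proj m p \<alpha> (a \<odot>\<^bsub>M\<^esub> x) = a \<odot>\<^bsub>M\<^esub> system_proj m p \<alpha> x"
proof -
  have "system_proj m p \<alpha> (a \<odot>\<^bsub>M\<^esub> x) = (\<Oplus>\<^bsub>M\<^esub>i\<in>{..<m}. a \<odot>\<^bsub>M\<^esub> (\<alpha> i x \<odot>\<^bsub>M\<^esub> p i))"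
    unfolding system_proj_def using free_systemD assms
    by (intro M.finsum_cong') (auto simp: linear_form_smult smult_assoc1)
  also have "\<dots> = a \<odot>\<^bsub>M\<^esub> system_proj m p \<alpha> x"
    unfolding system_proj_def using free_systemD assms
    by (intro finsum_smult_ldistr[symmetric]) auto
  finally show ?thesis .
qed

lemma system_proj_base:
  assumes "j < m" shows "system_proj m p \<alpha> (p j) = p j"
proof -
  have "system_proj m p \<alpha> (p j) = (\<Oplus>\<^bsub>M\<^esub>i\<in>{..<m}. if i = j then p j else \<zero>\<^bsub>M\<^esub>)"
    unfolding system_proj_def using free_systemD assms by (intro M.finsum_cong') auto
  then show ?thesis using M.finsum_delta[of "{..<m}" j "p j"] free_systemD assms by simp
qed

lemma form_system_proj:
  assumes "j < m" "x \<in> carrier M" shows "\<alpha> j (system_proj m p \<alpha> x) = \<alpha> j x"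
proof -
  have "\<alpha> j (system_proj m p \<alpha> x) = (\<Oplus>i\<in>{..<m}. \<alpha> j (\<alpha> i x \<odot>\<^bsub>M\<^esub> p i))"
    unfolding system_proj_def using free_systemD assms by (intro linear_form_finsum) auto
  also have "\<dots> = (\<Oplus>i\<in>{..<m}. if i = j then \<alpha> j x else \<zero>)"
    using free_systemD assms by (intro R.finsum_cong') (auto simp: linear_form_smult)
  also have "\<dots> = \<alpha> j x" using assms free_systemD by (intro R.finsum_delta) auto
  finally show ?thesis .
qed

lemma system_proj_zero:
  assumes "\<And>i. i < m \<Longrightarrow> \<alpha> i x = \<zero>" shows "system_proj m p \<alpha> x = \<zero>\<^bsub>M\<^esub>"
  unfolding system_proj_def using assms free_systemD by (intro M.finsum_eq_zero) auto

lemma submodule_common_kernel: "Module.submodule {x \<in> carrier M. \<forall>i<m. \<alpha> i x = \<zero>} R M"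
proof (rule submoduleI)
  fix a assume a: "a \<in> {x \<in> carrier M. \<forall>i<m. \<alpha> i x = \<zero>}"
  have "\<alpha> i (\<ominus>\<^bsub>M\<^esub> a) = \<zero>" if "i < m" for i
    using linear_form_minus[OF free_systemD(2)[OF that], of "\<zero>\<^bsub>M\<^esub>" a] a that
      linear_form_zero[OF free_systemD(2)[OF that]]
    by (simp add: M.minus_eq R.minus_eq)
  then show "\<ominus>\<^bsub>M\<^esub> a \<in> {x \<in> carrier M. \<forall>i<m. \<alpha> i x = \<zero>}" using a by simp
qed (auto simp: linear_form_zero free_systemD linear_form_add linear_form_smult)

text \<open>Composing \<open>\<beta>\<close> with the projection onto the complement of the free part makes it vanish at the
  \<open>p j\<close> and does not change its value at \<open>q\<close>, which lies in that complement.\<close>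

lemma free_system_extend:
  assumes \<beta>: "linear_form \<beta>" and q: "q \<in> carrier M" "\<And>i. i < m \<Longrightarrow> \<alpha> i q = \<zero>" "\<beta> q = \<one>"
  shows "\<exists>p' \<alpha>'. free_system (Suc m) p' \<alpha>'"
proof -
  define \<pi> where "\<pi> = system_proj m p \<alpha>"
  define \<gamma> where "\<gamma> = (\<lambda>x. \<beta> x \<ominus> \<beta> (\<pi> x))"
  have \<pi>: "\<pi> x \<in> carrier M" if "x \<in> carrier M" for x using system_proj_closed that by (simp add: \<pi>_def)
  have \<gamma>: "linear_form \<gamma>"
    unfolding linear_form_def
  proof (intro conjI ballI funcsetI)
    fix x assume x: "x \<in> carrier M"
    show "\<gamma> x \<in> carrier R" using x \<beta> \<pi> by (simp add: \<gamma>_def)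
    { fix y assume y: "y \<in> carrier M"
      have "\<beta> x \<in> carrier R" "\<beta> y \<in> carrier R" "\<beta> (\<pi> x) \<in> carrier R" "\<beta> (\<pi> y) \<in> carrier R" using x y \<beta> \<pi> by auto
      moreover have "\<gamma> (x \<oplus>\<^bsub>M\<^esub> y) = \<beta> x \<oplus> \<beta> y \<ominus> (\<beta> (\<pi> x) \<oplus> \<beta> (\<pi> y))"
        using x y \<beta> \<pi> system_proj_add[OF x y] by (simp add: \<gamma>_def linear_form_add \<pi>_def[symmetric])
      ultimately show "\<gamma> (x \<oplus>\<^bsub>M\<^esub> y) = \<gamma> x \<oplus> \<gamma> y"
        by (simp add: \<gamma>_def R.minus_eq R.minus_add R.a_ac) }
    { fix a assume a: "a \<in> carrier R"
      have "\<beta> x \<in> carrier R" "\<beta> (\<pi> x) \<in> carrier R" using x \<beta> \<pi> by auto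
      moreover have "\<gamma> (a \<odot>\<^bsub>M\<^esub> x) = a \<otimes> \<beta> x \<ominus> a \<otimes> \<beta> (\<pi> x)"
        using x a \<beta> \<pi> system_proj_smult[OF x a] by (simp add: \<gamma>_def linear_form_smult \<pi>_def[symmetric])
      ultimately show "\<gamma> (a \<odot>\<^bsub>M\<^esub> x) = a \<otimes> \<gamma> x"
        using a by (simp add: \<gamma>_def R.minus_eq R.r_distr R.r_minus) }
  qed
  have \<gamma>q: "\<gamma> q = \<one>" using system_proj_zero[of q] q linear_form_zero[OF \<beta>] by (simp add: \<gamma>_def \<pi>_def R.minus_eq)
  have \<gamma>p: "\<gamma> (p j) = \<zero>" if "j < m" for j
    using system_proj_base[OF that] \<beta> free_systemD(1)[OF that] by (simp add: \<gamma>_def \<pi>_def R.minus_eq R.r_neg)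
  have "free_system (Suc m) (p(m := q)) (\<alpha>(m := \<gamma>))"
    unfolding free_system_def using q \<gamma> \<gamma>q \<gamma>p free_systemD by (auto simp: less_Suc_eq)
  then show ?thesis by blast
qed

end

text \<open>In a free system of maximal length the common kernel of the forms cannot be faithful, for otherwise
  \<open>ex_unimodular\<close> would provide one more member.\<close>

lemma ex_maximal_free_system:
  assumes dcc: "principal_dcc"
    and bound: "\<And>m p \<alpha>. free_system m p \<alpha> \<Longrightarrow> m \<le> d"
    and sep: "\<And>x. x \<in> carrier M \<Longrightarrow> (\<And>\<beta>. linear_form \<beta> \<Longrightarrow> \<beta> x = \<zero>) \<Longrightarrow> x = \<zero>\<^bsub>M\<^esub>"
  obtains m p \<alpha> e where "free_system m p \<alpha>" "e \<in> carrier R" "e \<noteq> \<zero>"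
    "\<And>x. x \<in> carrier M \<Longrightarrow> (\<And>i. i < m \<Longrightarrow> \<alpha> i x = \<zero>) \<Longrightarrow> e \<odot>\<^bsub>M\<^esub> x = \<zero>\<^bsub>M\<^esub>"
proof -
  define P where "P = (\<lambda>m. \<exists>p \<alpha>. free_system m p \<alpha>)"
  have "P 0" by (simp add: P_def free_system_def)
  moreover have "\<And>m. P m \<Longrightarrow> m \<le> d" using bound by (auto simp: P_def)
  ultimately have "\<exists>m. P m \<and> (\<forall>s. P s \<longrightarrow> s \<le> m)"
    by (metis GreatestI_nat Greatest_le_nat)
  then obtain m p \<alpha> where fs: "free_system m p \<alpha>" and max: "\<And>s. P s \<Longrightarrow> s \<le> m"
    by (auto simp: P_def)
  define N where "N = {x \<in> carrier M. \<forall>i<m. \<alpha> i x = \<zero>}"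
  have N: "Module.submodule N R M" unfolding N_def by (rule submodule_common_kernel[OF fs])
  have "\<exists>e\<in>carrier R. (\<forall>x\<in>N. e \<odot>\<^bsub>M\<^esub> x = \<zero>\<^bsub>M\<^esub>) \<and> e \<noteq> \<zero>"
  proof (rule ccontr)
    assume "\<not> (\<exists>e\<in>carrier R. (\<forall>x\<in>N. e \<odot>\<^bsub>M\<^esub> x = \<zero>\<^bsub>M\<^esub>) \<and> e \<noteq> \<zero>)"
    then obtain \<gamma> r where "linear_form \<gamma>" "r \<in> N" "\<gamma> r = \<one>"
      using ex_unimodular[OF dcc N sep] by blast
    then have "P (Suc m)" using free_system_extend[OF fs, of \<gamma> r] by (auto simp: N_def P_def)
    then show False using max by fastforce
  qed
  then show ?thesis using that[OF fs] by (auto simp: N_def)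
qed

end

section \<open>Galois bimodules in coordinates\<close>

lemma (in abelian_group) finsum_Sigma:
  assumes "finite I" "finite J" "\<And>i j. i \<in> I \<Longrightarrow> j \<in> J \<Longrightarrow> f i j \<in> carrier G"
  shows "(\<Oplus>i\<in>I. \<Oplus>j\<in>J. f i j) = (\<Oplus>x\<in>I \<times> J. f (fst x) (snd x))"
  using assms(1,3)
proof (induction I rule: finite_induct)
  case empty
  then show ?case by simp
next
  case (insert a I)
  have "(\<Oplus>x\<in>insert a I \<times> J. f (fst x) (snd x)) = (\<Oplus>x\<in>({a} \<times> J) \<union> (I \<times> J). f (fst x) (snd x))"
    by (rule arg_cong[of _ _ "finsum G _"]) auto
  also have "\<dots> = (\<Oplus>x\<in>{a} \<times> J. f (fst x) (snd x)) \<oplus> (\<Oplus>x\<in>I \<times> J. f (fst x) (snd x))"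
    using insert assms(2) by (intro finsum_Un_disjoint) auto
  also have "(\<Oplus>x\<in>{a} \<times> J. f (fst x) (snd x)) = (\<Oplus>x\<in>Pair a ` J. f (fst x) (snd x))"
    by (rule arg_cong[of _ _ "finsum G _"]) auto
  also have "\<dots> = (\<Oplus>j\<in>J. f a j)"
    using insert by (subst finsum_reindex) (auto simp: inj_on_def)
  also have "(\<Oplus>x\<in>I \<times> J. f (fst x) (snd x)) = (\<Oplus>i\<in>I. \<Oplus>j\<in>J. f i j)"
    using insert by auto
  finally show ?case
    using insert by (subst finsum_insert) (auto intro!: finsum_closed)
qed

text \<open>A basis of a finite-dimensional space with its coordinate functions, in the form of a free system
  whose projection is the identity.\<close>

lemma (in vectorspace) ex_coordinates:
  assumes fin_dim "dim = d"
  obtains b h where "free_system d b h" "\<And>v. v \<in> carrier V \<Longrightarrow> system_proj d b h v = v"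
proof -
  obtain A where A: "finite A" "basis A" using finite_basis_exists assms by blast
  have AV: "A \<subseteq> carrier V" using A by (simp add: basis_def)
  have card: "card A = d" using dim_basis[OF A] assms by simp
  note crit = basis_criterion[OF A(1) AV, THEN iffD1, OF A(2), rule_format]
  have uniq: "a x = a' x" if "a \<in> A \<rightarrow> carrier K" "a' \<in> A \<rightarrow> carrier K" "lincomb a A = lincomb a' A" "x \<in> A" for a a' x
  proof -
    have "lincomb (restrict a A) A = lincomb a A" "lincomb (restrict a' A) A = lincomb a' A"
      by (rule lincomb_cong; use AV that in auto)+
    moreover have "lincomb a A \<in> carrier V" using AV that A by auto
    ultimately have "restrict a A = restrict a' A"
      using crit[of "lincomb a A"] that(1-3) by (metis restrict_PiE_iff PiE)
    then show ?thesis using that(4) by (metis restrict_apply')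
  qed
  define co where "co = (\<lambda>v. SOME a. a \<in> A \<rightarrow>\<^sub>E carrier K \<and> lincomb a A = v)"
  have co: "co v \<in> A \<rightarrow> carrier K" "lincomb (co v) A = v" if "v \<in> carrier V" for v
    using someI_ex[OF ex1_implies_ex[OF crit[OF that]]] by (auto simp: co_def PiE_def)
  obtain e where e: "bij_betw e {..<d} A"
    using ex_bij_betw_nat_finite[OF A(1)] card by (auto simp: atLeast0LessThan)
  have eA: "e i \<in> A" if "i < d" for i using e that by (auto simp: bij_betw_def)
  define h where "h = (\<lambda>i v. co v (e i))"
  have lc: "lincomb c A = (\<Oplus>\<^bsub>V\<^esub>i\<in>{..<d}. c (e i) \<odot>\<^bsub>V\<^esub> e i)" if "c \<in> A \<rightarrow> carrier K" for c
  proof -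
    have "lincomb c A = (\<Oplus>\<^bsub>V\<^esub>v\<in>e ` {..<d}. c v \<odot>\<^bsub>V\<^esub> v)" using e by (simp add: lincomb_def bij_betw_def)
    also have "\<dots> = (\<Oplus>\<^bsub>V\<^esub>i\<in>{..<d}. c (e i) \<odot>\<^bsub>V\<^esub> e i)"
      using e AV that by (subst M.finsum_reindex) (auto simp: bij_betw_def)
    finally show ?thesis .
  qed
  show ?thesis
  proof (rule that)
    show "free_system d e h"
      unfolding free_system_def
    proof (intro conjI allI impI)
      fix i assume i: "i < d"
      show "e i \<in> carrier V" using eA[OF i] AV by blast
      show "linear_form (h i)"
        unfolding linear_form_def
      proof (intro conjI ballI funcsetI)
        fix v assume v: "v \<in> carrier V"
        show "h i v \<in> carrier K" using co(1)[OF v] eA[OF i] by (auto simp: h_def)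
        { fix w assume w: "w \<in> carrier V"
          have "co (v \<oplus>\<^bsub>V\<^esub> w) (e i) = co v (e i) \<oplus>\<^bsub>K\<^esub> co w (e i)"
          proof (rule uniq)
            show "lincomb (co (v \<oplus>\<^bsub>V\<^esub> w)) A = lincomb (\<lambda>x. co v x \<oplus>\<^bsub>K\<^esub> co w x) A"
              using lincomb_sum[OF A(1) AV co(1)[OF v] co(1)[OF w]] v w by (simp add: co)
            show "co (v \<oplus>\<^bsub>V\<^esub> w) \<in> A \<rightarrow> carrier K" using co v w by simp
            show "(\<lambda>x. co v x \<oplus>\<^bsub>K\<^esub> co w x) \<in> A \<rightarrow> carrier K" using co(1)[OF v] co(1)[OF w] by auto
          qed (use eA i in auto)
          then show "h i (v \<oplus>\<^bsub>V\<^esub> w) = h i v \<oplus>\<^bsub>K\<^esub> h i w" by (simp add: h_def) }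
        { fix a assume a: "a \<in> carrier K"
          have "co (a \<odot>\<^bsub>V\<^esub> v) (e i) = a \<otimes>\<^bsub>K\<^esub> co v (e i)"
          proof (rule uniq)
            show "lincomb (co (a \<odot>\<^bsub>V\<^esub> v)) A = lincomb (\<lambda>x. a \<otimes>\<^bsub>K\<^esub> co v x) A"
              using lincomb_smult[OF AV co(1)[OF v] a] v a by (simp add: co)
            show "co (a \<odot>\<^bsub>V\<^esub> v) \<in> A \<rightarrow> carrier K" using co v a by simp
            show "(\<lambda>x. a \<otimes>\<^bsub>K\<^esub> co v x) \<in> A \<rightarrow> carrier K" using co(1)[OF v] a by auto
          qed (use eA i in auto)
          then show "h i (a \<odot>\<^bsub>V\<^esub> v) = a \<otimes>\<^bsub>K\<^esub> h i v" by (simp add: h_def) }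
      qed
      fix j assume j: "j < d"
      have ejV: "e j \<in> carrier V" using eA[OF j] AV by blast
      have "co (e j) (e i) = (if e i = e j then \<one>\<^bsub>K\<^esub> else \<zero>\<^bsub>K\<^esub>)"
      proof (rule uniq[of _ "\<lambda>x. if x = e j then \<one>\<^bsub>K\<^esub> else \<zero>\<^bsub>K\<^esub>"])
        have "lincomb (\<lambda>x. if x = e j then \<one>\<^bsub>K\<^esub> else \<zero>\<^bsub>K\<^esub>) A = (\<Oplus>\<^bsub>V\<^esub>v\<in>A. if v = e j then e j else \<zero>\<^bsub>V\<^esub>)"
          unfolding lincomb_def using AV ejV by (intro M.finsum_cong') auto
        also have "\<dots> = e j" using A eA[OF j] ejV by (intro M.finsum_delta) auto
        finally show "lincomb (co (e j)) A = lincomb (\<lambda>x. if x = e j then \<one>\<^bsub>K\<^esub> else \<zero>\<^bsub>K\<^esub>) A"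
          using co(2)[OF ejV] by simp
      qed (use co(1)[OF ejV] eA i in auto)
      then show "h i (e j) = (if i = j then \<one>\<^bsub>K\<^esub> else \<zero>\<^bsub>K\<^esub>)"
        using e i j by (auto simp: h_def bij_betw_def inj_on_def)
    qed
    fix v assume v: "v \<in> carrier V"
    show "system_proj d e h v = v"
      using lc[OF co(1)[OF v]] co(2)[OF v] by (simp add: system_proj_def h_def)
  qed
qed

lemma right_module_simps [simp]:
  "carrier (right_module P) = carrier P" "add (right_module P) = add P"
  "\<zero>\<^bsub>right_module P\<^esub> = \<zero>\<^bsub>P\<^esub>" "smult (right_module P) a x = x \<odot>\<^sup>r\<^bsub>P\<^esub> a"
  by (simp_all add: right_module_def)

lemma finsum_right_module [simp]: "finsum (right_module P) = finsum P"
  by (simp add: right_module_def finsum_def)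

locale field_bimodule = field L + bimodule L P
  for L :: "('a, 'k) ring_scheme" (structure) and P :: "('a, 'b, 'm) bimodule_scheme"
begin

abbreviation lact (infixr "\<triangleright>" 72) where "x \<triangleright> p \<equiv> x \<odot>\<^bsub>P\<^esub> p"
abbreviation ract (infixl "\<triangleleft>" 74) where "p \<triangleleft> x \<equiv> p \<odot>\<^sup>r\<^bsub>P\<^esub> x"

lemma ract_closed [simp, intro]: "p \<in> carrier P \<Longrightarrow> x \<in> carrier L \<Longrightarrow> p \<triangleleft> x \<in> carrier P"
  using right.smult_closed[of x p] by simp

lemma ract_add_left: "p \<in> carrier P \<Longrightarrow> q \<in> carrier P \<Longrightarrow> x \<in> carrier L \<Longrightarrow> (p \<oplus>\<^bsub>P\<^esub> q) \<triangleleft> x = p \<triangleleft> x \<oplus>\<^bsub>P\<^esub> q \<triangleleft> x"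
  using right.smult_r_distr[of x p q] by simp

lemma ract_add_right: "p \<in> carrier P \<Longrightarrow> x \<in> carrier L \<Longrightarrow> y \<in> carrier L \<Longrightarrow> p \<triangleleft> (x \<oplus> y) = p \<triangleleft> x \<oplus>\<^bsub>P\<^esub> p \<triangleleft> y"
  using right.smult_l_distr[of x y p] by simp

lemma ract_ract: "p \<in> carrier P \<Longrightarrow> x \<in> carrier L \<Longrightarrow> y \<in> carrier L \<Longrightarrow> p \<triangleleft> x \<triangleleft> y = p \<triangleleft> (x \<otimes> y)"
  using right.smult_assoc1[of y x p] by (simp add: m_comm)

lemma lact_ract: "p \<in> carrier P \<Longrightarrow> x \<in> carrier L \<Longrightarrow> y \<in> carrier L \<Longrightarrow> (x \<triangleright> p) \<triangleleft> y = x \<triangleright> (p \<triangleleft> y)"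
  using smult_rsmult by simp

lemma ract_one [simp]: "p \<in> carrier P \<Longrightarrow> p \<triangleleft> \<one> = p"
  using right.smult_one[of p] by simp

lemma ract_zero [simp]: "p \<in> carrier P \<Longrightarrow> p \<triangleleft> \<zero> = \<zero>\<^bsub>P\<^esub>"
  using right.smult_l_null[of p] by simp

lemma zero_ract [simp]: "x \<in> carrier L \<Longrightarrow> \<zero>\<^bsub>P\<^esub> \<triangleleft> x = \<zero>\<^bsub>P\<^esub>"
  using right.smult_r_null[of x] by simp

lemma finsum_ract:
  assumes "x \<in> carrier L" "\<And>i. i \<in> I \<Longrightarrow> p i \<in> carrier P"
  shows "(\<Oplus>\<^bsub>P\<^esub>i\<in>I. p i) \<triangleleft> x = (\<Oplus>\<^bsub>P\<^esub>i\<in>I. p i \<triangleleft> x)"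
  by (rule additive_finsum[where h = "\<lambda>p. p \<triangleleft> x", OF left.M.abelian_group_axioms left.M.abelian_group_axioms])
    (use assms in \<open>auto simp: ract_add_left\<close>)

lemma ract_finsum:
  assumes "p \<in> carrier P" "\<And>i. i \<in> I \<Longrightarrow> x i \<in> carrier L"
  shows "p \<triangleleft> (\<Oplus>i\<in>I. x i) = (\<Oplus>\<^bsub>P\<^esub>i\<in>I. p \<triangleleft> x i)"
  by (rule additive_finsum[where h = "\<lambda>x. p \<triangleleft> x", OF abelian_group_axioms left.M.abelian_group_axioms])
    (use assms in \<open>auto simp: ract_add_right\<close>)

lemma linear_form_ract:
  assumes "left.linear_form g" "x \<in> carrier L" shows "left.linear_form (\<lambda>p. g (p \<triangleleft> x))"
  unfolding left.linear_form_def
  using assms by (auto simp: ract_add_left lact_ract left.linear_form_add left.linear_form_smult)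

text \<open>The biadditive maps \<open>P \<times> P \<rightarrow> L\<close> that factor through \<open>P \<otimes>\<^sub>L P\<close> and are left linear on it.\<close>

definition balanced :: "('b \<Rightarrow> 'b \<Rightarrow> 'a) \<Rightarrow> bool"
  where "balanced G \<longleftrightarrow>
    (\<forall>p\<in>carrier P. \<forall>q\<in>carrier P. G p q \<in> carrier L) \<and>
    (\<forall>p\<in>carrier P. \<forall>p'\<in>carrier P. \<forall>q\<in>carrier P. G (p \<oplus>\<^bsub>P\<^esub> p') q = G p q \<oplus> G p' q) \<and>
    (\<forall>p\<in>carrier P. \<forall>q\<in>carrier P. \<forall>q'\<in>carrier P. G p (q \<oplus>\<^bsub>P\<^esub> q') = G p q \<oplus> G p q') \<and>
    (\<forall>p\<in>carrier P. \<forall>q\<in>carrier P. \<forall>z\<in>carrier L. G (p \<triangleleft> z) q = G p (z \<triangleright> q)) \<and>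
    (\<forall>p\<in>carrier P. \<forall>q\<in>carrier P. \<forall>x\<in>carrier L. G (x \<triangleright> p) q = x \<otimes> G p q)"

end

text \<open>What is used of a Galois bimodule: a left basis \<open>b\<close> and a right basis \<open>c\<close> with their coordinate
  forms, and the components \<open>\<beta> t\<close> of the map \<open>P \<times> P \<rightarrow> P \<otimes>\<^sub>L P \<cong> P\<^sup>d\<close>. That this map is an isomorphism
  on \<open>P \<otimes>\<^sub>L P\<close> enters through its consequence that each balanced form is a sum of left linear forms
  in the components.\<close>

locale galois_data = field_bimodule L P
  for L :: "('a, 'k) ring_scheme" (structure) and P :: "('a, 'b, 'm) bimodule_scheme" +
  fixes d :: nat and b :: "nat \<Rightarrow> 'b" and h :: "nat \<Rightarrow> 'b \<Rightarrow> 'a"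
    and c :: "nat \<Rightarrow> 'b" and \<kappa> :: "nat \<Rightarrow> 'b \<Rightarrow> 'a"
    and \<beta> :: "nat \<Rightarrow> 'b \<Rightarrow> 'b \<Rightarrow> 'b"
  assumes d_pos: "0 < d"
    and left_basis: "left.free_system d b h" "\<And>p. p \<in> carrier P \<Longrightarrow> left.system_proj d b h p = p"
    and right_basis: "right.free_system d c \<kappa>" "\<And>p. p \<in> carrier P \<Longrightarrow> right.system_proj d c \<kappa> p = p"
    and beta_closed: "\<And>t p q. t < d \<Longrightarrow> p \<in> carrier P \<Longrightarrow> q \<in> carrier P \<Longrightarrow> \<beta> t p q \<in> carrier P"
    and beta_ract: "\<And>t x p q. t < d \<Longrightarrow> x \<in> carrier L \<Longrightarrow> p \<in> carrier P \<Longrightarrow> q \<in> carrier P \<Longrightarrow>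
      \<beta> t p (q \<triangleleft> x) = \<beta> t p q \<triangleleft> x"
    and balanced_lift: "\<And>G. balanced G \<Longrightarrow> \<exists>g. (\<forall>t<d. left.linear_form (g t)) \<and>
      (\<forall>p\<in>carrier P. \<forall>q\<in>carrier P. G p q = (\<Oplus>t\<in>{..<d}. g t (\<beta> t p q)))"
begin

lemma b_closed [simp]: "i < d \<Longrightarrow> b i \<in> carrier P"
  and h_form [simp]: "i < d \<Longrightarrow> left.linear_form (h i)"
  and h_b: "i < d \<Longrightarrow> j < d \<Longrightarrow> h i (b j) = (if i = j then \<one> else \<zero>)"
  using left_basis by (auto simp: left.free_system_def)

lemma expand: "p \<in> carrier P \<Longrightarrow> p = (\<Oplus>\<^bsub>P\<^esub>i\<in>{..<d}. h i p \<triangleright> b i)"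
  using left_basis(2) by (simp add: left.system_proj_def)

lemma forms_separate:
  assumes "p \<in> carrier P" "q \<in> carrier P" "\<And>g. left.linear_form g \<Longrightarrow> g p = g q"
  shows "p = q"
proof -
  have "(\<Oplus>\<^bsub>P\<^esub>i\<in>{..<d}. h i p \<triangleright> b i) = (\<Oplus>\<^bsub>P\<^esub>i\<in>{..<d}. h i q \<triangleright> b i)"
  proof (rule left.M.finsum_cong')
    fix i assume i: "i \<in> {..<d}"
    have "h i p = h i q" by (rule assms(3)) (use i in simp)
    then show "h i p \<triangleright> b i = h i q \<triangleright> b i" by simp
  qed (use assms(2) in auto)
  then show ?thesis using expand[OF assms(1)] expand[OF assms(2)] by simp
qed

section \<open>Coefficient maps of the right action\<close>

text \<open>The left \<open>L\<close>-span of the matrix coefficients \<open>y \<mapsto> g (p \<triangleleft> y)\<close> of the right action. The definition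
  takes only the coefficients with respect to the basis \<open>b\<close>, which makes the finite dimension
  evident; the lemma \<open>coeff_mapI\<close> recovers the others.\<close>

definition coeff_maps :: "('a \<Rightarrow> 'a) set"
  where "coeff_maps = {\<phi>. \<exists>a\<in>{..<d} \<times> {..<d} \<rightarrow> carrier L. \<forall>y\<in>carrier L.
    \<phi> y = (\<Oplus>x\<in>{..<d} \<times> {..<d}. a x \<otimes> h (fst x) (b (snd x) \<triangleleft> y))}"

lemma basis_coeff_closed [simp]: "x \<in> {..<d} \<times> {..<d} \<Longrightarrow> y \<in> carrier L \<Longrightarrow> h (fst x) (b (snd x) \<triangleleft> y) \<in> carrier L"
  by auto

lemma coeff_maps_closed: "\<phi> \<in> coeff_maps \<Longrightarrow> y \<in> carrier L \<Longrightarrow> \<phi> y \<in> carrier L"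
  unfolding coeff_maps_def by (auto intro!: finsum_closed simp: Pi_iff)

lemma coeff_maps_cong:
  "\<phi> \<in> coeff_maps \<Longrightarrow> (\<And>y. y \<in> carrier L \<Longrightarrow> \<psi> y = \<phi> y) \<Longrightarrow> \<psi> \<in> coeff_maps"
  unfolding coeff_maps_def by auto

lemma coeff_maps_add:
  assumes "\<phi> \<in> coeff_maps" "\<psi> \<in> coeff_maps"
  shows "(\<lambda>y. \<phi> y \<oplus> \<psi> y) \<in> coeff_maps"
proof -
  obtain a where a: "a \<in> {..<d} \<times> {..<d} \<rightarrow> carrier L"
    "\<And>y. y \<in> carrier L \<Longrightarrow> \<phi> y = (\<Oplus>x\<in>{..<d} \<times> {..<d}. a x \<otimes> h (fst x) (b (snd x) \<triangleleft> y))"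
    using assms(1) unfolding coeff_maps_def by auto
  obtain a' where a': "a' \<in> {..<d} \<times> {..<d} \<rightarrow> carrier L"
    "\<And>y. y \<in> carrier L \<Longrightarrow> \<psi> y = (\<Oplus>x\<in>{..<d} \<times> {..<d}. a' x \<otimes> h (fst x) (b (snd x) \<triangleleft> y))"
    using assms(2) unfolding coeff_maps_def by auto
  have cl: "a x \<in> carrier L" "a' x \<in> carrier L" if "x \<in> {..<d} \<times> {..<d}" for x using a(1) a'(1) that by auto
  have "\<phi> y \<oplus> \<psi> y = (\<Oplus>x\<in>{..<d} \<times> {..<d}. (a x \<oplus> a' x) \<otimes> h (fst x) (b (snd x) \<triangleleft> y))" if y: "y \<in> carrier L" for y
  proof -
    have "\<phi> y \<oplus> \<psi> y = (\<Oplus>x\<in>{..<d} \<times> {..<d}. a x \<otimes> h (fst x) (b (snd x) \<triangleleft> y) \<oplus> a' x \<otimes> h (fst x) (b (snd x) \<triangleleft> y))"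
      unfolding a(2)[OF y] a'(2)[OF y] using cl y by (intro finsum_addf[symmetric]) auto
    also have "\<dots> = (\<Oplus>x\<in>{..<d} \<times> {..<d}. (a x \<oplus> a' x) \<otimes> h (fst x) (b (snd x) \<triangleleft> y))"
      using cl y basis_coeff_closed by (intro finsum_cong') (auto simp: l_distr)
    finally show ?thesis .
  qed
  then show ?thesis unfolding coeff_maps_def
    using cl by (intro CollectI bexI[of _ "\<lambda>x. a x \<oplus> a' x"]) auto
qed

lemma coeff_maps_scale:
  assumes "\<phi> \<in> coeff_maps" "z \<in> carrier L"
  shows "(\<lambda>y. z \<otimes> \<phi> y) \<in> coeff_maps"
proof -
  obtain a where a: "a \<in> {..<d} \<times> {..<d} \<rightarrow> carrier L"
    "\<And>y. y \<in> carrier L \<Longrightarrow> \<phi> y = (\<Oplus>x\<in>{..<d} \<times> {..<d}. a x \<otimes> h (fst x) (b (snd x) \<triangleleft> y))"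
    using assms(1) unfolding coeff_maps_def by auto
  have cl: "a x \<in> carrier L" if "x \<in> {..<d} \<times> {..<d}" for x using a(1) that by auto
  have "z \<otimes> \<phi> y = (\<Oplus>x\<in>{..<d} \<times> {..<d}. (z \<otimes> a x) \<otimes> h (fst x) (b (snd x) \<triangleleft> y))" if y: "y \<in> carrier L" for y
  proof -
    have "z \<otimes> \<phi> y = (\<Oplus>x\<in>{..<d} \<times> {..<d}. z \<otimes> (a x \<otimes> h (fst x) (b (snd x) \<triangleleft> y)))"
      unfolding a(2)[OF y] using cl y assms by (intro finsum_rdistr) auto
    also have "\<dots> = (\<Oplus>x\<in>{..<d} \<times> {..<d}. (z \<otimes> a x) \<otimes> h (fst x) (b (snd x) \<triangleleft> y))"
      using cl y basis_coeff_closed assms by (intro finsum_cong') (auto simp: m_assoc)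
    finally show ?thesis .
  qed
  then show ?thesis unfolding coeff_maps_def
    using cl assms by (intro CollectI bexI[of _ "\<lambda>x. z \<otimes> a x"]) auto
qed

lemma coeff_maps_diff:
  assumes "\<phi> \<in> coeff_maps" "\<psi> \<in> coeff_maps"
  shows "(\<lambda>y. \<phi> y \<ominus> \<psi> y) \<in> coeff_maps"
proof (rule coeff_maps_cong)
  show "(\<lambda>y. \<phi> y \<oplus> (\<ominus> \<one>) \<otimes> \<psi> y) \<in> coeff_maps"
    using assms by (intro coeff_maps_add[of \<phi> "\<lambda>y. (\<ominus> \<one>) \<otimes> \<psi> y"] coeff_maps_scale) auto
qed (use assms coeff_maps_closed in \<open>auto simp: minus_eq l_minus\<close>)

lemma coeff_maps_zero: "(\<lambda>y. \<zero>) \<in> coeff_maps"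
proof -
  have "\<zero> = (\<Oplus>x\<in>{..<d} \<times> {..<d}. \<zero> \<otimes> h (fst x) (b (snd x) \<triangleleft> y))" if "y \<in> carrier L" for y
    by (rule finsum_eq_zero[symmetric]) (use basis_coeff_closed that in simp)
  then show ?thesis
    unfolding coeff_maps_def by (intro CollectI bexI[of _ "\<lambda>x. \<zero>"]) auto
qed

lemma coeff_maps_sum:
  assumes "finite S" "\<And>s. s \<in> S \<Longrightarrow> \<phi> s \<in> coeff_maps"
  shows "(\<lambda>y. \<Oplus>s\<in>S. \<phi> s y) \<in> coeff_maps"
  using assms
proof (induction S rule: finite_induct)
  case empty
  then show ?case by (simp add: coeff_maps_zero)
next
  case (insert s S)
  have "(\<lambda>y. \<phi> s y \<oplus> (\<Oplus>s\<in>S. \<phi> s y)) \<in> coeff_maps"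
    using insert by (intro coeff_maps_add[of "\<phi> s" "\<lambda>y. \<Oplus>s\<in>S. \<phi> s y"]) auto
  then show ?case
    by (rule coeff_maps_cong) (use insert coeff_maps_closed in \<open>auto intro!: finsum_insert\<close>)
qed

lemma coeff_maps_basis_coeff: "i < d \<Longrightarrow> k < d \<Longrightarrow> (\<lambda>y. h i (b k \<triangleleft> y)) \<in> coeff_maps"
proof -
  assume ik: "i < d" "k < d"
  have "h i (b k \<triangleleft> y) = (\<Oplus>x\<in>{..<d} \<times> {..<d}. (if x = (i,k) then \<one> else \<zero>) \<otimes> h (fst x) (b (snd x) \<triangleleft> y))"
    if y: "y \<in> carrier L" for y
  proof -
    have "(\<Oplus>x\<in>{..<d} \<times> {..<d}. (if x = (i,k) then \<one> else \<zero>) \<otimes> h (fst x) (b (snd x) \<triangleleft> y))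
      = (\<Oplus>x\<in>{..<d} \<times> {..<d}. if x = (i,k) then h i (b k \<triangleleft> y) else \<zero>)"
      using ik y basis_coeff_closed by (intro finsum_cong') auto
    also have "\<dots> = h i (b k \<triangleleft> y)" using ik y by (intro finsum_delta) auto
    finally show ?thesis by simp
  qed
  then have "\<forall>y\<in>carrier L. h i (b k \<triangleleft> y)
      = (\<Oplus>x\<in>{..<d} \<times> {..<d}. (if x = (i,k) then \<one> else \<zero>) \<otimes> h (fst x) (b (snd x) \<triangleleft> y))"
    by (rule ballI)
  then show ?thesis unfolding coeff_maps_def
    by (intro CollectI bexI[of _ "\<lambda>x. if x = (i,k) then \<one> else \<zero>"]) (assumption, simp)
qed

lemma linear_form_expand:
  assumes "left.linear_form g" "p \<in> carrier P"
  shows "g p = (\<Oplus>i\<in>{..<d}. h i p \<otimes> g (b i))"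
proof -
  have "g p = g (\<Oplus>\<^bsub>P\<^esub>i\<in>{..<d}. h i p \<triangleright> b i)" using expand[OF assms(2)] by simp
  also have "\<dots> = (\<Oplus>i\<in>{..<d}. g (h i p \<triangleright> b i))"
    using assms by (intro left.linear_form_finsum) auto
  also have "\<dots> = (\<Oplus>i\<in>{..<d}. h i p \<otimes> g (b i))"
    using assms by (intro finsum_cong') (auto simp: left.linear_form_smult)
  finally show ?thesis .
qed

lemma forms_dual_system_bound:
  assumes "dual_system (carrier P) {g. left.linear_form g} m \<phi> p" shows "m \<le> d"
proof -
  have "m \<le> card {..<d}"
    using assms
    proof (rule dual_system_bound[where b = h])
      fix g assume "g \<in> {g. left.linear_form g}"
      then have g: "left.linear_form g" by simp
      have "g x = (\<Oplus>k\<in>{..<d}. g (b k) \<otimes> h k x)" if x: "x \<in> carrier P" for x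
        unfolding linear_form_expand[OF g x] using g x by (intro finsum_cong') (auto simp: m_comm)
      then show "\<exists>c\<in>{..<d} \<rightarrow> carrier L. \<forall>x\<in>carrier P. g x = (\<Oplus>k\<in>{..<d}. c k \<otimes> h k x)"
        using g by (intro bexI[of _ "\<lambda>k. g (b k)"]) auto
    qed auto
  then show ?thesis by simp
qed

lemma coeff_mapI:
  assumes g: "left.linear_form g" and p: "p \<in> carrier P"
  shows "(\<lambda>y. g (p \<triangleleft> y)) \<in> coeff_maps"
proof -
  have "(\<lambda>y. \<Oplus>k\<in>{..<d}. h k p \<otimes> (\<Oplus>i\<in>{..<d}. g (b i) \<otimes> h i (b k \<triangleleft> y))) \<in> coeff_maps"
    using g p
    by (intro coeff_maps_sum[of "{..<d}" "\<lambda>k y. h k p \<otimes> (\<Oplus>i\<in>{..<d}. g (b i) \<otimes> h i (b k \<triangleleft> y))"]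
        coeff_maps_scale[of "\<lambda>y. \<Oplus>i\<in>{..<d}. g (b i) \<otimes> h i (b _ \<triangleleft> y)"]
        coeff_maps_sum[of "{..<d}" "\<lambda>i y. g (b i) \<otimes> h i (b _ \<triangleleft> y)"]
        coeff_maps_scale[of "\<lambda>y. h _ (b _ \<triangleleft> y)"] coeff_maps_basis_coeff) auto
  then show ?thesis
  proof (rule coeff_maps_cong)
    fix y assume y: "y \<in> carrier L"
    have "g (p \<triangleleft> y) = (\<Oplus>k\<in>{..<d}. h k p \<otimes> g (b k \<triangleleft> y))"
      using linear_form_expand[OF linear_form_ract[OF g y] p] by simp
    also have "\<dots> = (\<Oplus>k\<in>{..<d}. h k p \<otimes> (\<Oplus>i\<in>{..<d}. g (b i) \<otimes> h i (b k \<triangleleft> y)))"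
    proof (rule finsum_cong')
      fix k assume k: "k \<in> {..<d}"
      have "g (b k \<triangleleft> y) = (\<Oplus>i\<in>{..<d}. h i (b k \<triangleleft> y) \<otimes> g (b i))"
        using linear_form_expand[OF g, of "b k \<triangleleft> y"] k y by simp
      also have "\<dots> = (\<Oplus>i\<in>{..<d}. g (b i) \<otimes> h i (b k \<triangleleft> y))"
        using k y g by (intro finsum_cong') (auto simp: m_comm)
      finally show "h k p \<otimes> g (b k \<triangleleft> y) = h k p \<otimes> (\<Oplus>i\<in>{..<d}. g (b i) \<otimes> h i (b k \<triangleleft> y))" by simp
    qed (use y g p in \<open>auto intro!: finsum_closed\<close>)
    finally show "g (p \<triangleleft> y) = (\<Oplus>k\<in>{..<d}. h k p \<otimes> (\<Oplus>i\<in>{..<d}. g (b i) \<otimes> h i (b k \<triangleleft> y)))" .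
  qed
qed

text \<open>Additive and linear statements need checking only for single matrix coefficients, since a scalar
  in front of \<open>h i (b k \<triangleleft> y)\<close> can be moved into the vector \<open>b k\<close>.\<close>

lemma coeff_map_induct [consumes 1, case_names rank_one sum cong]:
  assumes "\<phi> \<in> coeff_maps"
    and r: "\<And>g p. left.linear_form g \<Longrightarrow> p \<in> carrier P \<Longrightarrow> Q (\<lambda>y. g (p \<triangleleft> y))"
    and s: "\<And>(S :: (nat \<times> nat) set) \<psi>. finite S \<Longrightarrow> (\<And>s. s \<in> S \<Longrightarrow> \<psi> s \<in> coeff_maps) \<Longrightarrow> (\<And>s. s \<in> S \<Longrightarrow> Q (\<psi> s)) \<Longrightarrow> Q (\<lambda>y. \<Oplus>s\<in>S. \<psi> s y)"
    and c: "\<And>\<psi> \<chi>. Q \<psi> \<Longrightarrow> (\<And>y. y \<in> carrier L \<Longrightarrow> \<chi> y = \<psi> y) \<Longrightarrow> Q \<chi>"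
  shows "Q \<phi>"
proof -
  obtain a where a: "a \<in> {..<d} \<times> {..<d} \<rightarrow> carrier L"
    "\<And>y. y \<in> carrier L \<Longrightarrow> \<phi> y = (\<Oplus>x\<in>{..<d} \<times> {..<d}. a x \<otimes> h (fst x) (b (snd x) \<triangleleft> y))"
    using assms(1) unfolding coeff_maps_def by auto
  have ax: "a x \<in> carrier L" if "x \<in> {..<d} \<times> {..<d}" for x using a(1) that by auto
  define \<psi> where "\<psi> = (\<lambda>x y. h (fst x) ((a x \<triangleright> b (snd x)) \<triangleleft> y))"
  have "\<psi> x \<in> coeff_maps \<and> Q (\<psi> x)" if "x \<in> {..<d} \<times> {..<d}" for x
  proof -
    have "left.linear_form (h (fst x))" "a x \<triangleright> b (snd x) \<in> carrier P"
      using that ax[OF that] by auto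
    then show ?thesis unfolding \<psi>_def using r coeff_mapI by blast
  qed
  then have "Q (\<lambda>y. \<Oplus>x\<in>{..<d} \<times> {..<d}. \<psi> x y)"
    by (intro s) auto
  then show ?thesis
  proof (rule c)
    fix y assume y: "y \<in> carrier L"
    show "\<phi> y = (\<Oplus>x\<in>{..<d} \<times> {..<d}. \<psi> x y)"
      unfolding a(2)[OF y] \<psi>_def using ax y
      by (intro finsum_cong') (auto simp: lact_ract left.linear_form_smult)
  qed
qed

end

context galois_data
begin

lemma coeff_maps_additive:
  assumes "\<phi> \<in> coeff_maps" and xy: "x \<in> carrier L" "y \<in> carrier L"
  shows "\<phi> (x \<oplus> y) = \<phi> x \<oplus> \<phi> y"
  using assms(1)
proof (induction rule: coeff_map_induct)
  case (rank_one g p)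
  then show ?case using xy by (simp add: ract_add_right left.linear_form_add)
next
  case (sum S \<psi>)
  have cl: "\<psi> s z \<in> carrier L" if "s \<in> S" "z \<in> carrier L" for s z
    using coeff_maps_closed[OF sum(2)[OF that(1)] that(2)] .
  have "(\<Oplus>s\<in>S. \<psi> s (x \<oplus> y)) = (\<Oplus>s\<in>S. \<psi> s x \<oplus> \<psi> s y)"
    using cl xy by (intro finsum_cong') (auto simp: sum(3))
  also have "\<dots> = (\<Oplus>s\<in>S. \<psi> s x) \<oplus> (\<Oplus>s\<in>S. \<psi> s y)"
    using cl xy by (intro finsum_addf) auto
  finally show ?case .
next
  case (cong \<psi> \<chi>)
  show ?case using xy by (simp add: cong)
qed

lemma coeff_maps_finsum:
  assumes "\<phi> \<in> coeff_maps" "\<And>i. i \<in> I \<Longrightarrow> x i \<in> carrier L"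
  shows "\<phi> (\<Oplus>i\<in>I. x i) = (\<Oplus>i\<in>I. \<phi> (x i))"
  by (rule additive_finsum[OF abelian_group_axioms abelian_group_axioms])
    (use assms in \<open>auto simp: coeff_maps_closed coeff_maps_additive\<close>)

lemma coeff_maps_rmult:
  assumes "\<phi> \<in> coeff_maps" "z \<in> carrier L"
  shows "(\<lambda>y. \<phi> (z \<otimes> y)) \<in> coeff_maps"
  using assms(1)
proof (induction rule: coeff_map_induct)
  case (rank_one g p)
  show ?case
    by (rule coeff_maps_cong[OF coeff_mapI[OF rank_one(1), of "p \<triangleleft> z"]]) (use rank_one assms in \<open>auto simp: ract_ract\<close>)
next
  case (sum S \<psi>)
  then show ?case by (intro coeff_maps_sum[of S "\<lambda>s y. \<psi> s (z \<otimes> y)"]) auto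
next
  case (cong \<psi> \<chi>)
  show ?case by (rule coeff_maps_cong[OF cong(1)]) (use assms(2) in \<open>simp add: cong(2)\<close>)
qed

text \<open>This is where \<open>P \<otimes>\<^sub>L P \<cong> P\<^sup>d\<close> enters. The composition of \<open>g (p \<triangleleft> _)\<close> with \<open>g' (q \<triangleleft> _)\<close> comes from the
  balanced form \<open>(p, q) \<mapsto> g (p \<triangleleft> g' q)\<close>. Written in the components \<open>\<beta> t\<close>, which commute with the right
  action on \<open>q\<close>, it becomes a sum of matrix coefficients of the elements \<open>\<beta> t p q\<close>.\<close>

lemma coeff_maps_comp:
  assumes \<phi>: "\<phi> \<in> coeff_maps" and \<psi>: "\<psi> \<in> coeff_maps"
  shows "(\<lambda>y. \<phi> (\<psi> y)) \<in> coeff_maps"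
proof -
  have rank: "(\<lambda>y. g (p \<triangleleft> g' (q \<triangleleft> y))) \<in> coeff_maps"
    if g: "left.linear_form g" "left.linear_form g'" and p: "p \<in> carrier P" "q \<in> carrier P" for g g' p q
  proof -
    have "balanced (\<lambda>p q. g (p \<triangleleft> g' q))"
      unfolding balanced_def using g
      by (auto simp: ract_add_left ract_add_right left.linear_form_add left.linear_form_smult lact_ract ract_ract)
    from balanced_lift[OF this] obtain f where f: "\<And>t. t < d \<Longrightarrow> left.linear_form (f t)"
      "\<And>p q. p \<in> carrier P \<Longrightarrow> q \<in> carrier P \<Longrightarrow> g (p \<triangleleft> g' q) = (\<Oplus>t\<in>{..<d}. f t (\<beta> t p q))"
      by auto
    have "(\<lambda>y. \<Oplus>t\<in>{..<d}. f t (\<beta> t p q \<triangleleft> y)) \<in> coeff_maps"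
      using f p beta_closed by (intro coeff_maps_sum[of "{..<d}" "\<lambda>t y. f t (\<beta> t p q \<triangleleft> y)"] coeff_mapI) auto
    then show ?thesis
    proof (rule coeff_maps_cong)
      fix y assume y: "y \<in> carrier L"
      have "g (p \<triangleleft> g' (q \<triangleleft> y)) = (\<Oplus>t\<in>{..<d}. f t (\<beta> t p (q \<triangleleft> y)))"
        using f(2) p y by simp
      also have "\<dots> = (\<Oplus>t\<in>{..<d}. f t (\<beta> t p q \<triangleleft> y))"
        using f p y beta_closed by (intro finsum_cong') (auto simp: beta_ract)
      finally show "g (p \<triangleleft> g' (q \<triangleleft> y)) = (\<Oplus>t\<in>{..<d}. f t (\<beta> t p q \<triangleleft> y))" .
    qed
  qed
  have rank': "(\<lambda>y. g (p \<triangleleft> \<psi> y)) \<in> coeff_maps" if g: "left.linear_form g" "p \<in> carrier P" for g p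
    using \<psi>
  proof (induction rule: coeff_map_induct)
    case (rank_one g' q)
    then show ?case using rank g by blast
  next
    case (sum S \<psi>)
    have "(\<lambda>y. \<Oplus>s\<in>S. g (p \<triangleleft> \<psi> s y)) \<in> coeff_maps"
      using sum by (intro coeff_maps_sum[of S "\<lambda>s y. g (p \<triangleleft> \<psi> s y)"]) auto
    then show ?case
    proof (rule coeff_maps_cong)
      fix y assume y: "y \<in> carrier L"
      have "p \<triangleleft> (\<Oplus>s\<in>S. \<psi> s y) = (\<Oplus>\<^bsub>P\<^esub>s\<in>S. p \<triangleleft> \<psi> s y)"
        using sum(2) coeff_maps_closed g y by (intro ract_finsum) auto
      then show "g (p \<triangleleft> (\<Oplus>s\<in>S. \<psi> s y)) = (\<Oplus>s\<in>S. g (p \<triangleleft> \<psi> s y))"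
        using sum(2) coeff_maps_closed g y left.linear_form_finsum[OF g(1), of S "\<lambda>s. p \<triangleleft> \<psi> s y"] by auto
    qed
  next
    case (cong \<psi> \<chi>)
    show ?case by (rule coeff_maps_cong[OF cong(1)]) (simp add: cong(2))
  qed
  show ?thesis using \<phi>
  proof (induction rule: coeff_map_induct)
    case (rank_one g p)
    then show ?case using rank' by blast
  next
    case (sum S \<psi>')
    then show ?case by (intro coeff_maps_sum[of S "\<lambda>s y. \<psi>' s (\<psi> y)"]) auto
  next
    case (cong \<psi>' \<chi>)
    show ?case
      by (rule coeff_maps_cong[OF cong(1)]) (simp add: cong(2) coeff_maps_closed[OF \<psi>])
  qed
qed

lemma coeff_maps_dual_system_bound:
  assumes "dual_system (carrier L) coeff_maps t \<phi> u" shows "t \<le> d * d"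
proof -
  have "t \<le> card ({..<d} \<times> {..<d})"
    by (rule dual_system_bound[OF assms, where b = "\<lambda>x y. h (fst x) (b (snd x) \<triangleleft> y)"])
      (auto simp: coeff_maps_def)
  then show ?thesis by simp
qed

end

section \<open>The center and dual bases over it\<close>

context field_bimodule
begin

abbreviation center :: "'a set" where "center \<equiv> bimodule_center L P"

lemma center_closed: "z \<in> center \<Longrightarrow> z \<in> carrier L"
  and center_act: "z \<in> center \<Longrightarrow> p \<in> carrier P \<Longrightarrow> z \<triangleright> p = p \<triangleleft> z"
  by (auto simp: bimodule_center_def)

lemma centerI: "z \<in> carrier L \<Longrightarrow> (\<And>p. p \<in> carrier P \<Longrightarrow> z \<triangleright> p = p \<triangleleft> z) \<Longrightarrow> z \<in> center"
  by (auto simp: bimodule_center_def)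

lemma subfield_center: "subfield center L"
proof (rule subfieldI')
  show "subring center L"
  proof (rule subringI)
    show "center \<subseteq> carrier L" by (auto simp: center_closed)
    show "\<one> \<in> center" by (rule centerI) auto
  next
    fix x assume x: "x \<in> center"
    show "\<ominus> x \<in> center"
    proof (rule centerI)
      fix p assume p: "p \<in> carrier P"
      have "p \<triangleleft> (\<ominus> x) = \<ominus>\<^bsub>P\<^esub> (p \<triangleleft> x)"
        using right.smult_l_minus[of x p] p x by (simp add: center_closed right_module_def a_inv_def)
      then show "(\<ominus> x) \<triangleright> p = p \<triangleleft> (\<ominus> x)"
        using p x by (simp add: left.smult_l_minus center_closed center_act)
    qed (use x in \<open>simp add: center_closed\<close>)
    fix y assume y: "y \<in> center"
    show "x \<otimes> y \<in> center"
    proof (rule centerI)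
      fix p assume p: "p \<in> carrier P"
      have "(x \<otimes> y) \<triangleright> p = x \<triangleright> (p \<triangleleft> y)"
        using x y p by (simp add: left.smult_assoc1 center_closed center_act)
      also have "\<dots> = (p \<triangleleft> y) \<triangleleft> x"
        using x y p by (simp add: center_closed center_act)
      also have "\<dots> = p \<triangleleft> (x \<otimes> y)"
        using x y p by (simp add: ract_ract center_closed m_comm)
      finally show "(x \<otimes> y) \<triangleright> p = p \<triangleleft> (x \<otimes> y)" .
    qed (use x y in \<open>simp add: center_closed\<close>)
    show "x \<oplus> y \<in> center"
      by (rule centerI) (use x y in \<open>simp_all add: center_closed center_act left.smult_l_distr ract_add_right\<close>)
  qed
next
  fix x assume "x \<in> center - {\<zero>}"
  then have x: "x \<in> center" "x \<noteq> \<zero>" "x \<in> carrier L" by (auto simp: center_closed)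
  then have i: "inv x \<in> carrier L" "inv x \<otimes> x = \<one>" "x \<otimes> inv x = \<one>"
    using field_Units by auto
  show "inv x \<in> center"
  proof (rule centerI)
    fix p assume p: "p \<in> carrier P"
    have "p \<triangleleft> inv x = inv x \<triangleright> (x \<triangleright> (p \<triangleleft> inv x))"
      using p x i by (simp flip: left.smult_assoc1)
    also have "x \<triangleright> (p \<triangleleft> inv x) = (p \<triangleleft> inv x) \<triangleleft> x"
      using p x i by (simp add: center_act)
    also have "\<dots> = p" using p x i by (simp add: ract_ract)
    finally show "inv x \<triangleright> p = p \<triangleleft> inv x" by simp
  qed fact
qed

end

context galois_data
begin

lemma coeff_maps_center_right:
  assumes "\<phi> \<in> coeff_maps" and z: "z \<in> center" "a \<in> carrier L"
  shows "\<phi> (a \<otimes> z) = \<phi> a \<otimes> z"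
  using assms(1)
proof (induction rule: coeff_map_induct)
  case (rank_one g p)
  have zL: "z \<in> carrier L" using z by (simp add: center_closed)
  have "p \<triangleleft> (a \<otimes> z) = z \<triangleright> (p \<triangleleft> a)"
    using rank_one(2) z zL by (simp add: center_act flip: ract_ract)
  then show ?case using rank_one z zL by (simp add: left.linear_form_smult m_comm)
next
  case (sum S \<psi>)
  have zL: "z \<in> carrier L" using z by (simp add: center_closed)
  have cl: "\<psi> s y \<in> carrier L" if "s \<in> S" "y \<in> carrier L" for s y
    using coeff_maps_closed[OF sum(2)[OF that(1)] that(2)] .
  have "(\<Oplus>s\<in>S. \<psi> s (a \<otimes> z)) = (\<Oplus>s\<in>S. \<psi> s a \<otimes> z)"
    using cl z zL by (intro finsum_cong') (auto simp: sum(3))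
  also have "\<dots> = (\<Oplus>s\<in>S. \<psi> s a) \<otimes> z"
    using cl z zL sum(1) by (intro finsum_ldistr[symmetric]) auto
  finally show ?case .
next
  case (cong \<psi> \<chi>)
  show ?case using z by (simp add: cong center_closed)
qed

lemma coeff_maps_center_left:
  assumes "\<phi> \<in> coeff_maps" "z \<in> center" "a \<in> carrier L"
  shows "\<phi> (z \<otimes> a) = z \<otimes> \<phi> a"
  using coeff_maps_center_right[OF assms] assms coeff_maps_closed[OF assms(1,3)]
  by (simp add: m_comm center_closed)

lemma coeff_maps_zero_arg: "\<phi> \<in> coeff_maps \<Longrightarrow> \<phi> \<zero> = \<zero>"
  using coeff_maps_finsum[of \<phi> "{}"] by simp

text \<open>An element \<open>z\<close> is central as soon as \<open>g (z \<triangleright> p) = g (p \<triangleleft> z)\<close> for all \<open>g\<close>, and this is the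
  condition for the matrix coefficients of \<open>P\<close> at \<open>a = \<one>\<close>.\<close>

lemma centerI_coeff_maps:
  assumes z: "z \<in> carrier L" and c: "\<And>\<phi> a. \<phi> \<in> coeff_maps \<Longrightarrow> a \<in> carrier L \<Longrightarrow> \<phi> (a \<otimes> z) = \<phi> a \<otimes> z"
  shows "z \<in> center"
proof (rule centerI[OF z])
  fix p assume p: "p \<in> carrier P"
  show "z \<triangleright> p = p \<triangleleft> z"
  proof (rule forms_separate)
    fix g assume g: "left.linear_form g"
    have "g (p \<triangleleft> (\<one> \<otimes> z)) = g (p \<triangleleft> \<one>) \<otimes> z"
      using c[OF coeff_mapI[OF g p] one_closed] .
    then show "g (z \<triangleright> p) = g (p \<triangleleft> z)" using p z g by (simp add: left.linear_form_smult m_comm)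
  qed (use p z in auto)
qed

text \<open>This is the argument behind the Jacobson-Bourbaki correspondence. For a dual system \<open>\<phi>, u\<close> spanning
  the coefficient maps, \<open>y \<mapsto> \<phi>\<^sub>i (a \<phi>\<^sub>j y)\<close> is again a coefficient map. Expanding it in the \<open>\<phi>\<^sub>k\<close>, with
  coefficients its values at the \<open>u\<^sub>k\<close>, gives \<open>\<phi>\<^sub>i (a \<phi>\<^sub>j y) = \<phi>\<^sub>i a \<cdot> \<phi>\<^sub>j y\<close>. So all coefficient maps are
  linear over the values of \<open>\<phi>\<^sub>j\<close>, which are therefore central, and \<open>\<phi>\<^sub>0\<close> can serve as trace form.\<close>

lemma ex_trace_form:
  obtains \<tau> u0 where "\<tau> \<in> coeff_maps" "\<And>y. y \<in> carrier L \<Longrightarrow> \<tau> y \<in> center" "u0 \<in> carrier L" "\<tau> u0 = \<one>"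
proof -
  obtain t \<phi> u where ds: "dual_system (carrier L) coeff_maps t \<phi> u"
    and span: "\<And>\<psi> x. \<psi> \<in> coeff_maps \<Longrightarrow> x \<in> carrier L \<Longrightarrow> \<psi> x = (\<Oplus>i\<in>{..<t}. \<psi> (u i) \<otimes> \<phi> i x)"
  proof (rule dual_system_spanning[OF carrier_is_subfield, of coeff_maps "carrier L" "d * d"])
    fix \<psi> \<chi> assume "\<psi> \<in> coeff_maps" "\<And>x. x \<in> carrier L \<Longrightarrow> \<chi> x = \<psi> x"
    then show "\<chi> \<in> coeff_maps" by (rule coeff_maps_cong)
  qed (auto intro: coeff_maps_closed coeff_maps_diff coeff_maps_scale coeff_maps_dual_system_bound that)
  have \<phi>: "\<phi> i \<in> coeff_maps" "u i \<in> carrier L" if "i < t" for i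
    using ds that by (auto simp: dual_system_def)
  have \<phi>u: "\<phi> i (u j) = (if i = j then \<one> else \<zero>)" if "i < t" "j < t" for i j
    using ds that by (auto simp: dual_system_def)
  have \<phi>cl: "\<phi> i y \<in> carrier L" if "i < t" "y \<in> carrier L" for i y
    using coeff_maps_closed \<phi> that by blast
  have "t \<noteq> 0"
  proof
    assume "t = 0"
    then have "h 0 (b 0 \<triangleleft> \<one>) = \<zero>" using span[OF coeff_maps_basis_coeff[of 0 0], of \<one>] d_pos by simp
    then show False using h_b[of 0 0] d_pos by simp
  qed
  have key: "\<phi> i (a \<otimes> \<phi> j y) = \<phi> i a \<otimes> \<phi> j y" if ij: "i < t" "j < t" and a: "a \<in> carrier L" "y \<in> carrier L" for i j a y
  proof -
    have "(\<lambda>y. \<phi> i (a \<otimes> \<phi> j y)) \<in> coeff_maps"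
      using coeff_maps_comp[OF coeff_maps_rmult[OF \<phi>(1)[OF ij(1)] a(1)] \<phi>(1)[OF ij(2)]] .
    from span[OF this a(2)]
    have "\<phi> i (a \<otimes> \<phi> j y) = (\<Oplus>k\<in>{..<t}. \<phi> i (a \<otimes> \<phi> j (u k)) \<otimes> \<phi> k y)" .
    also have "\<dots> = (\<Oplus>k\<in>{..<t}. if k = j then \<phi> i a \<otimes> \<phi> j y else \<zero>)"
      using ij a \<phi>u \<phi>cl coeff_maps_zero_arg[OF \<phi>(1)[OF ij(1)]] by (intro finsum_cong') auto
    also have "\<dots> = \<phi> i a \<otimes> \<phi> j y" using ij a \<phi>cl by (intro finsum_delta) auto
    finally show ?thesis .
  qed
  have "\<phi> 0 y \<in> center" if y: "y \<in> carrier L" for y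
  proof (rule centerI_coeff_maps)
    fix \<psi> a assume \<psi>: "\<psi> \<in> coeff_maps" and a: "a \<in> carrier L"
    have 0: "0 < t" using \<open>t \<noteq> 0\<close> by simp
    have \<psi>cl: "\<psi> (u i) \<in> carrier L" if "i < t" for i using coeff_maps_closed[OF \<psi>] \<phi> that by blast
    have "\<psi> (a \<otimes> \<phi> 0 y) = (\<Oplus>i\<in>{..<t}. \<psi> (u i) \<otimes> \<phi> i (a \<otimes> \<phi> 0 y))"
      using span[OF \<psi>] a y \<phi>cl[OF 0] by simp
    also have "\<dots> = (\<Oplus>i\<in>{..<t}. \<psi> (u i) \<otimes> \<phi> i a \<otimes> \<phi> 0 y)"
      using 0 a y \<phi>cl \<psi>cl by (intro finsum_cong') (auto simp: key m_assoc)
    also have "\<dots> = (\<Oplus>i\<in>{..<t}. \<psi> (u i) \<otimes> \<phi> i a) \<otimes> \<phi> 0 y"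
      using 0 a y \<phi>cl \<psi>cl by (intro finsum_ldistr[symmetric]) auto
    also have "\<dots> = \<psi> a \<otimes> \<phi> 0 y" using span[OF \<psi> a] by simp
    finally show "\<psi> (a \<otimes> \<phi> 0 y) = \<psi> a \<otimes> \<phi> 0 y" .
  qed (use \<phi>cl \<open>t \<noteq> 0\<close> y in simp)
  then show ?thesis using that[of "\<phi> 0" "u 0"] \<phi> \<phi>u \<open>t \<noteq> 0\<close> by simp
qed

text \<open>The maps \<open>y \<mapsto> \<tau> (x y)\<close> have values in the center \<open>K\<close> and form a \<open>K\<close>-space in which
  dual systems have bounded length, as they are dual systems of coefficient maps. One that spans has members
  \<open>y \<mapsto> \<tau> (v\<^sub>i y)\<close>. The pairing \<open>(x, y) \<mapsto> \<tau> (x y)\<close> is nondegenerate because \<open>\<tau> \<noteq> 0\<close> and \<open>L\<close> is a field,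
  and this turns the expansion of functions into the two expansions of elements.\<close>

lemma ex_dual_bases:
  obtains \<tau> and n :: nat and u v :: "nat \<Rightarrow> 'a" where "\<tau> \<in> coeff_maps" "\<And>y. y \<in> carrier L \<Longrightarrow> \<tau> y \<in> center"
    "\<And>i. i < n \<Longrightarrow> u i \<in> carrier L" "\<And>i. i < n \<Longrightarrow> v i \<in> carrier L"
    "\<And>i j. i < n \<Longrightarrow> j < n \<Longrightarrow> \<tau> (v i \<otimes> u j) = (if i = j then \<one> else \<zero>)"
    "\<And>y. y \<in> carrier L \<Longrightarrow> y = (\<Oplus>i\<in>{..<n}. \<tau> (v i \<otimes> y) \<otimes> u i)"
    "\<And>y. y \<in> carrier L \<Longrightarrow> y = (\<Oplus>i\<in>{..<n}. \<tau> (u i \<otimes> y) \<otimes> v i)"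
    "0 < n"
proof -
  obtain \<tau> u0 where \<tau>: "\<tau> \<in> coeff_maps" "\<And>y. y \<in> carrier L \<Longrightarrow> \<tau> y \<in> center"
    and u0: "u0 \<in> carrier L" "\<tau> u0 = \<one>" using ex_trace_form by metis
  have \<tau>cl: "\<tau> y \<in> carrier L" if "y \<in> carrier L" for y using coeff_maps_closed[OF \<tau>(1) that] .
  have cC: "z \<otimes> y \<in> carrier L" if "z \<in> center" "y \<in> carrier L" for z y using that by (simp add: center_closed)
  have nondeg: "x = x'" if x: "x \<in> carrier L" "x' \<in> carrier L"
    and eq: "\<And>y. y \<in> carrier L \<Longrightarrow> \<tau> (x \<otimes> y) = \<tau> (x' \<otimes> y)" for x x'
  proof (rule ccontr)
    assume "x \<noteq> x'"
    define w where "w = x \<ominus> x'"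
    have w: "w \<in> carrier L" "w \<noteq> \<zero>"
      using x \<open>x \<noteq> x'\<close> by (auto simp: w_def r_right_minus_eq)
    have wx: "x = w \<oplus> x'" using x by (simp add: w_def minus_eq a_assoc l_neg)
    have iw: "inv w \<in> carrier L" "w \<otimes> inv w = \<one>" using w field_Units by auto
    define y where "y = inv w \<otimes> u0"
    have y: "y \<in> carrier L" using iw u0 by (simp add: y_def)
    have wy: "w \<otimes> y = u0" using iw w u0 by (simp add: y_def flip: m_assoc)
    have "\<tau> (x' \<otimes> y) = \<tau> ((w \<oplus> x') \<otimes> y)" using eq[OF y] by (simp flip: wx)
    also have "\<dots> = \<tau> (w \<otimes> y \<oplus> x' \<otimes> y)" using w x(2) y by (simp add: l_distr)
    also have "\<dots> = \<tau> (w \<otimes> y) \<oplus> \<tau> (x' \<otimes> y)"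
      using w x(2) y by (intro coeff_maps_additive \<tau>) auto
    finally have "\<tau> (x' \<otimes> y) = \<one> \<oplus> \<tau> (x' \<otimes> y)" by (simp only: wy u0(2))
    then show False
      using add.r_cancel_one'[of "\<tau> (x' \<otimes> y)" \<one>] \<tau>cl[of "x' \<otimes> y"] x(2) y by simp
  qed
  define F where "F = {\<psi>. \<exists>x\<in>carrier L. \<forall>y\<in>carrier L. \<psi> y = \<tau> (x \<otimes> y)}"
  have Fc: "F \<subseteq> coeff_maps"
  proof
    fix \<psi> assume "\<psi> \<in> F"
    then obtain x where x: "x \<in> carrier L" "\<forall>y\<in>carrier L. \<psi> y = \<tau> (x \<otimes> y)" unfolding F_def by blast
    show "\<psi> \<in> coeff_maps" by (rule coeff_maps_cong[OF coeff_maps_rmult[OF \<tau>(1) x(1)]]) (use x in auto)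
  qed
  obtain n \<phi> u where ds: "dual_system (carrier L) F n \<phi> u"
    and span: "\<And>\<psi> x. \<psi> \<in> F \<Longrightarrow> x \<in> carrier L \<Longrightarrow> \<psi> x = (\<Oplus>i\<in>{..<n}. \<psi> (u i) \<otimes> \<phi> i x)"
  proof (rule dual_system_spanning[OF subfield_center, of F "carrier L" "d * d"])
    fix \<psi> x assume "\<psi> \<in> F" "x \<in> carrier L"
    then show "\<psi> x \<in> center" unfolding F_def using \<tau>(2) by auto
  next
    fix \<psi> \<chi> assume "\<psi> \<in> F" "\<chi> \<in> F"
    then obtain x x' where x: "x \<in> carrier L" "\<And>y. y \<in> carrier L \<Longrightarrow> \<psi> y = \<tau> (x \<otimes> y)"
      "x' \<in> carrier L" "\<And>y. y \<in> carrier L \<Longrightarrow> \<chi> y = \<tau> (x' \<otimes> y)" unfolding F_def by blast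
    have "\<psi> y \<ominus> \<chi> y = \<tau> ((x \<ominus> x') \<otimes> y)" if y: "y \<in> carrier L" for y
    proof -
      have "x \<otimes> y = (x \<ominus> x') \<otimes> y \<oplus> x' \<otimes> y" using x(1,3) y by algebra
      then have "\<tau> (x \<otimes> y) = \<tau> ((x \<ominus> x') \<otimes> y) \<oplus> \<tau> (x' \<otimes> y)"
        using coeff_maps_additive[OF \<tau>(1)] x(1,3) y by simp
      then show ?thesis using x y \<tau>cl by (simp add: minus_eq a_assoc r_neg)
    qed
    then show "(\<lambda>y. \<psi> y \<ominus> \<chi> y) \<in> F" unfolding F_def using x(1,3) by (intro CollectI bexI[of _ "x \<ominus> x'"]) auto
  next
    fix z \<psi> assume z: "z \<in> center" and "\<psi> \<in> F"
    then obtain x where x: "x \<in> carrier L" "\<And>y. y \<in> carrier L \<Longrightarrow> \<psi> y = \<tau> (x \<otimes> y)" unfolding F_def by blast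
    have "z \<otimes> \<psi> y = \<tau> ((z \<otimes> x) \<otimes> y)" if "y \<in> carrier L" for y
      using coeff_maps_center_left[OF \<tau>(1) z, of "x \<otimes> y"] x z that by (simp add: m_assoc center_closed)
    then show "(\<lambda>y. z \<otimes> \<psi> y) \<in> F" unfolding F_def using x(1) z cC by (intro CollectI bexI[of _ "z \<otimes> x"]) auto
  next
    fix \<psi> \<chi> assume "\<psi> \<in> F" "\<And>x. x \<in> carrier L \<Longrightarrow> \<chi> x = \<psi> x"
    then show "\<chi> \<in> F" unfolding F_def by auto
  next
    fix t \<phi> u assume "dual_system (carrier L) F t \<phi> u"
    then have "dual_system (carrier L) coeff_maps t \<phi> u" using Fc unfolding dual_system_def by blast
    then show "t \<le> d * d" by (rule coeff_maps_dual_system_bound)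
  qed (rule that)
  have "\<forall>i\<in>{..<n}. \<exists>x. x \<in> carrier L \<and> (\<forall>y\<in>carrier L. \<phi> i y = \<tau> (x \<otimes> y))"
    using ds unfolding dual_system_def F_def by auto
  from bchoice[OF this] obtain v where v: "\<And>i. i < n \<Longrightarrow> v i \<in> carrier L"
    "\<And>i y. i < n \<Longrightarrow> y \<in> carrier L \<Longrightarrow> \<phi> i y = \<tau> (v i \<otimes> y)" by auto
  have u: "u i \<in> carrier L" if "i < n" for i using ds that by (auto simp: dual_system_def)
  have vu: "\<tau> (v i \<otimes> u j) = (if i = j then \<one> else \<zero>)" if "i < n" "j < n" for i j
    using ds that v(2)[OF that(1) u[OF that(2)]] by (auto simp: dual_system_def)
  have sp: "\<tau> (x \<otimes> y) = (\<Oplus>i\<in>{..<n}. \<tau> (x \<otimes> u i) \<otimes> \<tau> (v i \<otimes> y))" if "x \<in> carrier L" "y \<in> carrier L" for x y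
  proof -
    have "(\<lambda>y. \<tau> (x \<otimes> y)) \<in> F" unfolding F_def using that by blast
    from span[OF this that(2)] have "\<tau> (x \<otimes> y) = (\<Oplus>i\<in>{..<n}. \<tau> (x \<otimes> u i) \<otimes> \<phi> i y)" .
    also have "\<dots> = (\<Oplus>i\<in>{..<n}. \<tau> (x \<otimes> u i) \<otimes> \<tau> (v i \<otimes> y))"
      using that u v \<tau>cl by (intro finsum_cong') auto
    finally show ?thesis .
  qed
  have vspan: "x = (\<Oplus>i\<in>{..<n}. \<tau> (u i \<otimes> x) \<otimes> v i)" if x: "x \<in> carrier L" for x
  proof (rule nondeg[OF x])
    show "(\<Oplus>i\<in>{..<n}. \<tau> (u i \<otimes> x) \<otimes> v i) \<in> carrier L" using x u v \<tau>cl by (intro finsum_closed) auto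
    fix y assume y: "y \<in> carrier L"
    have "\<tau> ((\<Oplus>i\<in>{..<n}. \<tau> (u i \<otimes> x) \<otimes> v i) \<otimes> y) = \<tau> (\<Oplus>i\<in>{..<n}. \<tau> (u i \<otimes> x) \<otimes> v i \<otimes> y)"
      using x y u v \<tau>cl by (subst finsum_ldistr) auto
    also have "\<dots> = (\<Oplus>i\<in>{..<n}. \<tau> (\<tau> (u i \<otimes> x) \<otimes> v i \<otimes> y))"
      using x y u v \<tau>cl by (intro coeff_maps_finsum \<tau>) auto
    also have "\<dots> = (\<Oplus>i\<in>{..<n}. \<tau> (x \<otimes> u i) \<otimes> \<tau> (v i \<otimes> y))"
    proof (rule finsum_cong')
      fix i assume "i \<in> {..<n}"
      then have i: "u i \<in> carrier L" "v i \<in> carrier L" using u v by auto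
      have "\<tau> (\<tau> (u i \<otimes> x) \<otimes> v i \<otimes> y) = \<tau> (\<tau> (u i \<otimes> x) \<otimes> (v i \<otimes> y))"
        using i x y \<tau>cl by (simp add: m_assoc)
      also have "\<dots> = \<tau> (u i \<otimes> x) \<otimes> \<tau> (v i \<otimes> y)"
        using i x y \<tau> by (intro coeff_maps_center_left) auto
      finally show "\<tau> (\<tau> (u i \<otimes> x) \<otimes> v i \<otimes> y) = \<tau> (x \<otimes> u i) \<otimes> \<tau> (v i \<otimes> y)"
        using i x by (simp add: m_comm)
    qed (use x y u v \<tau>cl in auto)
    also have "\<dots> = \<tau> (x \<otimes> y)" using sp[OF x y] by simp
    finally show "\<tau> (x \<otimes> y) = \<tau> ((\<Oplus>i\<in>{..<n}. \<tau> (u i \<otimes> x) \<otimes> v i) \<otimes> y)" by simp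
  qed
  have uspan: "y = (\<Oplus>i\<in>{..<n}. \<tau> (v i \<otimes> y) \<otimes> u i)" if y: "y \<in> carrier L" for y
  proof (rule nondeg[OF y])
    show "(\<Oplus>i\<in>{..<n}. \<tau> (v i \<otimes> y) \<otimes> u i) \<in> carrier L" using y u v \<tau>cl by (intro finsum_closed) auto
    fix x assume x: "x \<in> carrier L"
    have "\<tau> ((\<Oplus>i\<in>{..<n}. \<tau> (v i \<otimes> y) \<otimes> u i) \<otimes> x) = \<tau> (\<Oplus>i\<in>{..<n}. \<tau> (v i \<otimes> y) \<otimes> u i \<otimes> x)"
      using x y u v \<tau>cl by (subst finsum_ldistr) auto
    also have "\<dots> = (\<Oplus>i\<in>{..<n}. \<tau> (\<tau> (v i \<otimes> y) \<otimes> u i \<otimes> x))"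
      using x y u v \<tau>cl by (intro coeff_maps_finsum \<tau>) auto
    also have "\<dots> = (\<Oplus>i\<in>{..<n}. \<tau> (x \<otimes> u i) \<otimes> \<tau> (v i \<otimes> y))"
    proof (rule finsum_cong')
      fix i assume "i \<in> {..<n}"
      then have i: "u i \<in> carrier L" "v i \<in> carrier L" using u v by auto
      have "\<tau> (\<tau> (v i \<otimes> y) \<otimes> u i \<otimes> x) = \<tau> (\<tau> (v i \<otimes> y) \<otimes> (u i \<otimes> x))"
        using i x y \<tau>cl by (simp add: m_assoc)
      also have "\<dots> = \<tau> (v i \<otimes> y) \<otimes> \<tau> (u i \<otimes> x)"
        using i x y \<tau> by (intro coeff_maps_center_left) auto
      finally show "\<tau> (\<tau> (v i \<otimes> y) \<otimes> u i \<otimes> x) = \<tau> (x \<otimes> u i) \<otimes> \<tau> (v i \<otimes> y)"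
        using i x y \<tau>cl by (simp add: m_comm)
    qed (use x y u v \<tau>cl in auto)
    also have "\<dots> = \<tau> (x \<otimes> y)" using sp[OF x y] by simp
    finally show "\<tau> (y \<otimes> x) = \<tau> ((\<Oplus>i\<in>{..<n}. \<tau> (v i \<otimes> y) \<otimes> u i) \<otimes> x)" using x y by (simp add: m_comm)
  qed
  have "0 < n"
  proof (rule ccontr)
    assume "\<not> 0 < n"
    then have "u0 = \<zero>" using uspan[OF u0(1)] by simp
    then show False using u0 coeff_maps_zero_arg[OF \<tau>(1)] by simp
  qed
  then show ?thesis
    by (intro that[of \<tau> n u v] \<tau> u v(1) vu uspan vspan)
qed

end

section \<open>The enveloping ring\<close>

text \<open>A nonzero \<open>K\<close>-linear form \<open>\<tau>\<close> on \<open>L\<close>, with \<open>K\<close> the center of \<open>P\<close>, and two \<open>K\<close>-bases of \<open>L\<close> dual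
  to each other for the pairing \<open>(x, y) \<mapsto> \<tau> (x y)\<close>. Thus \<open>n\<close> is the degree of \<open>L\<close> over \<open>K\<close>.\<close>

locale galois_dual = galois_data L P d b h c \<kappa> \<beta>
  for L :: "('a, 'k) ring_scheme" (structure) and P :: "('a, 'b, 'm) bimodule_scheme"
    and d b h c \<kappa> \<beta> +
  fixes \<tau> :: "'a \<Rightarrow> 'a" and n :: nat and u v :: "nat \<Rightarrow> 'a"
  assumes tau_coeff: "\<tau> \<in> coeff_maps"
    and tau_center: "\<And>y. y \<in> carrier L \<Longrightarrow> \<tau> y \<in> center"
    and u_closed [simp]: "\<And>i. i < n \<Longrightarrow> u i \<in> carrier L"
    and v_closed [simp]: "\<And>i. i < n \<Longrightarrow> v i \<in> carrier L"
    and tau_dual: "\<And>i j. i < n \<Longrightarrow> j < n \<Longrightarrow> \<tau> (v i \<otimes> u j) = (if i = j then \<one> else \<zero>)"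
    and u_expand: "\<And>y. y \<in> carrier L \<Longrightarrow> y = (\<Oplus>i\<in>{..<n}. \<tau> (v i \<otimes> y) \<otimes> u i)"
    and v_expand: "\<And>y. y \<in> carrier L \<Longrightarrow> y = (\<Oplus>i\<in>{..<n}. \<tau> (u i \<otimes> y) \<otimes> v i)"
    and n_pos: "0 < n"
begin

lemma tau_closed [simp]: "y \<in> carrier L \<Longrightarrow> \<tau> y \<in> carrier L"
  using coeff_maps_closed[OF tau_coeff] .

text \<open>The element \<open>\<Sum>\<^sub>k v\<^sub>k \<otimes> u\<^sub>k\<close> of \<open>L \<otimes>\<^sub>K L\<close> is the same for multiplication by \<open>z\<close> on either side: both
  \<open>z v\<^sub>k\<close> and \<open>u\<^sub>i z\<close> expand with the same coefficients \<open>\<tau> (v\<^sub>k u\<^sub>i z)\<close>, which may cross the tensor sign.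
  The balanced map \<open>T\<close> stands for the tensor product.\<close>

lemma casimir:
  assumes "abelian_group G"
    and T: "\<And>x y. x \<in> carrier L \<Longrightarrow> y \<in> carrier L \<Longrightarrow> T x y \<in> carrier G"
    and add1: "\<And>x x' y. x \<in> carrier L \<Longrightarrow> x' \<in> carrier L \<Longrightarrow> y \<in> carrier L \<Longrightarrow> T (x \<oplus> x') y = T x y \<oplus>\<^bsub>G\<^esub> T x' y"
    and add2: "\<And>x y y'. x \<in> carrier L \<Longrightarrow> y \<in> carrier L \<Longrightarrow> y' \<in> carrier L \<Longrightarrow> T x (y \<oplus> y') = T x y \<oplus>\<^bsub>G\<^esub> T x y'"
    and bal: "\<And>x y z. x \<in> carrier L \<Longrightarrow> y \<in> carrier L \<Longrightarrow> z \<in> center \<Longrightarrow> T (z \<otimes> x) y = T x (z \<otimes> y)"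
    and z: "z \<in> carrier L"
  shows "(\<Oplus>\<^bsub>G\<^esub>k\<in>{..<n}. T (z \<otimes> v k) (u k)) = (\<Oplus>\<^bsub>G\<^esub>k\<in>{..<n}. T (v k) (u k \<otimes> z))"
proof -
  interpret G: abelian_group G by fact
  have "(\<Oplus>\<^bsub>G\<^esub>k\<in>{..<n}. T (z \<otimes> v k) (u k))
    = (\<Oplus>\<^bsub>G\<^esub>k\<in>{..<n}. \<Oplus>\<^bsub>G\<^esub>i\<in>{..<n}. T (v i) (\<tau> (v k \<otimes> (u i \<otimes> z)) \<otimes> u k))"
  proof (rule G.finsum_cong')
    fix k assume "k \<in> {..<n}"
    then have k: "v k \<in> carrier L" "u k \<in> carrier L" by auto
    have "T (z \<otimes> v k) (u k) = T (\<Oplus>i\<in>{..<n}. \<tau> (u i \<otimes> (z \<otimes> v k)) \<otimes> v i) (u k)"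
      using v_expand[of "z \<otimes> v k"] k z by simp
    also have "\<dots> = (\<Oplus>\<^bsub>G\<^esub>i\<in>{..<n}. T (\<tau> (u i \<otimes> (z \<otimes> v k)) \<otimes> v i) (u k))"
      by (rule additive_finsum[OF abelian_group_axioms assms(1)]) (use k z add1 T in auto)
    also have "\<dots> = (\<Oplus>\<^bsub>G\<^esub>i\<in>{..<n}. T (v i) (\<tau> (v k \<otimes> (u i \<otimes> z)) \<otimes> u k))"
    proof (rule G.finsum_cong')
      fix i assume "i \<in> {..<n}"
      then have i: "v i \<in> carrier L" "u i \<in> carrier L" by auto
      have "u i \<otimes> (z \<otimes> v k) = v k \<otimes> (u i \<otimes> z)" using i k z by (simp add: m_ac)
      then show "T (\<tau> (u i \<otimes> (z \<otimes> v k)) \<otimes> v i) (u k) = T (v i) (\<tau> (v k \<otimes> (u i \<otimes> z)) \<otimes> u k)"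
        using i k z tau_center by (simp add: bal)
    qed (use k z T in auto)
    finally show "T (z \<otimes> v k) (u k) = (\<Oplus>\<^bsub>G\<^esub>i\<in>{..<n}. T (v i) (\<tau> (v k \<otimes> (u i \<otimes> z)) \<otimes> u k))" .
  qed (use z T in \<open>auto intro!: G.finsum_closed\<close>)
  also have "\<dots> = (\<Oplus>\<^bsub>G\<^esub>i\<in>{..<n}. \<Oplus>\<^bsub>G\<^esub>k\<in>{..<n}. T (v i) (\<tau> (v k \<otimes> (u i \<otimes> z)) \<otimes> u k))"
    using z T by (intro G.finsum_swap) auto
  also have "\<dots> = (\<Oplus>\<^bsub>G\<^esub>i\<in>{..<n}. T (v i) (u i \<otimes> z))"
  proof (rule G.finsum_cong')
    fix i assume "i \<in> {..<n}"
    then have i: "v i \<in> carrier L" "u i \<in> carrier L" by auto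
    have "T (v i) (\<Oplus>k\<in>{..<n}. \<tau> (v k \<otimes> (u i \<otimes> z)) \<otimes> u k)
        = (\<Oplus>\<^bsub>G\<^esub>k\<in>{..<n}. T (v i) (\<tau> (v k \<otimes> (u i \<otimes> z)) \<otimes> u k))"
      by (rule additive_finsum[OF abelian_group_axioms assms(1)]) (use i z add2 T in auto)
    then show "(\<Oplus>\<^bsub>G\<^esub>k\<in>{..<n}. T (v i) (\<tau> (v k \<otimes> (u i \<otimes> z)) \<otimes> u k)) = T (v i) (u i \<otimes> z)"
      using u_expand[of "u i \<otimes> z"] i z by simp
  qed (use z T in auto)
  finally show ?thesis .
qed

definition klin :: "('a \<Rightarrow> 'a) \<Rightarrow> bool"
  where "klin \<phi> \<longleftrightarrow> \<phi> \<in> carrier L \<rightarrow> carrier L \<and>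
    (\<forall>x\<in>carrier L. \<forall>y\<in>carrier L. \<phi> (x \<oplus> y) = \<phi> x \<oplus> \<phi> y) \<and>
    (\<forall>z\<in>center. \<forall>y\<in>carrier L. \<phi> (z \<otimes> y) = z \<otimes> \<phi> y)"

lemma klin_closed [simp, intro]: "klin \<phi> \<Longrightarrow> y \<in> carrier L \<Longrightarrow> \<phi> y \<in> carrier L"
  and klin_add: "klin \<phi> \<Longrightarrow> x \<in> carrier L \<Longrightarrow> y \<in> carrier L \<Longrightarrow> \<phi> (x \<oplus> y) = \<phi> x \<oplus> \<phi> y"
  and klin_center: "klin \<phi> \<Longrightarrow> z \<in> center \<Longrightarrow> y \<in> carrier L \<Longrightarrow> \<phi> (z \<otimes> y) = z \<otimes> \<phi> y"
  by (auto simp: klin_def)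

lemma klin_coeff_maps: "\<phi> \<in> coeff_maps \<Longrightarrow> klin \<phi>"
  by (auto simp: klin_def coeff_maps_closed coeff_maps_additive coeff_maps_center_left)

lemma klin_tau: "klin \<tau>" by (rule klin_coeff_maps[OF tau_coeff])

lemma klin_finsum:
  assumes "klin \<phi>" "\<And>i. i \<in> I \<Longrightarrow> x i \<in> carrier L"
  shows "\<phi> (\<Oplus>i\<in>I. x i) = (\<Oplus>i\<in>I. \<phi> (x i))"
  by (rule additive_finsum[OF abelian_group_axioms abelian_group_axioms])
    (use assms in \<open>auto simp: klin_add\<close>)

lemma klin_restrict: "klin (restrict \<phi> (carrier L)) \<longleftrightarrow> klin \<phi>"
  unfolding klin_def by (auto simp: center_closed Pi_iff)

lemma klin_v_expand:
  assumes "klin \<phi>" "y \<in> carrier L"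
  shows "\<phi> y = (\<Oplus>j\<in>{..<n}. \<phi> (v j) \<otimes> \<tau> (u j \<otimes> y))"
proof -
  have "\<phi> y = \<phi> (\<Oplus>j\<in>{..<n}. \<tau> (u j \<otimes> y) \<otimes> v j)" using v_expand[OF assms(2)] by simp
  also have "\<dots> = (\<Oplus>j\<in>{..<n}. \<phi> (\<tau> (u j \<otimes> y) \<otimes> v j))"
    using assms by (intro klin_finsum) auto
  also have "\<dots> = (\<Oplus>j\<in>{..<n}. \<phi> (v j) \<otimes> \<tau> (u j \<otimes> y))"
  proof (rule finsum_cong')
    fix j assume "j \<in> {..<n}"
    then have j: "u j \<in> carrier L" "v j \<in> carrier L" by auto
    have "\<phi> (\<tau> (u j \<otimes> y) \<otimes> v j) = \<tau> (u j \<otimes> y) \<otimes> \<phi> (v j)"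
      using assms j tau_center by (intro klin_center) auto
    then show "\<phi> (\<tau> (u j \<otimes> y) \<otimes> v j) = \<phi> (v j) \<otimes> \<tau> (u j \<otimes> y)"
      using assms j m_comm[of "\<phi> (v j)" "\<tau> (u j \<otimes> y)"] by simp
  qed (use assms in auto)
  finally show ?thesis .
qed

lemma klin_u_expand:
  assumes "klin \<phi>" "x \<in> carrier L" "y \<in> carrier L"
  shows "(\<Oplus>j\<in>{..<n}. \<tau> (x \<otimes> v j) \<otimes> \<phi> (u j \<otimes> y)) = \<phi> (x \<otimes> y)"
proof -
  have "\<phi> (x \<otimes> y) = \<phi> ((\<Oplus>j\<in>{..<n}. \<tau> (v j \<otimes> x) \<otimes> u j) \<otimes> y)" using u_expand[OF assms(2)] by simp
  also have "\<dots> = \<phi> (\<Oplus>j\<in>{..<n}. \<tau> (v j \<otimes> x) \<otimes> u j \<otimes> y)"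
    using assms by (subst finsum_ldistr) auto
  also have "\<dots> = (\<Oplus>j\<in>{..<n}. \<phi> (\<tau> (v j \<otimes> x) \<otimes> u j \<otimes> y))"
    using assms by (intro klin_finsum) auto
  also have "\<dots> = (\<Oplus>j\<in>{..<n}. \<tau> (x \<otimes> v j) \<otimes> \<phi> (u j \<otimes> y))"
    using assms tau_center by (intro finsum_cong') (auto simp: klin_center m_assoc m_comm[of x])
  finally show ?thesis by simp
qed

text \<open>The product of \<open>L \<otimes>\<^sub>K L\<close>, transported to \<open>K\<close>-linear maps by \<open>x \<otimes> y \<mapsto> x \<tau> (y _)\<close>. The inverse of
  this identification sends \<open>\<phi>\<close> to \<open>\<Sum>\<^sub>j \<phi> (v\<^sub>j) \<otimes> u\<^sub>j\<close>.\<close>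

definition conv :: "('a \<Rightarrow> 'a) \<Rightarrow> ('a \<Rightarrow> 'a) \<Rightarrow> 'a \<Rightarrow> 'a"
  where "conv \<phi> \<psi> = (\<lambda>y\<in>carrier L. \<Oplus>j\<in>{..<n}. \<phi> (v j) \<otimes> \<psi> (u j \<otimes> y))"

text \<open>The enveloping ring \<open>L \<otimes>\<^sub>K L\<close> as a ring of functions. It acts on each \<open>L\<close>-bimodule with center
  containing \<open>K\<close>. Maps are made extensional so that they are determined by their values on \<open>L\<close>.\<close>

definition E :: "('a \<Rightarrow> 'a) ring"
  where "E = \<lparr>carrier = {\<phi> \<in> extensional (carrier L). klin \<phi>}, monoid.mult = conv,
    one = restrict \<tau> (carrier L), ring.zero = (\<lambda>y\<in>carrier L. \<zero>),
    add = (\<lambda>\<phi> \<psi>. \<lambda>y\<in>carrier L. \<phi> y \<oplus> \<psi> y)\<rparr>"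

lemma E_simps: "carrier E = {\<phi> \<in> extensional (carrier L). klin \<phi>}"
  "\<phi> \<otimes>\<^bsub>E\<^esub> \<psi> = conv \<phi> \<psi>" "\<one>\<^bsub>E\<^esub> = restrict \<tau> (carrier L)" "\<zero>\<^bsub>E\<^esub> = (\<lambda>y\<in>carrier L. \<zero>)"
  "\<phi> \<oplus>\<^bsub>E\<^esub> \<psi> = (\<lambda>y\<in>carrier L. \<phi> y \<oplus> \<psi> y)"
  by (simp_all add: E_def)

lemma E_klin: "\<phi> \<in> carrier E \<Longrightarrow> klin \<phi>" by (simp add: E_simps)

lemma E_closed [simp]: "\<phi> \<in> carrier E \<Longrightarrow> y \<in> carrier L \<Longrightarrow> \<phi> y \<in> carrier L"
  using E_klin by blast

lemma E_restrictI: "klin \<phi> \<Longrightarrow> restrict \<phi> (carrier L) \<in> carrier E"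
  by (simp add: E_simps klin_restrict)

lemma E_eqI: "\<phi> \<in> carrier E \<Longrightarrow> \<psi> \<in> carrier E \<Longrightarrow> (\<And>y. y \<in> carrier L \<Longrightarrow> \<phi> y = \<psi> y) \<Longrightarrow> \<phi> = \<psi>"
  unfolding E_simps by (auto intro: extensionalityI)

lemma conv_apply: "y \<in> carrier L \<Longrightarrow> conv \<phi> \<psi> y = (\<Oplus>j\<in>{..<n}. \<phi> (v j) \<otimes> \<psi> (u j \<otimes> y))"
  by (simp add: conv_def)

lemma klin_conv:
  assumes "klin \<phi>" "klin \<psi>" shows "klin (conv \<phi> \<psi>)"
  unfolding klin_def
proof (intro conjI ballI funcsetI)
  fix x assume x: "x \<in> carrier L"
  show "conv \<phi> \<psi> x \<in> carrier L" using assms x by (auto simp: conv_apply intro!: finsum_closed)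
  { fix y assume y: "y \<in> carrier L"
    have "conv \<phi> \<psi> (x \<oplus> y) = (\<Oplus>j\<in>{..<n}. \<phi> (v j) \<otimes> \<psi> (u j \<otimes> x) \<oplus> \<phi> (v j) \<otimes> \<psi> (u j \<otimes> y))"
      using assms x y
      by (simp only: conv_apply a_closed) (intro finsum_cong', auto simp: r_distr klin_add)
    also have "\<dots> = conv \<phi> \<psi> x \<oplus> conv \<phi> \<psi> y"
      using assms x y by (simp only: conv_apply) (intro finsum_addf, auto)
    finally show "conv \<phi> \<psi> (x \<oplus> y) = conv \<phi> \<psi> x \<oplus> conv \<phi> \<psi> y" . }
  { fix z assume z: "z \<in> center"
    have zL: "z \<in> carrier L" using z by (rule center_closed)
    have "conv \<phi> \<psi> (z \<otimes> x) = (\<Oplus>j\<in>{..<n}. z \<otimes> (\<phi> (v j) \<otimes> \<psi> (u j \<otimes> x)))"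
    proof -
      have "\<phi> (v j) \<otimes> \<psi> (u j \<otimes> (z \<otimes> x)) = z \<otimes> (\<phi> (v j) \<otimes> \<psi> (u j \<otimes> x))" if "j < n" for j
      proof -
        have "u j \<otimes> (z \<otimes> x) = z \<otimes> (u j \<otimes> x)" using that x zL by (simp add: m_lcomm)
        then show ?thesis using that assms x z zL by (simp add: klin_center m_lcomm)
      qed
      then show ?thesis using assms x zL by (simp only: conv_apply m_closed) (intro finsum_cong', auto)
    qed
    also have "\<dots> = z \<otimes> conv \<phi> \<psi> x"
      using assms x zL by (simp only: conv_apply) (intro finsum_rdistr[symmetric], auto)
    finally show "conv \<phi> \<psi> (z \<otimes> x) = z \<otimes> conv \<phi> \<psi> x" . }
qed

lemma conv_closed: "\<phi> \<in> carrier E \<Longrightarrow> \<psi> \<in> carrier E \<Longrightarrow> conv \<phi> \<psi> \<in> carrier E"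
  using klin_conv by (simp add: E_simps conv_def)

text \<open>Expanding \<open>\<psi>\<close> in the basis \<open>v\<close> gives the symmetric expression
  \<open>\<Sum>\<^sub>j\<^sub>k \<phi> (v\<^sub>j) \<psi> (v\<^sub>k) \<tau> (u\<^sub>j u\<^sub>k y)\<close>.\<close>

lemma conv_comm:
  assumes "\<phi> \<in> carrier E" "\<psi> \<in> carrier E"
  shows "conv \<phi> \<psi> = conv \<psi> \<phi>"
proof (rule E_eqI)
  fix y assume y: "y \<in> carrier L"
  note kl = E_klin[OF assms(1)] E_klin[OF assms(2)]
  have "conv \<phi> \<psi> y = (\<Oplus>j\<in>{..<n}. \<Oplus>k\<in>{..<n}. \<psi> (v k) \<otimes> (\<phi> (v j) \<otimes> \<tau> (u j \<otimes> (u k \<otimes> y))))"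
    unfolding conv_apply[OF y]
  proof (rule finsum_cong')
    fix j assume j: "j \<in> {..<n}"
    have "\<phi> (v j) \<otimes> \<psi> (u j \<otimes> y) = \<phi> (v j) \<otimes> (\<Oplus>k\<in>{..<n}. \<psi> (v k) \<otimes> \<tau> (u k \<otimes> (u j \<otimes> y)))"
      using klin_v_expand[OF kl(2), of "u j \<otimes> y"] j y by simp
    also have "\<dots> = (\<Oplus>k\<in>{..<n}. \<phi> (v j) \<otimes> (\<psi> (v k) \<otimes> \<tau> (u k \<otimes> (u j \<otimes> y))))"
      using j y kl by (intro finsum_rdistr) auto
    also have "\<dots> = (\<Oplus>k\<in>{..<n}. \<psi> (v k) \<otimes> (\<phi> (v j) \<otimes> \<tau> (u j \<otimes> (u k \<otimes> y))))"
      using j y kl by (intro finsum_cong') (auto simp: m_lcomm)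
    finally show "\<phi> (v j) \<otimes> \<psi> (u j \<otimes> y) = (\<Oplus>k\<in>{..<n}. \<psi> (v k) \<otimes> (\<phi> (v j) \<otimes> \<tau> (u j \<otimes> (u k \<otimes> y))))" .
  qed (use y kl in \<open>auto intro!: finsum_closed\<close>)
  also have "\<dots> = (\<Oplus>k\<in>{..<n}. \<Oplus>j\<in>{..<n}. \<psi> (v k) \<otimes> (\<phi> (v j) \<otimes> \<tau> (u j \<otimes> (u k \<otimes> y))))"
    using y kl by (intro finsum_swap) auto
  also have "\<dots> = (\<Oplus>k\<in>{..<n}. \<psi> (v k) \<otimes> \<phi> (u k \<otimes> y))"
  proof (rule finsum_cong')
    fix k assume k: "k \<in> {..<n}"
    have "(\<Oplus>j\<in>{..<n}. \<psi> (v k) \<otimes> (\<phi> (v j) \<otimes> \<tau> (u j \<otimes> (u k \<otimes> y))))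
      = \<psi> (v k) \<otimes> (\<Oplus>j\<in>{..<n}. \<phi> (v j) \<otimes> \<tau> (u j \<otimes> (u k \<otimes> y)))"
      using k y kl by (intro finsum_rdistr[symmetric]) auto
    then show "(\<Oplus>j\<in>{..<n}. \<psi> (v k) \<otimes> (\<phi> (v j) \<otimes> \<tau> (u j \<otimes> (u k \<otimes> y)))) = \<psi> (v k) \<otimes> \<phi> (u k \<otimes> y)"
      using klin_v_expand[OF kl(1), of "u k \<otimes> y"] k y by simp
  qed (use y kl in auto)
  finally show "conv \<phi> \<psi> y = conv \<psi> \<phi> y" by (simp add: conv_apply[OF y])
qed (use assms conv_closed in auto)

lemma casimir_klin:
  assumes "klin \<phi>" "klin \<psi>" "z \<in> carrier L" "y \<in> carrier L"
  shows "(\<Oplus>k\<in>{..<n}. \<phi> (z \<otimes> v k) \<otimes> \<psi> (u k \<otimes> y)) = (\<Oplus>k\<in>{..<n}. \<phi> (v k) \<otimes> \<psi> (u k \<otimes> (z \<otimes> y)))"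
proof -
  have "(\<Oplus>k\<in>{..<n}. \<phi> (z \<otimes> v k) \<otimes> \<psi> (u k \<otimes> y)) = (\<Oplus>k\<in>{..<n}. \<phi> (v k) \<otimes> \<psi> ((u k \<otimes> z) \<otimes> y))"
  proof (rule casimir[where T = "\<lambda>a b. \<phi> a \<otimes> \<psi> (b \<otimes> y)", OF abelian_group_axioms])
    fix x x' w assume x: "x \<in> carrier L" "x' \<in> carrier L" and w: "w \<in> center"
    have wL: "w \<in> carrier L" using w by (rule center_closed)
    have "\<psi> (w \<otimes> x' \<otimes> y) = w \<otimes> \<psi> (x' \<otimes> y)"
      using klin_center[OF assms(2) w, of "x' \<otimes> y"] x wL assms(4) by (simp add: m_assoc)
    moreover have "\<phi> (w \<otimes> x) = w \<otimes> \<phi> x" using klin_center[OF assms(1) w x(1)] .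
    moreover have "\<phi> x \<in> carrier L" "\<psi> (x' \<otimes> y) \<in> carrier L" using assms x by auto
    ultimately show "\<phi> (w \<otimes> x) \<otimes> \<psi> (x' \<otimes> y) = \<phi> x \<otimes> \<psi> (w \<otimes> x' \<otimes> y)"
      using wL by (simp add: m_ac)
  qed (use assms in \<open>auto simp: klin_add l_distr r_distr\<close>)
  also have "\<dots> = (\<Oplus>k\<in>{..<n}. \<phi> (v k) \<otimes> \<psi> (u k \<otimes> (z \<otimes> y)))"
    using assms by (intro finsum_cong') (auto simp: m_assoc)
  finally show ?thesis .
qed

lemma conv_assoc:
  assumes "\<phi> \<in> carrier E" "\<psi> \<in> carrier E" "\<chi> \<in> carrier E"
  shows "conv (conv \<phi> \<psi>) \<chi> = conv \<phi> (conv \<psi> \<chi>)"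
proof (rule E_eqI)
  fix y assume y: "y \<in> carrier L"
  note kl = E_klin[OF assms(1)] E_klin[OF assms(2)] E_klin[OF assms(3)]
  have "conv (conv \<phi> \<psi>) \<chi> y = (\<Oplus>k\<in>{..<n}. \<Oplus>j\<in>{..<n}. \<phi> (v j) \<otimes> (\<psi> (u j \<otimes> v k) \<otimes> \<chi> (u k \<otimes> y)))"
    unfolding conv_apply[OF y]
  proof (rule finsum_cong')
    fix k assume k: "k \<in> {..<n}"
    have "conv \<phi> \<psi> (v k) \<otimes> \<chi> (u k \<otimes> y) = (\<Oplus>j\<in>{..<n}. \<phi> (v j) \<otimes> \<psi> (u j \<otimes> v k) \<otimes> \<chi> (u k \<otimes> y))"
      using k y kl by (simp only: conv_apply v_closed lessThan_iff) (intro finsum_ldistr, auto)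
    also have "\<dots> = (\<Oplus>j\<in>{..<n}. \<phi> (v j) \<otimes> (\<psi> (u j \<otimes> v k) \<otimes> \<chi> (u k \<otimes> y)))"
      using k y kl by (intro finsum_cong') (auto simp: m_assoc)
    finally show "conv \<phi> \<psi> (v k) \<otimes> \<chi> (u k \<otimes> y) = (\<Oplus>j\<in>{..<n}. \<phi> (v j) \<otimes> (\<psi> (u j \<otimes> v k) \<otimes> \<chi> (u k \<otimes> y)))" .
  qed (use y kl in \<open>auto intro!: finsum_closed\<close>)
  also have "\<dots> = (\<Oplus>j\<in>{..<n}. \<Oplus>k\<in>{..<n}. \<phi> (v j) \<otimes> (\<psi> (u j \<otimes> v k) \<otimes> \<chi> (u k \<otimes> y)))"
    using y kl by (intro finsum_swap) auto
  also have "\<dots> = (\<Oplus>j\<in>{..<n}. \<phi> (v j) \<otimes> conv \<psi> \<chi> (u j \<otimes> y))"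
  proof (rule finsum_cong')
    fix j assume j: "j \<in> {..<n}"
    have "(\<Oplus>k\<in>{..<n}. \<phi> (v j) \<otimes> (\<psi> (u j \<otimes> v k) \<otimes> \<chi> (u k \<otimes> y)))
      = \<phi> (v j) \<otimes> (\<Oplus>k\<in>{..<n}. \<psi> (u j \<otimes> v k) \<otimes> \<chi> (u k \<otimes> y))"
      using j y kl by (intro finsum_rdistr[symmetric]) auto
    also have "(\<Oplus>k\<in>{..<n}. \<psi> (u j \<otimes> v k) \<otimes> \<chi> (u k \<otimes> y)) = conv \<psi> \<chi> (u j \<otimes> y)"
      using casimir_klin[OF kl(2,3), of "u j" y] j y by (simp add: conv_apply)
    finally show "(\<Oplus>k\<in>{..<n}. \<phi> (v j) \<otimes> (\<psi> (u j \<otimes> v k) \<otimes> \<chi> (u k \<otimes> y))) = \<phi> (v j) \<otimes> conv \<psi> \<chi> (u j \<otimes> y)" .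
  qed (use y kl klin_conv in auto)
  finally show "conv (conv \<phi> \<psi>) \<chi> y = conv \<phi> (conv \<psi> \<chi>) y" by (simp add: conv_apply[OF y])
qed (use assms conv_closed in auto)

lemma conv_one:
  assumes "\<phi> \<in> carrier E" shows "conv (restrict \<tau> (carrier L)) \<phi> = \<phi>"
proof (rule E_eqI)
  fix y assume y: "y \<in> carrier L"
  have "(\<Oplus>j\<in>{..<n}. \<tau> (\<one> \<otimes> v j) \<otimes> \<phi> (u j \<otimes> y)) = \<phi> (\<one> \<otimes> y)"
    using y E_klin[OF assms] by (intro klin_u_expand) auto
  moreover have "conv (restrict \<tau> (carrier L)) \<phi> y = (\<Oplus>j\<in>{..<n}. \<tau> (\<one> \<otimes> v j) \<otimes> \<phi> (u j \<otimes> y))"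
    unfolding conv_apply[OF y] using y assms by (intro finsum_cong') auto
  ultimately show "conv (restrict \<tau> (carrier L)) \<phi> y = \<phi> y" using y by simp
qed (use assms conv_closed E_restrictI klin_tau in auto)

lemma E_add_closed:
  assumes "\<phi> \<in> carrier E" "\<psi> \<in> carrier E" shows "\<phi> \<oplus>\<^bsub>E\<^esub> \<psi> \<in> carrier E"
  unfolding E_simps(5)
proof (rule E_restrictI)
  note kl = E_klin[OF assms(1)] E_klin[OF assms(2)]
  show "klin (\<lambda>y. \<phi> y \<oplus> \<psi> y)"
    unfolding klin_def
  proof (intro conjI ballI funcsetI)
    fix x assume x: "x \<in> carrier L"
    have c: "\<phi> x \<in> carrier L" "\<psi> x \<in> carrier L" using x kl by auto
    show "\<phi> x \<oplus> \<psi> x \<in> carrier L" using c by simp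
    { fix y assume y: "y \<in> carrier L"
      have "\<phi> y \<in> carrier L" "\<psi> y \<in> carrier L" using y kl by auto
      then show "\<phi> (x \<oplus> y) \<oplus> \<psi> (x \<oplus> y) = \<phi> x \<oplus> \<psi> x \<oplus> (\<phi> y \<oplus> \<psi> y)"
        using c by (simp only: klin_add[OF kl(1) x y] klin_add[OF kl(2) x y]) (simp add: a_ac) }
    { fix z assume z: "z \<in> center"
      then show "\<phi> (z \<otimes> x) \<oplus> \<psi> (z \<otimes> x) = z \<otimes> (\<phi> x \<oplus> \<psi> x)"
        using c by (simp only: klin_center[OF kl(1) z x] klin_center[OF kl(2) z x])
          (simp add: r_distr center_closed) }
  qed
qed

lemma E_zero_closed: "\<zero>\<^bsub>E\<^esub> \<in> carrier E"
  unfolding E_simps(4) by (rule E_restrictI) (auto simp: klin_def center_closed)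

lemma cring_E: "cring E"
proof (rule cringI)
  show "abelian_group E"
  proof (rule abelian_groupI)
    fix \<phi> assume \<phi>: "\<phi> \<in> carrier E"
    have "klin (\<lambda>y. \<ominus> \<phi> y)"
      unfolding klin_def
    proof (intro conjI ballI funcsetI)
      fix x y assume x: "x \<in> carrier L" and y: "y \<in> carrier L"
      show "\<ominus> \<phi> (x \<oplus> y) = \<ominus> \<phi> x \<oplus> \<ominus> \<phi> y"
        using \<phi> x y by (simp add: klin_add[OF E_klin[OF \<phi>]] minus_add)
    next
      fix z y assume z: "z \<in> center" and y: "y \<in> carrier L"
      show "\<ominus> \<phi> (z \<otimes> y) = z \<otimes> \<ominus> \<phi> y"
        using \<phi> y z by (simp add: klin_center[OF E_klin[OF \<phi>]] r_minus center_closed)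
    qed (use \<phi> in simp)
    then have "restrict (\<lambda>y. \<ominus> \<phi> y) (carrier L) \<in> carrier E" by (rule E_restrictI)
    moreover have "restrict (\<lambda>y. \<ominus> \<phi> y) (carrier L) \<oplus>\<^bsub>E\<^esub> \<phi> = \<zero>\<^bsub>E\<^esub>"
      using \<phi> by (auto simp: E_simps(4,5) l_neg)
    ultimately show "\<exists>\<psi>\<in>carrier E. \<psi> \<oplus>\<^bsub>E\<^esub> \<phi> = \<zero>\<^bsub>E\<^esub>" by blast
    show "\<zero>\<^bsub>E\<^esub> \<oplus>\<^bsub>E\<^esub> \<phi> = \<phi>"
      using \<phi> by (intro E_eqI E_add_closed E_zero_closed) (auto simp: E_simps(4,5))
  next
    fix \<phi> \<psi> \<chi> assume "\<phi> \<in> carrier E" "\<psi> \<in> carrier E" "\<chi> \<in> carrier E"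
    then show "(\<phi> \<oplus>\<^bsub>E\<^esub> \<psi>) \<oplus>\<^bsub>E\<^esub> \<chi> = \<phi> \<oplus>\<^bsub>E\<^esub> (\<psi> \<oplus>\<^bsub>E\<^esub> \<chi>)"
      by (intro E_eqI E_add_closed) (auto simp: E_simps(5) a_assoc)
  next
    fix \<phi> \<psi> assume "\<phi> \<in> carrier E" "\<psi> \<in> carrier E"
    then show "\<phi> \<oplus>\<^bsub>E\<^esub> \<psi> = \<psi> \<oplus>\<^bsub>E\<^esub> \<phi>"
      by (intro E_eqI E_add_closed) (auto simp: E_simps(5) a_comm)
  qed (simp_all add: E_add_closed E_zero_closed)
  show "comm_monoid E"
  proof (rule comm_monoidI)
    show "\<one>\<^bsub>E\<^esub> \<in> carrier E" unfolding E_simps(3) by (rule E_restrictI[OF klin_tau])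
  qed (use conv_closed conv_assoc conv_one conv_comm in \<open>auto simp: E_simps(2,3)\<close>)
  fix \<phi> \<psi> \<chi> assume E: "\<phi> \<in> carrier E" "\<psi> \<in> carrier E" "\<chi> \<in> carrier E"
  show "(\<phi> \<oplus>\<^bsub>E\<^esub> \<psi>) \<otimes>\<^bsub>E\<^esub> \<chi> = \<phi> \<otimes>\<^bsub>E\<^esub> \<chi> \<oplus>\<^bsub>E\<^esub> \<psi> \<otimes>\<^bsub>E\<^esub> \<chi>"
  proof (rule E_eqI)
    fix y assume y: "y \<in> carrier L"
    have "((\<phi> \<oplus>\<^bsub>E\<^esub> \<psi>) \<otimes>\<^bsub>E\<^esub> \<chi>) y = (\<Oplus>j\<in>{..<n}. \<phi> (v j) \<otimes> \<chi> (u j \<otimes> y) \<oplus> \<psi> (v j) \<otimes> \<chi> (u j \<otimes> y))"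
      unfolding E_simps(2,5) conv_apply[OF y] using E y by (intro finsum_cong') (auto simp: l_distr)
    also have "\<dots> = (\<phi> \<otimes>\<^bsub>E\<^esub> \<chi> \<oplus>\<^bsub>E\<^esub> \<psi> \<otimes>\<^bsub>E\<^esub> \<chi>) y"
      unfolding E_simps(2,5) using E y by (simp only: conv_apply restrict_apply') (intro finsum_addf, auto)
    finally show "((\<phi> \<oplus>\<^bsub>E\<^esub> \<psi>) \<otimes>\<^bsub>E\<^esub> \<chi>) y = (\<phi> \<otimes>\<^bsub>E\<^esub> \<chi> \<oplus>\<^bsub>E\<^esub> \<psi> \<otimes>\<^bsub>E\<^esub> \<chi>) y" .
  qed (use E E_add_closed conv_closed in \<open>auto simp: E_simps(2)\<close>)
qed

end

section \<open>The module structure over the enveloping ring\<close>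

context galois_dual
begin

text \<open>The tensor \<open>\<Sum>\<^sub>j \<phi> (v\<^sub>j) \<otimes> u\<^sub>j\<close> acting with its left factor from the left and with its right factor
  from the right.\<close>

definition act :: "('a \<Rightarrow> 'a) \<Rightarrow> 'b \<Rightarrow> 'b"
  where "act \<phi> p = (\<Oplus>\<^bsub>P\<^esub>j\<in>{..<n}. \<phi> (v j) \<triangleright> (p \<triangleleft> u j))"

definition PE :: "('a \<Rightarrow> 'a, 'b) module"
  where "PE = \<lparr>carrier = carrier P, monoid.mult = undefined, one = undefined,
    ring.zero = \<zero>\<^bsub>P\<^esub>, add = add P, smult = act\<rparr>"

lemma PE_simps [simp]: "carrier PE = carrier P" "\<zero>\<^bsub>PE\<^esub> = \<zero>\<^bsub>P\<^esub>" "add PE = add P" "smult PE = act"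
  by (simp_all add: PE_def)

lemma finsum_PE [simp]: "finsum PE = finsum P"
  by (rule ext, rule ext) (simp add: PE_def finsum_def finprod_def)

lemma act_closed [simp]: "klin \<phi> \<Longrightarrow> p \<in> carrier P \<Longrightarrow> act \<phi> p \<in> carrier P"
  unfolding act_def by (intro left.M.finsum_closed) auto

lemma form_act:
  assumes "left.linear_form g" "klin \<phi>" "p \<in> carrier P"
  shows "g (act \<phi> p) = (\<Oplus>j\<in>{..<n}. \<phi> (v j) \<otimes> g (p \<triangleleft> u j))"
proof -
  have "g (act \<phi> p) = (\<Oplus>j\<in>{..<n}. g (\<phi> (v j) \<triangleright> (p \<triangleleft> u j)))"
    unfolding act_def using assms by (intro left.linear_form_finsum) auto
  also have "\<dots> = (\<Oplus>j\<in>{..<n}. \<phi> (v j) \<otimes> g (p \<triangleleft> u j))"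
    using assms by (intro finsum_cong') (auto simp: left.linear_form_smult)
  finally show ?thesis .
qed

lemma klin_form:
  assumes g: "left.linear_form g" and p: "p \<in> carrier P"
  shows "klin (\<lambda>y. g (p \<triangleleft> y))"
  by (rule klin_coeff_maps[OF coeff_mapI[OF g p]])

lemma act_ract:
  assumes "klin \<phi>" "p \<in> carrier P" "y \<in> carrier L"
  shows "act \<phi> p \<triangleleft> y = act \<phi> (p \<triangleleft> y)"
proof -
  have "act \<phi> p \<triangleleft> y = (\<Oplus>\<^bsub>P\<^esub>j\<in>{..<n}. (\<phi> (v j) \<triangleright> (p \<triangleleft> u j)) \<triangleleft> y)"
    unfolding act_def using assms by (intro finsum_ract) auto
  also have "\<dots> = act \<phi> (p \<triangleleft> y)"
    unfolding act_def
  proof (rule left.M.finsum_cong')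
    fix j assume "j \<in> {..<n}"
    then have j: "u j \<in> carrier L" "\<phi> (v j) \<in> carrier L" using assms by auto
    then show "(\<phi> (v j) \<triangleright> (p \<triangleleft> u j)) \<triangleleft> y = \<phi> (v j) \<triangleright> (p \<triangleleft> y \<triangleleft> u j)"
      using assms by (simp add: lact_ract ract_ract m_comm)
  qed (use assms in auto)
  finally show ?thesis .
qed

text \<open>The left linear forms translate the action of \<open>E\<close> on \<open>P\<close> into the multiplication of \<open>E\<close>. Since forms
  separate the points of \<open>P\<close>, identities in \<open>P\<close> can be read off from identities in \<open>E\<close>.\<close>

lemma form_act_ract:
  assumes "left.linear_form g" "klin \<phi>" "p \<in> carrier P" "y \<in> carrier L"
  shows "g (act \<phi> p \<triangleleft> y) = conv \<phi> (\<lambda>y. g (p \<triangleleft> y)) y"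
  using assms form_act[of g \<phi> "p \<triangleleft> y"]
  by (simp add: act_ract conv_apply) (intro finsum_cong', auto simp: ract_ract m_comm)

lemma act_conv:
  assumes \<phi>: "\<phi> \<in> carrier E" and \<psi>: "\<psi> \<in> carrier E" and p: "p \<in> carrier P"
  shows "act (conv \<phi> \<psi>) p = act \<phi> (act \<psi> p)"
proof (rule forms_separate)
  note kl = E_klin[OF \<phi>] E_klin[OF \<psi>]
  show "act (conv \<phi> \<psi>) p \<in> carrier P" "act \<phi> (act \<psi> p) \<in> carrier P"
    using kl p klin_conv by auto
  fix g assume g: "left.linear_form g"
  define \<chi> where "\<chi> = restrict (\<lambda>y. g (p \<triangleleft> y)) (carrier L)"
  have \<chi>: "\<chi> \<in> carrier E" unfolding \<chi>_def by (rule E_restrictI[OF klin_form[OF g p]])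
  have 1: "g (act \<eta> p \<triangleleft> y) = conv \<eta> \<chi> y" if "klin \<eta>" "y \<in> carrier L" for \<eta> y
  proof -
    have "conv \<eta> (\<lambda>y. g (p \<triangleleft> y)) y = conv \<eta> \<chi> y"
      unfolding conv_apply[OF that(2)] using that g p by (intro finsum_cong') (auto simp: \<chi>_def)
    then show ?thesis using form_act_ract[OF g that(1) p that(2)] by simp
  qed
  have "g (act \<phi> (act \<psi> p) \<triangleleft> \<one>) = conv \<phi> (\<lambda>y. g (act \<psi> p \<triangleleft> y)) \<one>"
    using form_act_ract[OF g kl(1) _ one_closed, of "act \<psi> p"] kl p by simp
  also have "\<dots> = conv \<phi> (conv \<psi> \<chi>) \<one>"
    unfolding conv_apply[OF one_closed] using kl 1[OF kl(2)] E_closed[OF conv_closed[OF \<psi> \<chi>]]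
    by (intro finsum_cong') auto
  also have "\<dots> = conv (conv \<phi> \<psi>) \<chi> \<one>" by (simp add: conv_assoc[OF \<phi> \<psi> \<chi>])
  also have "\<dots> = g (act (conv \<phi> \<psi>) p \<triangleleft> \<one>)" using 1[OF klin_conv[OF kl] one_closed] by simp
  finally show "g (act (conv \<phi> \<psi>) p) = g (act \<phi> (act \<psi> p))"
    using kl p klin_conv by simp
qed

text \<open>The images of \<open>x \<otimes> \<one>\<close> and \<open>\<one> \<otimes> y\<close>; acting by them is acting from the left and from the right.\<close>

definition lam :: "'a \<Rightarrow> 'a \<Rightarrow> 'a" where "lam x = (\<lambda>w\<in>carrier L. x \<otimes> \<tau> w)"
definition rho :: "'a \<Rightarrow> 'a \<Rightarrow> 'a" where "rho y = (\<lambda>w\<in>carrier L. \<tau> (y \<otimes> w))"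

lemma lam_closed [simp]: "x \<in> carrier L \<Longrightarrow> lam x \<in> carrier E"
  unfolding lam_def by (intro E_restrictI klin_coeff_maps coeff_maps_scale tau_coeff)

lemma rho_closed [simp]: "y \<in> carrier L \<Longrightarrow> rho y \<in> carrier E"
  unfolding rho_def by (intro E_restrictI klin_coeff_maps coeff_maps_rmult tau_coeff)

lemma conv_rho:
  assumes "klin \<phi>" "y \<in> carrier L" "w \<in> carrier L" shows "conv (rho y) \<phi> w = \<phi> (y \<otimes> w)"
proof -
  have "conv (rho y) \<phi> w = (\<Oplus>j\<in>{..<n}. \<tau> (y \<otimes> v j) \<otimes> \<phi> (u j \<otimes> w))"
    unfolding conv_apply[OF assms(3)] using assms by (intro finsum_cong') (auto simp: rho_def)
  then show ?thesis using klin_u_expand[OF assms] by simp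
qed

lemma conv_lam:
  assumes "klin \<phi>" "x \<in> carrier L" "w \<in> carrier L" shows "conv (lam x) \<phi> w = x \<otimes> \<phi> w"
proof -
  have "conv (lam x) \<phi> w = (\<Oplus>j\<in>{..<n}. x \<otimes> (\<tau> (\<one> \<otimes> v j) \<otimes> \<phi> (u j \<otimes> w)))"
    unfolding conv_apply[OF assms(3)] using assms by (intro finsum_cong') (auto simp: lam_def m_assoc)
  also have "\<dots> = x \<otimes> (\<Oplus>j\<in>{..<n}. \<tau> (\<one> \<otimes> v j) \<otimes> \<phi> (u j \<otimes> w))"
    using assms by (intro finsum_rdistr[symmetric]) auto
  also have "\<dots> = x \<otimes> \<phi> w"
    using klin_u_expand[OF assms(1) one_closed assms(3)] assms(3) by simp
  finally show ?thesis .
qed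

lemma act_rho:
  assumes p: "p \<in> carrier P" and y: "y \<in> carrier L" shows "act (rho y) p = p \<triangleleft> y"
proof (rule forms_separate)
  fix g assume g: "left.linear_form g"
  have "g (act (rho y) p) = g (act (rho y) p \<triangleleft> \<one>)" using p y E_klin[OF rho_closed[OF y]] by simp
  also have "\<dots> = g (p \<triangleleft> (y \<otimes> \<one>))"
    using form_act_ract[OF g E_klin[OF rho_closed[OF y]] p one_closed]
      conv_rho[OF klin_form[OF g p] y one_closed] by simp
  finally show "g (act (rho y) p) = g (p \<triangleleft> y)" using y by simp
qed (use p y E_klin[OF rho_closed[OF y]] in auto)

lemma act_lam:
  assumes p: "p \<in> carrier P" and x: "x \<in> carrier L" shows "act (lam x) p = x \<triangleright> p"
proof (rule forms_separate)
  fix g assume g: "left.linear_form g"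
  have "g (act (lam x) p) = g (act (lam x) p \<triangleleft> \<one>)" using p x E_klin[OF lam_closed[OF x]] by simp
  also have "\<dots> = x \<otimes> g (p \<triangleleft> \<one>)"
    using form_act_ract[OF g E_klin[OF lam_closed[OF x]] p one_closed]
      conv_lam[OF klin_form[OF g p] x one_closed] by simp
  finally show "g (act (lam x) p) = g (x \<triangleright> p)" using x p g by (simp add: left.linear_form_smult)
qed (use p x E_klin[OF lam_closed[OF x]] in auto)

lemma module_PE: "module E PE"
proof (rule moduleI)
  show "cring E" by (rule cring_E)
  show "abelian_group PE"
  proof (rule abelian_groupI)
    fix p assume "p \<in> carrier PE"
    then show "\<exists>q\<in>carrier PE. q \<oplus>\<^bsub>PE\<^esub> p = \<zero>\<^bsub>PE\<^esub>"
      by (intro bexI[of _ "\<ominus>\<^bsub>P\<^esub> p"]) (auto simp: left.M.l_neg)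
  qed (auto simp: left.M.a_ac)
next
  fix \<phi> p assume "\<phi> \<in> carrier E" "p \<in> carrier PE"
  then show "\<phi> \<odot>\<^bsub>PE\<^esub> p \<in> carrier PE" by (simp add: E_klin)
next
  fix \<phi> \<psi> p assume E: "\<phi> \<in> carrier E" "\<psi> \<in> carrier E" and p: "p \<in> carrier PE"
  have "act (\<phi> \<oplus>\<^bsub>E\<^esub> \<psi>) p = (\<Oplus>\<^bsub>P\<^esub>j\<in>{..<n}. \<phi> (v j) \<triangleright> (p \<triangleleft> u j) \<oplus>\<^bsub>P\<^esub> \<psi> (v j) \<triangleright> (p \<triangleleft> u j))"
    unfolding act_def using E p by (intro left.M.finsum_cong') (auto simp: E_simps(5) left.smult_l_distr)
  also have "\<dots> = act \<phi> p \<oplus>\<^bsub>P\<^esub> act \<psi> p"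
    unfolding act_def using E p by (intro left.M.finsum_addf) auto
  finally show "(\<phi> \<oplus>\<^bsub>E\<^esub> \<psi>) \<odot>\<^bsub>PE\<^esub> p = \<phi> \<odot>\<^bsub>PE\<^esub> p \<oplus>\<^bsub>PE\<^esub> \<psi> \<odot>\<^bsub>PE\<^esub> p" by simp
next
  fix \<phi> p q assume E: "\<phi> \<in> carrier E" and p: "p \<in> carrier PE" "q \<in> carrier PE"
  have "act \<phi> (p \<oplus>\<^bsub>P\<^esub> q) = (\<Oplus>\<^bsub>P\<^esub>j\<in>{..<n}. \<phi> (v j) \<triangleright> (p \<triangleleft> u j) \<oplus>\<^bsub>P\<^esub> \<phi> (v j) \<triangleright> (q \<triangleleft> u j))"
    unfolding act_def using E p by (intro left.M.finsum_cong') (auto simp: ract_add_left left.smult_r_distr)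
  also have "\<dots> = act \<phi> p \<oplus>\<^bsub>P\<^esub> act \<phi> q"
    unfolding act_def using E p by (intro left.M.finsum_addf) auto
  finally show "\<phi> \<odot>\<^bsub>PE\<^esub> (p \<oplus>\<^bsub>PE\<^esub> q) = \<phi> \<odot>\<^bsub>PE\<^esub> p \<oplus>\<^bsub>PE\<^esub> \<phi> \<odot>\<^bsub>PE\<^esub> q" by simp
next
  fix \<phi> \<psi> p assume "\<phi> \<in> carrier E" "\<psi> \<in> carrier E" "p \<in> carrier PE"
  then show "(\<phi> \<otimes>\<^bsub>E\<^esub> \<psi>) \<odot>\<^bsub>PE\<^esub> p = \<phi> \<odot>\<^bsub>PE\<^esub> (\<psi> \<odot>\<^bsub>PE\<^esub> p)"
    by (simp add: E_simps(2) act_conv)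
next
  fix p assume p: "p \<in> carrier PE"
  have "\<one>\<^bsub>E\<^esub> = rho \<one>" by (auto simp: E_simps(3) rho_def)
  then show "\<one>\<^bsub>E\<^esub> \<odot>\<^bsub>PE\<^esub> p = p" using p act_rho[of p \<one>] by simp
qed

sublocale E: module E PE by (rule module_PE)

text \<open>A left \<open>L\<close>-linear form \<open>g\<close> induces an \<open>E\<close>-linear form with values in \<open>E\<close>, from which \<open>g\<close> is recovered by
  evaluation at \<open>\<one>\<close>. So \<open>P\<close> has enough \<open>E\<close>-linear forms to separate its points.\<close>

lemma E_form_of:
  assumes g: "left.linear_form g"
  shows "E.linear_form (\<lambda>p. \<lambda>y\<in>carrier L. g (p \<triangleleft> y))"
  unfolding E.linear_form_def
proof (intro conjI ballI funcsetI)
  fix p assume p: "p \<in> carrier PE"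
  show cl: "(\<lambda>y\<in>carrier L. g (p \<triangleleft> y)) \<in> carrier E"
    using p g by (intro E_restrictI klin_form) auto
  { fix q assume q: "q \<in> carrier PE"
    show "(\<lambda>y\<in>carrier L. g ((p \<oplus>\<^bsub>PE\<^esub> q) \<triangleleft> y)) = (\<lambda>y\<in>carrier L. g (p \<triangleleft> y)) \<oplus>\<^bsub>E\<^esub> (\<lambda>y\<in>carrier L. g (q \<triangleleft> y))"
      unfolding E_simps(5) using p q g
      by (intro restrict_ext) (simp add: ract_add_left left.linear_form_add) }
  { fix \<phi> assume \<phi>: "\<phi> \<in> carrier E"
    show "(\<lambda>y\<in>carrier L. g ((\<phi> \<odot>\<^bsub>PE\<^esub> p) \<triangleleft> y)) = \<phi> \<otimes>\<^bsub>E\<^esub> (\<lambda>y\<in>carrier L. g (p \<triangleleft> y))"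
    proof (rule E_eqI)
      show "(\<lambda>y\<in>carrier L. g ((\<phi> \<odot>\<^bsub>PE\<^esub> p) \<triangleleft> y)) \<in> carrier E"
        using p g E_klin[OF \<phi>] by (intro E_restrictI klin_form) auto
      show "\<phi> \<otimes>\<^bsub>E\<^esub> (\<lambda>y\<in>carrier L. g (p \<triangleleft> y)) \<in> carrier E" using \<phi> cl by simp
      fix y assume y: "y \<in> carrier L"
      have "conv \<phi> (\<lambda>y\<in>carrier L. g (p \<triangleleft> y)) y = conv \<phi> (\<lambda>y. g (p \<triangleleft> y)) y"
        unfolding conv_apply[OF y] using \<phi> p g y by (intro finsum_cong') auto
      then show "(\<lambda>y\<in>carrier L. g ((\<phi> \<odot>\<^bsub>PE\<^esub> p) \<triangleleft> y)) y = (\<phi> \<otimes>\<^bsub>E\<^esub> (\<lambda>y\<in>carrier L. g (p \<triangleleft> y))) y"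
        using form_act_ract[OF g E_klin[OF \<phi>] _ y, of p] p y by (simp add: E_simps(2))
    qed }
qed

lemma E_forms_separate:
  assumes x: "x \<in> carrier P" and z: "\<And>\<alpha>. E.linear_form \<alpha> \<Longrightarrow> \<alpha> x = \<zero>\<^bsub>E\<^esub>"
  shows "x = \<zero>\<^bsub>P\<^esub>"
proof (rule forms_separate)
  fix g assume g: "left.linear_form g"
  have "(\<lambda>y\<in>carrier L. g (x \<triangleleft> y)) \<one> = \<zero>"
    using z[OF E_form_of[OF g]] by (simp add: E_simps(4))
  then show "g x = g \<zero>\<^bsub>P\<^esub>" using x left.linear_form_zero[OF g] by simp
qed (use x in auto)

lemma E_form_ract:
  assumes "E.linear_form \<alpha>" "p \<in> carrier P" "y \<in> carrier L" "w \<in> carrier L"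
  shows "\<alpha> (p \<triangleleft> y) w = \<alpha> p (y \<otimes> w)"
proof -
  have c: "\<alpha> p \<in> carrier E" using E.linear_form_closed[OF assms(1)] assms(2) by simp
  have "\<alpha> (p \<triangleleft> y) = rho y \<otimes>\<^bsub>E\<^esub> \<alpha> p"
    using E.linear_form_smult[OF assms(1) rho_closed[OF assms(3)], of p] assms by (simp add: act_rho)
  then show ?thesis using conv_rho[OF E_klin[OF c] assms(3,4)] by (simp add: E_simps(2))
qed

lemma E_form_lact:
  assumes "E.linear_form \<alpha>" "p \<in> carrier P" "x \<in> carrier L" "w \<in> carrier L"
  shows "\<alpha> (x \<triangleright> p) w = x \<otimes> \<alpha> p w"
proof -
  have c: "\<alpha> p \<in> carrier E" using E.linear_form_closed[OF assms(1)] assms(2) by simp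
  have "\<alpha> (x \<triangleright> p) = lam x \<otimes>\<^bsub>E\<^esub> \<alpha> p"
    using E.linear_form_smult[OF assms(1) lam_closed[OF assms(3)], of p] assms by (simp add: act_lam)
  then show ?thesis using conv_lam[OF E_klin[OF c] assms(3,4)] by (simp add: E_simps(2))
qed

lemma E_form_eval:
  assumes "E.linear_form \<alpha>" "w \<in> carrier L"
  shows "left.linear_form (\<lambda>p. \<alpha> p w)"
  unfolding left.linear_form_def
proof (intro conjI ballI funcsetI)
  fix p assume p: "p \<in> carrier P"
  show "\<alpha> p w \<in> carrier L" using E.linear_form_closed[OF assms(1)] p assms(2) by simp
  { fix q assume q: "q \<in> carrier P"
    show "\<alpha> (p \<oplus>\<^bsub>P\<^esub> q) w = \<alpha> p w \<oplus> \<alpha> q w"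
      using E.linear_form_add[OF assms(1), of p q] p q assms(2) by (simp add: E_simps(5)) }
qed (use assms E_form_lact in auto)

lemma E_zero_iff:
  assumes "\<phi> \<in> carrier E" "\<And>j. j < n \<Longrightarrow> \<phi> (v j) = \<zero>"
  shows "\<phi> = \<zero>\<^bsub>E\<^esub>"
proof (rule E_eqI[OF assms(1) E_zero_closed])
  fix y assume y: "y \<in> carrier L"
  have "\<phi> y = (\<Oplus>j\<in>{..<n}. \<phi> (v j) \<otimes> \<tau> (u j \<otimes> y))" by (rule klin_v_expand[OF E_klin[OF assms(1)] y])
  also have "\<dots> = \<zero>" using assms y by (intro finsum_eq_zero) simp
  finally show "\<phi> y = \<zero>\<^bsub>E\<^esub> y" using y by (simp add: E_simps(4))
qed

lemma E_finsum_apply: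
  assumes "\<And>i. i \<in> I \<Longrightarrow> \<phi> i \<in> carrier E" "y \<in> carrier L"
  shows "finsum E \<phi> I y = (\<Oplus>i\<in>I. \<phi> i y)"
  by (rule additive_finsum[where h = "\<lambda>\<phi>. \<phi> y", OF E.R.abelian_group_axioms abelian_group_axioms])
    (use assms in \<open>auto simp: E_simps(5)\<close>)

text \<open>\<open>E\<close> has dimension \<open>n\<close> over \<open>L\<close>, acting through \<open>lam\<close>, because a map in \<open>E\<close> is determined by its
  values at \<open>v\<^sub>0, \<dots>, v\<^sub>n\<^sub>-\<^sub>1\<close>. So among \<open>n + 1\<close> elements there is a relation, whose first nonzero
  coefficient is a unit.\<close>

lemma E_dcc: "E.principal_dcc"
proof (rule E.R.principal_dccI[of n])
  fix x :: "nat \<Rightarrow> 'a \<Rightarrow> 'a" assume x: "\<And>i. x i \<in> carrier E"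
  obtain w where w: "w \<in> {..n} \<rightarrow> carrier L" "\<exists>i\<in>{..n}. w i \<noteq> \<zero>"
    "\<And>j. j \<in> {..<n} \<Longrightarrow> (\<Oplus>i\<in>{..n}. x i (v j) \<otimes> w i) = \<zero>"
    using homogeneous_system_field[of "{..<n}" "{..n}" "\<lambda>j i. x i (v j)"] x by auto
  have wL: "w i \<in> carrier L" if "i \<le> n" for i using w(1) that by auto
  define k where "k = (LEAST i. i \<le> n \<and> w i \<noteq> \<zero>)"
  have "\<exists>i. i \<le> n \<and> w i \<noteq> \<zero>" using w(2) by auto
  from LeastI_ex[OF this] have k: "k \<le> n" "w k \<noteq> \<zero>" by (auto simp: k_def)
  have less: "w i = \<zero>" if "i < k" for i
    using not_less_Least[of i "\<lambda>i. i \<le> n \<and> w i \<noteq> \<zero>"] that k(1) by (auto simp: k_def)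
  define a where "a = (\<lambda>i. lam (w i))"
  have aE: "a i \<in> carrier E" if "i \<le> n" for i using wL[OF that] by (simp add: a_def)
  have "a k \<in> Units E"
  proof -
    have iw: "inv (w k) \<in> carrier L" "w k \<otimes> inv (w k) = \<one>" using field_Units wL[OF k(1)] k(2) by auto
    have "a k \<otimes>\<^bsub>E\<^esub> lam (inv (w k)) = \<one>\<^bsub>E\<^esub>"
    proof (rule E_eqI)
      fix y assume y: "y \<in> carrier L"
      have "(a k \<otimes>\<^bsub>E\<^esub> lam (inv (w k))) y = w k \<otimes> lam (inv (w k)) y"
        using conv_lam[OF E_klin[OF lam_closed[OF iw(1)]] wL[OF k(1)] y] by (simp add: a_def E_simps(2))
      also have "\<dots> = (w k \<otimes> inv (w k)) \<otimes> \<tau> y" using y iw(1) wL[OF k(1)] by (simp add: lam_def m_assoc)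
      finally show "(a k \<otimes>\<^bsub>E\<^esub> lam (inv (w k))) y = \<one>\<^bsub>E\<^esub> y" using y iw(2) by (simp add: E_simps(3))
    qed (use aE[OF k(1)] iw in auto)
    moreover have "lam (inv (w k)) \<otimes>\<^bsub>E\<^esub> a k = a k \<otimes>\<^bsub>E\<^esub> lam (inv (w k))"
      using aE[OF k(1)] lam_closed[OF iw(1)] by (rule E.R.m_comm[OF _ _, symmetric])
    ultimately show ?thesis using aE[OF k(1)] lam_closed[OF iw(1)] unfolding Units_def by auto
  qed
  moreover have "a i = \<zero>\<^bsub>E\<^esub>" if "i < k" for i
    by (auto simp: a_def less[OF that] lam_def E_simps(4))
  moreover have "(\<Oplus>\<^bsub>E\<^esub>i\<in>{..n}. a i \<otimes>\<^bsub>E\<^esub> x i) = \<zero>\<^bsub>E\<^esub>"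
  proof (rule E_zero_iff)
    show "(\<Oplus>\<^bsub>E\<^esub>i\<in>{..n}. a i \<otimes>\<^bsub>E\<^esub> x i) \<in> carrier E" using aE x by (intro E.R.finsum_closed) auto
    fix j assume j: "j < n"
    have "(\<Oplus>\<^bsub>E\<^esub>i\<in>{..n}. a i \<otimes>\<^bsub>E\<^esub> x i) (v j) = (\<Oplus>i\<in>{..n}. (a i \<otimes>\<^bsub>E\<^esub> x i) (v j))"
      using aE x j by (intro E_finsum_apply) auto
    also have "\<dots> = (\<Oplus>i\<in>{..n}. x i (v j) \<otimes> w i)"
    proof (rule finsum_cong')
      fix i assume "i \<in> {..n}"
      then have wi: "w i \<in> carrier L" using wL by simp
      have "(a i \<otimes>\<^bsub>E\<^esub> x i) (v j) = w i \<otimes> x i (v j)"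
        using conv_lam[OF E_klin[OF x] wi] j by (simp add: a_def E_simps(2))
      then show "(a i \<otimes>\<^bsub>E\<^esub> x i) (v j) = x i (v j) \<otimes> w i" using wi x j by (simp add: m_comm)
    qed (use wL x j in auto)
    also have "\<dots> = \<zero>" using w(3) j by simp
    finally show "(\<Oplus>\<^bsub>E\<^esub>i\<in>{..n}. a i \<otimes>\<^bsub>E\<^esub> x i) (v j) = \<zero>" .
  qed
  ultimately show "\<exists>k a. k \<le> n \<and> a k \<in> Units E \<and> (\<forall>i<k. a i = \<zero>\<^bsub>E\<^esub>) \<and> (\<forall>i\<le>n. a i \<in> carrier E) \<and>
      (\<Oplus>\<^bsub>E\<^esub>i\<in>{..n}. a i \<otimes>\<^bsub>E\<^esub> x i) = \<zero>\<^bsub>E\<^esub>"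
    using k(1) aE by blast
qed

text \<open>If \<open>e\<close> kills \<open>P\<close>, then \<open>\<Sum>\<^sub>j e (v\<^sub>j) \<phi> (u\<^sub>j) = 0\<close> for each matrix coefficient \<open>\<phi>\<close>, hence for each coefficient
  map. The map \<open>\<phi> = \<tau> (v\<^sub>k _)\<close> is one, and it picks out \<open>e (v\<^sub>k)\<close>.\<close>

lemma E_faithful:
  assumes e: "e \<in> carrier E" and z: "\<And>p. p \<in> carrier P \<Longrightarrow> act e p = \<zero>\<^bsub>P\<^esub>"
  shows "e = \<zero>\<^bsub>E\<^esub>"
proof (rule E_zero_iff[OF e])
  fix k assume k: "k < n"
  have key: "(\<forall>j<n. \<phi> (u j) \<in> carrier L) \<and> (\<Oplus>j\<in>{..<n}. e (v j) \<otimes> \<phi> (u j)) = \<zero>" if "\<phi> \<in> coeff_maps" for \<phi>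
    using that
  proof (induction rule: coeff_map_induct)
    case (rank_one g p)
    have "g (act e p) = \<zero>" using z[OF rank_one(2)] left.linear_form_zero[OF rank_one(1)] by simp
    then show ?case using form_act[OF rank_one(1) E_klin[OF e] rank_one(2)] rank_one by simp
  next
    case (sum S \<psi>)
    have cl: "\<psi> s y \<in> carrier L" if "s \<in> S" "y \<in> carrier L" for s y
      using coeff_maps_closed[OF sum(2)[OF that(1)] that(2)] .
    have "(\<Oplus>j\<in>{..<n}. e (v j) \<otimes> (\<Oplus>s\<in>S. \<psi> s (u j))) = (\<Oplus>j\<in>{..<n}. \<Oplus>s\<in>S. e (v j) \<otimes> \<psi> s (u j))"
      using cl e sum(1) by (intro finsum_cong' finsum_rdistr) (auto intro!: finsum_closed)
    also have "\<dots> = (\<Oplus>s\<in>S. \<Oplus>j\<in>{..<n}. e (v j) \<otimes> \<psi> s (u j))"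
      using cl e sum(1) by (intro finsum_swap) auto
    also have "\<dots> = \<zero>" by (rule finsum_eq_zero) (use sum(3) in blast)
    finally show ?case using cl by (auto intro!: finsum_closed)
  next
    case (cong \<psi> \<chi>)
    have "(\<Oplus>j\<in>{..<n}. e (v j) \<otimes> \<chi> (u j)) = (\<Oplus>j\<in>{..<n}. e (v j) \<otimes> \<psi> (u j))"
      using cong(1) e by (intro finsum_cong') (auto simp: cong(2))
    then show ?case using cong(1) by (simp add: cong(2))
  qed
  have "(\<Oplus>j\<in>{..<n}. e (v j) \<otimes> \<tau> (v k \<otimes> u j)) = \<zero>"
    using key[OF coeff_maps_rmult[OF tau_coeff v_closed[OF k]]] by (rule conjunct2)
  moreover have "(\<Oplus>j\<in>{..<n}. e (v j) \<otimes> \<tau> (v k \<otimes> u j)) = (\<Oplus>j\<in>{..<n}. if j = k then e (v k) else \<zero>)"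
    using k e by (intro finsum_cong') (auto simp: tau_dual)
  moreover have "\<dots> = e (v k)" using k e by (intro finsum_delta) auto
  ultimately show "e (v k) = \<zero>" by simp
qed

text \<open>Evaluating the forms at a point \<open>w\<close> with \<open>\<tau> w = \<one>\<close> turns the free system into a dual system of left linear
  forms.\<close>

lemma E_free_system_bound:
  assumes "E.free_system m p \<alpha>" shows "m \<le> d"
proof -
  \<comment> \<open>The unit of \<open>E\<close> is \<open>\<tau>\<close>, which takes the value \<open>\<one>\<close> at \<open>v\<^sub>0 u\<^sub>0\<close>.\<close>
  define w where "w = v 0 \<otimes> u 0"
  have w: "w \<in> carrier L" "\<tau> w = \<one>" using n_pos tau_dual[of 0 0] by (auto simp: w_def)
  have "dual_system (carrier P) {g. left.linear_form g} m (\<lambda>i q. \<alpha> i q w) p"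
    unfolding dual_system_def
  proof (intro conjI allI impI)
    fix i assume i: "i < m"
    show "(\<lambda>q. \<alpha> i q w) \<in> {g. left.linear_form g}"
      using E_form_eval[OF E.free_systemD(2)[OF assms i] w(1)] by simp
    show "p i \<in> carrier P" using E.free_systemD(1)[OF assms i] by simp
    fix j assume j: "j < m"
    show "\<alpha> i (p j) w = (if i = j then \<one> else \<zero>)"
      using E.free_systemD(3)[OF assms i j] w by (simp add: E_simps(3,4))
  qed
  then show ?thesis by (rule forms_dual_system_bound)
qed

end

section \<open>Freeness over the enveloping ring\<close>

lemma (in abelian_group) diff_eq_zero_iff:
  assumes "x \<in> carrier G" "y \<in> carrier G"
  shows "x \<ominus> y = \<zero> \<longleftrightarrow> x = y"
proof
  assume "x \<ominus> y = \<zero>"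
  moreover have "x = (x \<ominus> y) \<oplus> y" using assms by (simp add: minus_eq a_assoc l_neg)
  ultimately show "x = y" using assms by simp
qed (use assms in \<open>simp add: minus_eq r_neg\<close>)

context galois_dual
begin

text \<open>An \<open>E\<close>-linear relation between pure tensors, expressed by the components \<open>\<beta> t\<close>, may be tested with any
  balanced form \<open>G\<close>. As \<open>G\<close> is in general not right linear, \<open>E\<close> acts through its values \<open>G p (q \<triangleleft> u\<^sub>j)\<close>.\<close>

lemma balanced_relation:
  fixes Z :: "'x \<Rightarrow> 'b \<times> 'b"
  assumes J: "finite J" and \<eta>: "\<And>x. x \<in> J \<Longrightarrow> \<eta> x \<in> carrier E"
    and Z: "\<And>x. x \<in> J \<Longrightarrow> fst (Z x) \<in> carrier P" "\<And>x. x \<in> J \<Longrightarrow> snd (Z x) \<in> carrier P"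
    and zero: "\<And>t. t < d \<Longrightarrow> (\<Oplus>\<^bsub>P\<^esub>x\<in>J. act (\<eta> x) (\<beta> t (fst (Z x)) (snd (Z x)))) = \<zero>\<^bsub>P\<^esub>"
    and G: "balanced G"
  shows "(\<Oplus>x\<in>J. \<Oplus>j\<in>{..<n}. \<eta> x (v j) \<otimes> G (fst (Z x)) (snd (Z x) \<triangleleft> u j)) = \<zero>"
proof -
  obtain g where g: "\<And>t. t < d \<Longrightarrow> left.linear_form (g t)"
    "\<And>p q. p \<in> carrier P \<Longrightarrow> q \<in> carrier P \<Longrightarrow> G p q = (\<Oplus>t\<in>{..<d}. g t (\<beta> t p q))"
    using balanced_lift[OF G] by auto
  define B where "B = (\<lambda>t x. \<beta> t (fst (Z x)) (snd (Z x)))"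
  have B: "B t x \<in> carrier P" if "t < d" "x \<in> J" for t x using beta_closed that Z by (simp add: B_def)
  have gB: "g t (B t x \<triangleleft> u j) \<in> carrier L" if "t < d" "x \<in> J" "j < n" for t x j
    using that B g(1) by simp
  have "(\<Oplus>x\<in>J. \<Oplus>j\<in>{..<n}. \<eta> x (v j) \<otimes> G (fst (Z x)) (snd (Z x) \<triangleleft> u j))
    = (\<Oplus>x\<in>J. \<Oplus>t\<in>{..<d}. g t (act (\<eta> x) (B t x)))"
  proof (rule finsum_cong')
    fix x assume x: "x \<in> J"
    have "(\<Oplus>j\<in>{..<n}. \<eta> x (v j) \<otimes> G (fst (Z x)) (snd (Z x) \<triangleleft> u j))
      = (\<Oplus>j\<in>{..<n}. \<Oplus>t\<in>{..<d}. \<eta> x (v j) \<otimes> g t (B t x \<triangleleft> u j))"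
    proof (rule finsum_cong')
      fix j assume j: "j \<in> {..<n}"
      have "G (fst (Z x)) (snd (Z x) \<triangleleft> u j) = (\<Oplus>t\<in>{..<d}. g t (\<beta> t (fst (Z x)) (snd (Z x) \<triangleleft> u j)))"
        using g(2) Z x j by simp
      also have "\<dots> = (\<Oplus>t\<in>{..<d}. g t (B t x \<triangleleft> u j))"
        using Z x j gB by (intro finsum_cong') (auto simp: beta_ract B_def)
      finally show "\<eta> x (v j) \<otimes> G (fst (Z x)) (snd (Z x) \<triangleleft> u j) = (\<Oplus>t\<in>{..<d}. \<eta> x (v j) \<otimes> g t (B t x \<triangleleft> u j))"
        using \<eta>[OF x] j x gB by (simp only:) (intro finsum_rdistr, auto)
    qed (use gB x \<eta> in \<open>auto intro!: finsum_closed\<close>)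
    also have "\<dots> = (\<Oplus>t\<in>{..<d}. \<Oplus>j\<in>{..<n}. \<eta> x (v j) \<otimes> g t (B t x \<triangleleft> u j))"
      using gB x \<eta> by (intro finsum_swap) auto
    also have "\<dots> = (\<Oplus>t\<in>{..<d}. g t (act (\<eta> x) (B t x)))"
      using x B g(1) E_klin[OF \<eta>[OF x]] by (intro finsum_cong') (auto simp: form_act)
    finally show "(\<Oplus>j\<in>{..<n}. \<eta> x (v j) \<otimes> G (fst (Z x)) (snd (Z x) \<triangleleft> u j))
      = (\<Oplus>t\<in>{..<d}. g t (act (\<eta> x) (B t x)))" .
  qed (use B g(1) \<eta> E_klin in \<open>auto intro!: finsum_closed\<close>)
  also have "\<dots> = (\<Oplus>t\<in>{..<d}. \<Oplus>x\<in>J. g t (act (\<eta> x) (B t x)))"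
    using J B g(1) \<eta> E_klin by (intro finsum_swap) auto
  also have "\<dots> = \<zero>"
  proof (rule finsum_eq_zero)
    fix t assume t: "t \<in> {..<d}"
    have "(\<Oplus>x\<in>J. g t (act (\<eta> x) (B t x))) = g t (\<Oplus>\<^bsub>P\<^esub>x\<in>J. act (\<eta> x) (B t x))"
      using t B g(1) \<eta> E_klin by (intro left.linear_form_finsum[symmetric]) auto
    also have "\<dots> = \<zero>" using zero[of t] t left.linear_form_zero[OF g(1)] by (simp add: B_def)
    finally show "(\<Oplus>x\<in>J. g t (act (\<eta> x) (B t x))) = \<zero>" .
  qed
  finally show ?thesis .
qed

text \<open>A bimodule endomorphism \<open>r\<close> in the first argument leaves \<open>(p, q) \<mapsto> g (p \<triangleleft> h' q)\<close> balanced; it is used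
  with the projection onto the complement of a free part.\<close>

lemma balanced_rank_one:
  assumes g: "left.linear_form g" and h': "left.linear_form h'"
    and r: "\<And>p. p \<in> carrier P \<Longrightarrow> r p \<in> carrier P"
    "\<And>p q. p \<in> carrier P \<Longrightarrow> q \<in> carrier P \<Longrightarrow> r (p \<oplus>\<^bsub>P\<^esub> q) = r p \<oplus>\<^bsub>P\<^esub> r q"
    "\<And>\<phi> p. \<phi> \<in> carrier E \<Longrightarrow> p \<in> carrier P \<Longrightarrow> r (act \<phi> p) = act \<phi> (r p)"
  shows "balanced (\<lambda>p q. g (r p \<triangleleft> h' q))"
proof -
  have l: "r (x \<triangleright> p) = x \<triangleright> r p" if "x \<in> carrier L" "p \<in> carrier P" for x p
    using r(3)[OF lam_closed[OF that(1)] that(2)] that r(1) by (simp add: act_lam)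
  have rr: "r (p \<triangleleft> x) = r p \<triangleleft> x" if "x \<in> carrier L" "p \<in> carrier P" for x p
    using r(3)[OF rho_closed[OF that(1)] that(2)] that r(1) by (simp add: act_rho)
  show ?thesis
    unfolding balanced_def using g h' r(1,2) l rr
    by (auto simp: ract_add_left ract_add_right left.linear_form_add left.linear_form_smult lact_ract ract_ract)
qed

lemma rform_closed: "right.linear_form k \<Longrightarrow> p \<in> carrier P \<Longrightarrow> k p \<in> carrier L"
  and rform_add: "right.linear_form k \<Longrightarrow> p \<in> carrier P \<Longrightarrow> q \<in> carrier P \<Longrightarrow> k (p \<oplus>\<^bsub>P\<^esub> q) = k p \<oplus> k q"
  and rform_ract: "right.linear_form k \<Longrightarrow> p \<in> carrier P \<Longrightarrow> x \<in> carrier L \<Longrightarrow> k (p \<triangleleft> x) = x \<otimes> k p"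
  using right.linear_form_closed[of k p] right.linear_form_add[of k p q] right.linear_form_smult[of k x p]
  by simp_all

lemma klin_right_form:
  assumes k: "right.linear_form k" and r: "r \<in> carrier L" and q: "q \<in> carrier P"
  shows "klin (\<lambda>w. \<tau> (r \<otimes> k (w \<triangleright> q)))"
  unfolding klin_def
proof (intro conjI ballI funcsetI)
  fix x assume x: "x \<in> carrier L"
  have kx: "k (x \<triangleright> q) \<in> carrier L" using k q x rform_closed by simp
  show "\<tau> (r \<otimes> k (x \<triangleright> q)) \<in> carrier L" using kx r by simp
  { fix y assume y: "y \<in> carrier L"
    have ky: "k (y \<triangleright> q) \<in> carrier L" using k q y rform_closed by simp
    have "k ((x \<oplus> y) \<triangleright> q) = k (x \<triangleright> q) \<oplus> k (y \<triangleright> q)"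
      using k q x y by (simp add: left.smult_l_distr rform_add)
    then show "\<tau> (r \<otimes> k ((x \<oplus> y) \<triangleright> q)) = \<tau> (r \<otimes> k (x \<triangleright> q)) \<oplus> \<tau> (r \<otimes> k (y \<triangleright> q))"
      using kx ky r by (simp add: r_distr klin_add[OF klin_tau]) }
  { fix z assume z: "z \<in> center"
    have zL: "z \<in> carrier L" using z by (rule center_closed)
    have "(z \<otimes> x) \<triangleright> q = (x \<triangleright> q) \<triangleleft> z" using x z zL q by (simp add: left.smult_assoc1 center_act)
    then have "k ((z \<otimes> x) \<triangleright> q) = z \<otimes> k (x \<triangleright> q)" using k q x zL by (simp add: rform_ract)
    then have "r \<otimes> k ((z \<otimes> x) \<triangleright> q) = z \<otimes> (r \<otimes> k (x \<triangleright> q))" using kx r zL by (simp add: m_lcomm)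
    then show "\<tau> (r \<otimes> k ((z \<otimes> x) \<triangleright> q)) = z \<otimes> \<tau> (r \<otimes> k (x \<triangleright> q))"
      using klin_center[OF klin_tau z, of "r \<otimes> k (x \<triangleright> q)"] kx r by simp }
qed

text \<open>The functions \<open>\<alpha> p\<close> and \<open>w \<mapsto> \<tau> (r k (w q))\<close> are contracted by the Casimir element of the dual
  bases. By the Casimir identity, moving a scalar \<open>z\<close> from \<open>p\<close> to \<open>q\<close> does not change the result.\<close>

lemma balanced_trace_pairing:
  assumes \<alpha>: "E.linear_form \<alpha>" and k: "right.linear_form k" and r: "r \<in> carrier L"
  shows "balanced (\<lambda>p q. \<Oplus>s\<in>{..<n}. \<alpha> p (v s) \<otimes> \<tau> (r \<otimes> k (u s \<triangleright> q)))"
    (is "balanced ?G")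
proof -
  have \<alpha>E: "\<alpha> p \<in> carrier E" if "p \<in> carrier P" for p using E.linear_form_closed[OF \<alpha>] that by simp
  have ac: "\<alpha> p (v s) \<in> carrier L" if "p \<in> carrier P" "s < n" for p s using \<alpha>E that by simp
  have tc: "\<tau> (r \<otimes> k (u s \<triangleright> q)) \<in> carrier L" if "q \<in> carrier P" "s < n" for q s
    using that r k rform_closed by simp
  show ?thesis
    unfolding balanced_def
  proof (intro conjI ballI)
    fix p q assume p: "p \<in> carrier P" and q: "q \<in> carrier P"
    show "?G p q \<in> carrier L"
      using ac tc p q by (intro finsum_closed) auto
  next
    fix p p' q assume p: "p \<in> carrier P" "p' \<in> carrier P" and q: "q \<in> carrier P"
    have "?G (p \<oplus>\<^bsub>P\<^esub> p') q
      = (\<Oplus>s\<in>{..<n}. \<alpha> p (v s) \<otimes> \<tau> (r \<otimes> k (u s \<triangleright> q)) \<oplus> \<alpha> p' (v s) \<otimes> \<tau> (r \<otimes> k (u s \<triangleright> q)))"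
      using ac tc p q E.linear_form_add[OF \<alpha>, of p p']
      by (intro finsum_cong') (auto simp: E_simps(5) l_distr)
    also have "\<dots> = ?G p q \<oplus> ?G p' q"
      using ac tc p q by (intro finsum_addf) auto
    finally show "?G (p \<oplus>\<^bsub>P\<^esub> p') q = ?G p q \<oplus> ?G p' q" .
  next
    fix p q q' assume p: "p \<in> carrier P" and q: "q \<in> carrier P" "q' \<in> carrier P"
    have "?G p (q \<oplus>\<^bsub>P\<^esub> q')
      = (\<Oplus>s\<in>{..<n}. \<alpha> p (v s) \<otimes> \<tau> (r \<otimes> k (u s \<triangleright> q)) \<oplus> \<alpha> p (v s) \<otimes> \<tau> (r \<otimes> k (u s \<triangleright> q')))"
    proof (rule finsum_cong')
      fix s assume "s \<in> {..<n}"
      then have s: "s < n" by simp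
      have kc: "k (u s \<triangleright> q) \<in> carrier L" "k (u s \<triangleright> q') \<in> carrier L" using k q s rform_closed by auto
      have "k (u s \<triangleright> (q \<oplus>\<^bsub>P\<^esub> q')) = k (u s \<triangleright> q) \<oplus> k (u s \<triangleright> q')"
        using k q s by (simp add: left.smult_r_distr rform_add)
      then have "\<tau> (r \<otimes> k (u s \<triangleright> (q \<oplus>\<^bsub>P\<^esub> q'))) = \<tau> (r \<otimes> k (u s \<triangleright> q)) \<oplus> \<tau> (r \<otimes> k (u s \<triangleright> q'))"
        using kc r by (simp add: r_distr klin_add[OF klin_tau])
      then show "\<alpha> p (v s) \<otimes> \<tau> (r \<otimes> k (u s \<triangleright> (q \<oplus>\<^bsub>P\<^esub> q')))
          = \<alpha> p (v s) \<otimes> \<tau> (r \<otimes> k (u s \<triangleright> q)) \<oplus> \<alpha> p (v s) \<otimes> \<tau> (r \<otimes> k (u s \<triangleright> q'))"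
        using ac[OF p s] tc[OF q(1) s] tc[OF q(2) s] by (simp add: r_distr)
    qed (use ac tc p q in auto)
    also have "\<dots> = ?G p q \<oplus> ?G p q'"
      using ac tc p q by (intro finsum_addf) auto
    finally show "?G p (q \<oplus>\<^bsub>P\<^esub> q') = ?G p q \<oplus> ?G p q'" .
  next
    fix p q z assume p: "p \<in> carrier P" and q: "q \<in> carrier P" and z: "z \<in> carrier L"
    define \<psi> where "\<psi> = (\<lambda>w. \<tau> (r \<otimes> k (w \<triangleright> q)))"
    have \<psi>: "klin \<psi>" unfolding \<psi>_def by (rule klin_right_form[OF k r q])
    have "?G (p \<triangleleft> z) q = (\<Oplus>s\<in>{..<n}. \<alpha> p (z \<otimes> v s) \<otimes> \<psi> (u s \<otimes> \<one>))"
      using p q z \<psi> \<alpha>E[OF p] tc by (intro finsum_cong') (auto simp: E_form_ract[OF \<alpha>] \<psi>_def)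
    also have "\<dots> = (\<Oplus>s\<in>{..<n}. \<alpha> p (v s) \<otimes> \<psi> (u s \<otimes> (z \<otimes> \<one>)))"
      by (rule casimir_klin[OF E_klin[OF \<alpha>E[OF p]] \<psi> z one_closed])
    also have "\<dots> = ?G p (z \<triangleright> q)"
      using p q z ac tc by (intro finsum_cong') (auto simp: \<psi>_def left.smult_assoc1)
    finally show "?G (p \<triangleleft> z) q = ?G p (z \<triangleright> q)" .
  next
    fix p q x assume p: "p \<in> carrier P" and q: "q \<in> carrier P" and x: "x \<in> carrier L"
    have "?G (x \<triangleright> p) q
      = (\<Oplus>s\<in>{..<n}. x \<otimes> (\<alpha> p (v s) \<otimes> \<tau> (r \<otimes> k (u s \<triangleright> q))))"
      using p q x ac tc by (intro finsum_cong') (auto simp: E_form_lact[OF \<alpha>] m_assoc)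
    also have "\<dots> = x \<otimes> ?G p q"
      using p q x ac tc by (intro finsum_rdistr[symmetric]) auto
    finally show "?G (x \<triangleright> p) q
      = x \<otimes> ?G p q" .
  qed
qed

text \<open>Let \<open>N\<close> be the common kernel of the \<open>\<alpha>\<^sub>i\<close>, which \<open>e\<close> kills, and let \<open>\<nu>\<close> be a nonzero element of it.
  The \<open>m d + 1\<close> pairs \<open>(p\<^sub>l, c\<^sub>k)\<close> and \<open>(\<nu>, p\<^sub>0)\<close> have only \<open>m d\<close> coordinates \<open>\<alpha>\<^sub>i (\<beta>\<^sub>t _)\<close> in \<open>E\<close>. Modulo the
  annihilator of \<open>e\<close>, linear algebra over \<open>E\<close> is that over a field, so the coordinates satisfy a relation
  with coefficients \<open>\<eta> = e w\<close>, not all zero. It holds for the tensors themselves, since \<open>e\<close> forgets the part of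
  \<open>\<beta>\<^sub>t\<close> in \<open>N\<close>. But balanced forms see that all coefficients vanish. Those of the first kind, with the
  projection onto \<open>N\<close>, vanish on the pairs \<open>(p\<^sub>l, c\<^sub>k)\<close> and isolate the coefficient of \<open>(\<nu>, p\<^sub>0)\<close>; after that the
  trace pairings of \<open>\<alpha>\<^sub>i\<close> and \<open>\<kappa>\<^sub>k\<close> isolate that of \<open>(p\<^sub>i, c\<^sub>k)\<close>. The comparison of ranks behind this is
  that \<open>P \<otimes>\<^sub>L P\<close> contains a copy of \<open>(E\<^sup>m) \<otimes>\<^sub>L P\<close>, which has the rank \<open>m d\<close> that \<open>P\<^sup>d\<close> has modulo
  \<open>N\<close>.\<close>

lemma killed_kernel_trivial:
  assumes fs: "E.free_system m p \<alpha>" and m: "0 < m"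
    and e: "e \<in> carrier E" "e \<noteq> \<zero>\<^bsub>E\<^esub>"
    and simple: "\<And>a. a \<in> carrier E \<Longrightarrow> e \<otimes>\<^bsub>E\<^esub> a \<noteq> \<zero>\<^bsub>E\<^esub> \<Longrightarrow> \<exists>b\<in>carrier E. e \<otimes>\<^bsub>E\<^esub> a \<otimes>\<^bsub>E\<^esub> b = e"
    and kill: "\<And>x. x \<in> carrier P \<Longrightarrow> (\<And>i. i < m \<Longrightarrow> \<alpha> i x = \<zero>\<^bsub>E\<^esub>) \<Longrightarrow> act e x = \<zero>\<^bsub>P\<^esub>"
    and \<nu>: "\<nu> \<in> carrier P" "\<And>i. i < m \<Longrightarrow> \<alpha> i \<nu> = \<zero>\<^bsub>E\<^esub>"
  shows "\<nu> = \<zero>\<^bsub>P\<^esub>"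
proof (rule ccontr)
  assume \<nu>0: "\<nu> \<noteq> \<zero>\<^bsub>P\<^esub>"
  define \<pi> where "\<pi> = E.system_proj m p \<alpha>"
  have pP: "p i \<in> carrier P" if "i < m" for i using E.free_systemD(1)[OF fs that] by simp
  have \<alpha>f: "E.linear_form (\<alpha> i)" if "i < m" for i using E.free_systemD(2)[OF fs that] .
  have \<alpha>p: "\<alpha> i (p j) = (if i = j then \<one>\<^bsub>E\<^esub> else \<zero>\<^bsub>E\<^esub>)" if "i < m" "j < m" for i j
    using E.free_systemD(3)[OF fs that] .
  have \<alpha>E: "\<alpha> i x \<in> carrier E" if "i < m" "x \<in> carrier P" for i x
    using E.linear_form_closed[OF \<alpha>f[OF that(1)]] that(2) by simp
  have \<pi>P: "\<pi> x \<in> carrier P" if "x \<in> carrier P" for x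
    using E.system_proj_closed[OF fs] that by (simp add: \<pi>_def)
  have \<pi>add: "\<pi> (x \<oplus>\<^bsub>P\<^esub> y) = \<pi> x \<oplus>\<^bsub>P\<^esub> \<pi> y" if "x \<in> carrier P" "y \<in> carrier P" for x y
    using E.system_proj_add[OF fs, of x y] that by (simp add: \<pi>_def)
  have \<pi>act: "\<pi> (act \<phi> x) = act \<phi> (\<pi> x)" if "\<phi> \<in> carrier E" "x \<in> carrier P" for \<phi> x
    using E.system_proj_smult[OF fs, of x \<phi>] that by (simp add: \<pi>_def)
  \<comment> \<open>The projection onto the complement \<open>N\<close> of the free part.\<close>
  define \<rho> where "\<rho> = (\<lambda>x. x \<ominus>\<^bsub>P\<^esub> \<pi> x)"
  have \<rho>P: "\<rho> x \<in> carrier P" if "x \<in> carrier P" for x using \<pi>P that by (simp add: \<rho>_def)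
  have \<rho>add: "\<rho> (x \<oplus>\<^bsub>P\<^esub> y) = \<rho> x \<oplus>\<^bsub>P\<^esub> \<rho> y" if "x \<in> carrier P" "y \<in> carrier P" for x y
    using that \<pi>P[OF that(1)] \<pi>P[OF that(2)]
    by (simp add: \<rho>_def \<pi>add left.M.minus_eq left.M.minus_add left.M.a_ac)
  have act_minus: "act \<phi> (x \<ominus>\<^bsub>P\<^esub> y) = act \<phi> x \<ominus>\<^bsub>P\<^esub> act \<phi> y"
    if "\<phi> \<in> carrier E" "x \<in> carrier P" "y \<in> carrier P" for \<phi> x y
  proof -
    have yP: "act \<phi> y \<in> carrier P" "act \<phi> (x \<ominus>\<^bsub>P\<^esub> y) \<in> carrier P" using that E_klin by auto
    have "x = (x \<ominus>\<^bsub>P\<^esub> y) \<oplus>\<^bsub>P\<^esub> y" using that by (simp add: left.M.minus_eq left.M.a_assoc left.M.l_neg)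
    then have "act \<phi> x = act \<phi> (x \<ominus>\<^bsub>P\<^esub> y) \<oplus>\<^bsub>P\<^esub> act \<phi> y"
      using E.smult_r_distr[of \<phi> "x \<ominus>\<^bsub>P\<^esub> y" y] that by simp
    then show ?thesis using yP by (simp add: left.M.minus_eq left.M.a_assoc left.M.r_neg)
  qed
  have \<rho>act: "\<rho> (act \<phi> x) = act \<phi> (\<rho> x)" if "\<phi> \<in> carrier E" "x \<in> carrier P" for \<phi> x
    using that by (simp add: \<rho>_def \<pi>act act_minus \<pi>P)
  have e\<pi>: "act e x = act e (\<pi> x)" if x: "x \<in> carrier P" for x
  proof -
    have "\<alpha> i (\<rho> x) = \<zero>\<^bsub>E\<^esub>" if i: "i < m" for i
    proof -
      have "\<rho> x = x \<ominus>\<^bsub>PE\<^esub> \<pi> x" by (simp add: \<rho>_def a_minus_def a_inv_def PE_def m_inv_def)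
      then have "\<alpha> i (\<rho> x) = \<alpha> i x \<ominus>\<^bsub>E\<^esub> \<alpha> i (\<pi> x)"
        using E.linear_form_minus[OF \<alpha>f[OF i], of x "\<pi> x"] x \<pi>P by simp
      moreover have "\<alpha> i (\<pi> x) = \<alpha> i x"
        using E.form_system_proj[OF fs i, of x] x by (simp add: \<pi>_def)
      ultimately show ?thesis using \<alpha>E[OF i x] by (simp add: E.R.minus_eq E.R.r_neg)
    qed
    then have "act e (\<rho> x) = \<zero>\<^bsub>P\<^esub>" using kill \<rho>P x by blast
    then have "act e x \<ominus>\<^bsub>P\<^esub> act e (\<pi> x) = \<zero>\<^bsub>P\<^esub>" using x e \<pi>P by (simp add: \<rho>_def act_minus)
    then show ?thesis using x \<pi>P E_klin[OF e(1)] by (simp add: left.M.diff_eq_zero_iff)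
  qed
  \<comment> \<open>The index \<open>None\<close> stands for the pair \<open>(\<nu>, p\<^sub>0)\<close> and \<open>Some (l, k)\<close> for \<open>(p\<^sub>l, c\<^sub>k)\<close>.\<close>
  define J where "J = insert None (Some ` ({..<m} \<times> {..<d}))"
  define Z where "Z = (\<lambda>x. case x of None \<Rightarrow> (\<nu>, p 0) | Some (l, k) \<Rightarrow> (p l, c k))"
  have cP: "c k \<in> carrier P" if "k < d" for k using right_basis(1) that by (auto simp: right.free_system_def)
  have ZP: "fst (Z x) \<in> carrier P" "snd (Z x) \<in> carrier P" if "x \<in> J" for x
    using that \<nu> pP cP m by (auto simp: J_def Z_def)
  have J: "finite J" by (simp add: J_def)
  have cardJ: "card ({..<m} \<times> {..<d}) < card J"
    unfolding J_def by (subst card_insert_disjoint) (auto simp: card_image)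
  define M where "M = (\<lambda>(i, t) x. \<alpha> i (\<beta> t (fst (Z x)) (snd (Z x))))"
  have ME: "M it x \<in> carrier E" if "it \<in> {..<m} \<times> {..<d}" "x \<in> J" for it x
    using that ZP[OF that(2)] by (auto simp: M_def intro!: \<alpha>E beta_closed)
  obtain w where w: "w \<in> J \<rightarrow> carrier E" "\<exists>x\<in>J. e \<otimes>\<^bsub>E\<^esub> w x \<noteq> \<zero>\<^bsub>E\<^esub>"
    "\<And>it. it \<in> {..<m} \<times> {..<d} \<Longrightarrow> e \<otimes>\<^bsub>E\<^esub> (\<Oplus>\<^bsub>E\<^esub>x\<in>J. M it x \<otimes>\<^bsub>E\<^esub> w x) = \<zero>\<^bsub>E\<^esub>"
    using E.R.homogeneous_system[OF e simple _ J cardJ, of M] ME by blast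
  have wE: "w x \<in> carrier E" if "x \<in> J" for x using w(1) that by auto
  define \<eta> where "\<eta> = (\<lambda>x. e \<otimes>\<^bsub>E\<^esub> w x)"
  have \<eta>E: "\<eta> x \<in> carrier E" if "x \<in> J" for x using wE[OF that] e by (simp add: \<eta>_def)
  have W: "(\<Oplus>\<^bsub>P\<^esub>x\<in>J. act (\<eta> x) (\<beta> t (fst (Z x)) (snd (Z x)))) = \<zero>\<^bsub>P\<^esub>" if t: "t < d" for t
  proof -
    define B where "B = (\<lambda>x. \<beta> t (fst (Z x)) (snd (Z x)))"
    have B: "B x \<in> carrier P" if "x \<in> J" for x using beta_closed[OF t] ZP[OF that] by (simp add: B_def)
    have wB: "act (w x) (B x) \<in> carrier P" if "x \<in> J" for x using E_klin[OF wE[OF that]] B[OF that] by simp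
    define W where "W = (\<Oplus>\<^bsub>P\<^esub>x\<in>J. act (w x) (B x))"
    have WP: "W \<in> carrier P" unfolding W_def using wB by (intro left.M.finsum_closed) auto
    have 1: "(\<Oplus>\<^bsub>P\<^esub>x\<in>J. act (\<eta> x) (B x)) = act e W"
    proof -
      have "(\<Oplus>\<^bsub>P\<^esub>x\<in>J. act (\<eta> x) (B x)) = (\<Oplus>\<^bsub>P\<^esub>x\<in>J. act e (act (w x) (B x)))"
        using wB e wE B E_klin[OF e(1)]
        by (intro left.M.finsum_cong') (auto simp: \<eta>_def E_simps(2) act_conv)
      also have "\<dots> = act e W"
        unfolding W_def
        using E.finsum_smult_ldistr[OF J e(1), of "\<lambda>x. act (w x) (B x)"] wB by (simp add: Pi_iff)
      finally show ?thesis .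
    qed
    have \<alpha>W: "\<alpha> i (act e W) = \<zero>\<^bsub>E\<^esub>" if i: "i < m" for i
    proof -
      have "\<alpha> i W = (\<Oplus>\<^bsub>E\<^esub>x\<in>J. \<alpha> i (act (w x) (B x)))"
        unfolding W_def using E.linear_form_finsum[OF \<alpha>f[OF i], of J "\<lambda>x. act (w x) (B x)"] wB by simp
      also have "\<dots> = (\<Oplus>\<^bsub>E\<^esub>x\<in>J. M (i, t) x \<otimes>\<^bsub>E\<^esub> w x)"
      proof (rule E.R.finsum_cong')
        fix x assume x: "x \<in> J"
        have "\<alpha> i (act (w x) (B x)) = w x \<otimes>\<^bsub>E\<^esub> \<alpha> i (B x)"
          using E.linear_form_smult[OF \<alpha>f[OF i], of "w x" "B x"] wE B x by simp
        then show "\<alpha> i (act (w x) (B x)) = M (i, t) x \<otimes>\<^bsub>E\<^esub> w x"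
          using wE[OF x] \<alpha>E[OF i B[OF x]] by (simp add: M_def B_def E.R.m_comm)
      qed (use ME i t wE in auto)
      finally have "\<alpha> i (act e W) = e \<otimes>\<^bsub>E\<^esub> (\<Oplus>\<^bsub>E\<^esub>x\<in>J. M (i, t) x \<otimes>\<^bsub>E\<^esub> w x)"
        using E.linear_form_smult[OF \<alpha>f[OF i] e(1), of W] WP by simp
      then show ?thesis using w(3)[of "(i, t)"] i t by simp
    qed
    have "act e W = act e (\<pi> W)" by (rule e\<pi>[OF WP])
    also have "\<dots> = \<pi> (act e W)" using \<pi>act[OF e(1) WP] by simp
    also have "\<dots> = \<zero>\<^bsub>P\<^esub>" unfolding \<pi>_def using E.system_proj_zero[OF fs \<alpha>W] by simp
    finally show ?thesis using 1 by (simp add: B_def)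
  qed
  have rel: "(\<Oplus>x\<in>J. \<Oplus>j\<in>{..<n}. \<eta> x (v j) \<otimes> G (fst (Z x)) (snd (Z x) \<triangleleft> u j)) = \<zero>" if "balanced G" for G
    using balanced_relation[of J \<eta> Z G, OF J \<eta>E ZP W that] by simp
  have split: "(\<Oplus>x\<in>J. f x) = f None \<oplus> (\<Oplus>x\<in>Some ` ({..<m} \<times> {..<d}). f x)"
    if "\<And>x. x \<in> J \<Longrightarrow> f x \<in> carrier L" for f
    unfolding J_def using that by (intro finsum_insert) (auto simp: J_def)
  have None: "None \<in> J" by (simp add: J_def)
  have \<eta>None: "\<eta> None = \<zero>\<^bsub>E\<^esub>"
  proof (rule E_zero_iff[OF \<eta>E[OF None]])
    fix k assume k: "k < n"
    obtain g where g: "left.linear_form g" "g \<nu> \<noteq> \<zero>"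
      using forms_separate[of \<nu> "\<zero>\<^bsub>P\<^esub>"] \<nu> \<nu>0 left.linear_form_zero by auto
    define h' where "h' = (\<lambda>q. \<alpha> 0 q (v k))"
    have h': "left.linear_form h'" unfolding h'_def by (rule E_form_eval[OF \<alpha>f[OF m] v_closed[OF k]])
    \<comment> \<open>The form \<open>h'\<close> selects the \<open>k\<close>-th summand of the action on \<open>p\<^sub>0\<close>.\<close>
    have h'p: "h' (p 0 \<triangleleft> u j) = (if j = k then \<one> else \<zero>)" if "j < n" for j
      using that k m pP[OF m] E_form_ract[OF \<alpha>f[OF m] pP[OF m], of "u j" "v k"] \<alpha>p[OF m m] tau_dual[OF k that]
      by (auto simp: h'_def E_simps(3) m_comm)
    define G where "G = (\<lambda>p q. g (\<rho> p \<triangleleft> h' q))"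
    have G: "balanced G" unfolding G_def using \<rho>P \<rho>add \<rho>act by (intro balanced_rank_one g h') auto
    define f where "f = (\<lambda>x. \<Oplus>j\<in>{..<n}. \<eta> x (v j) \<otimes> G (fst (Z x)) (snd (Z x) \<triangleleft> u j))"
    have GL: "G a q \<in> carrier L" if "a \<in> carrier P" "q \<in> carrier P" for a q
      using G that by (auto simp: balanced_def)
    have fL: "f x \<in> carrier L" if "x \<in> J" for x
      unfolding f_def using GL ZP[OF that] \<eta>E[OF that] by (intro finsum_closed) auto
    have \<rho>p: "\<rho> (p l) = \<zero>\<^bsub>P\<^esub>" if "l < m" for l
      using E.system_proj_base[OF fs that] pP[OF that] by (simp add: \<rho>_def \<pi>_def left.M.diff_eq_zero_iff)
    have \<rho>\<nu>: "\<rho> \<nu> = \<nu>"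
    proof -
      have "\<pi> \<nu> = \<zero>\<^bsub>P\<^esub>" unfolding \<pi>_def using E.system_proj_zero[OF fs \<nu>(2)] by simp
      then show ?thesis using \<nu> by (simp add: \<rho>_def left.M.minus_eq)
    qed
    have fSome: "f x = \<zero>" if "x \<in> Some ` ({..<m} \<times> {..<d})" for x
    proof -
      obtain l k' where lk: "l < m" "k' < d" "x = Some (l, k')" using \<open>x \<in> _\<close> by auto
      have xJ: "x \<in> J" using that by (simp add: J_def)
      show ?thesis unfolding f_def
      proof (rule finsum_eq_zero)
        fix j assume j: "j \<in> {..<n}"
        have "G (fst (Z x)) (snd (Z x) \<triangleleft> u j) = \<zero>"
          using lk j cP \<rho>p left.linear_form_zero[OF g(1)] left.linear_form_closed[OF h']
          by (simp add: G_def Z_def)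
        then show "\<eta> x (v j) \<otimes> G (fst (Z x)) (snd (Z x) \<triangleleft> u j) = \<zero>"
          using \<eta>E[OF xJ] j by simp
      qed
    qed
    have fNone: "f None = \<eta> None (v k) \<otimes> g \<nu>"
    proof -
      have "f None = (\<Oplus>j\<in>{..<n}. if j = k then \<eta> None (v k) \<otimes> g \<nu> else \<zero>)"
        unfolding f_def
        using \<eta>E[OF None] g \<nu> \<rho>\<nu> h'p left.linear_form_zero[OF g(1)]
        by (intro finsum_cong') (auto simp: Z_def G_def)
      also have "\<dots> = \<eta> None (v k) \<otimes> g \<nu>"
        using k \<eta>E[OF None] g \<nu> by (intro finsum_delta) auto
      finally show ?thesis .
    qed
    have "(\<Oplus>x\<in>J. f x) = f None \<oplus> (\<Oplus>x\<in>Some ` ({..<m} \<times> {..<d}). f x)" by (rule split[OF fL])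
    moreover have "(\<Oplus>x\<in>Some ` ({..<m} \<times> {..<d}). f x) = \<zero>" by (rule finsum_eq_zero[OF fSome])
    moreover have "(\<Oplus>x\<in>J. f x) = \<zero>" unfolding f_def by (rule rel[OF G])
    ultimately have "f None = \<zero>" using fL[OF None] by simp
    then show "\<eta> None (v k) = \<zero>"
      using fNone g \<nu> \<eta>E[OF None] k integral[of "\<eta> None (v k)" "g \<nu>"] by auto
  qed
  have \<eta>Some: "\<eta> (Some (i, k)) = \<zero>\<^bsub>E\<^esub>" if i: "i < m" and k: "k < d" for i k
  proof -
    have SJ: "Some (i, k) \<in> J" using i k by (simp add: J_def)
    show ?thesis
    proof (rule E_zero_iff[OF \<eta>E[OF SJ]])
      fix r assume r: "r < n"
      have \<kappa>k: "right.linear_form (\<kappa> k)" using right_basis(1) k by (auto simp: right.free_system_def)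
      define G where "G = (\<lambda>p q. \<Oplus>s\<in>{..<n}. \<alpha> i p (v s) \<otimes> \<tau> (v r \<otimes> \<kappa> k (u s \<triangleright> q)))"
      have G: "balanced G" unfolding G_def by (rule balanced_trace_pairing[OF \<alpha>f[OF i] \<kappa>k v_closed[OF r]])
      have GL: "G a q \<in> carrier L" if "a \<in> carrier P" "q \<in> carrier P" for a q
        using G that by (auto simp: balanced_def)
      have \<kappa>c: "\<kappa> k (c k') = (if k = k' then \<one> else \<zero>)" if "k' < d" for k'
        using right_basis(1) k that by (auto simp: right.free_system_def)
      have Gp: "G (p l) q = (if l = i then \<tau> (v r \<otimes> \<kappa> k q) else \<zero>)" if l: "l < m" and q: "q \<in> carrier P" for l q
      proof (cases "l = i")
        case True
        define \<psi> where "\<psi> = (\<lambda>w. \<tau> (v r \<otimes> \<kappa> k (w \<triangleright> q)))"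
        have \<psi>: "klin \<psi>" unfolding \<psi>_def by (rule klin_right_form[OF \<kappa>k v_closed[OF r] q])
        have "G (p l) q = (\<Oplus>s\<in>{..<n}. \<tau> (\<one> \<otimes> v s) \<otimes> \<psi> (u s \<otimes> \<one>))"
          unfolding G_def using True \<alpha>p[OF i l] klin_closed[OF \<psi>, unfolded \<psi>_def]
          by (intro finsum_cong') (auto simp: E_simps(3) \<psi>_def)
        also have "\<dots> = \<psi> (\<one> \<otimes> \<one>)" by (rule klin_u_expand[OF \<psi> one_closed one_closed])
        finally show ?thesis using True q by (simp add: \<psi>_def)
      next
        case False
        then show ?thesis unfolding G_def using \<alpha>p[OF i l] q r rform_closed[OF \<kappa>k]
          by (auto intro!: finsum_eq_zero simp: E_simps(4))
      qed
      have Gpc: "G (p l) (c k' \<triangleleft> u j) = (if l = i \<and> k' = k \<and> j = r then \<one> else \<zero>)"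
        if "l < m" "k' < d" "j < n" for l k' j
      proof -
        have "\<kappa> k (c k' \<triangleleft> u j) = u j \<otimes> \<kappa> k (c k')"
          using rform_ract[OF \<kappa>k cP[OF that(2)] u_closed[OF that(3)]] .
        moreover have "\<tau> \<zero> = \<zero>" by (rule coeff_maps_zero_arg[OF tau_coeff])
        ultimately show ?thesis
          using Gp[OF that(1), of "c k' \<triangleleft> u j"] cP[OF that(2)] \<kappa>c[OF that(2)] that tau_dual[OF r that(3)] r
          by auto
      qed
      define f where "f = (\<lambda>x. \<Oplus>j\<in>{..<n}. \<eta> x (v j) \<otimes> G (fst (Z x)) (snd (Z x) \<triangleleft> u j))"
      have fL: "f x \<in> carrier L" if "x \<in> J" for x
        unfolding f_def using GL ZP[OF that] \<eta>E[OF that] by (intro finsum_closed) auto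
      have fx: "f x = (if x = Some (i, k) then \<eta> (Some (i, k)) (v r) else \<zero>)" if x: "x \<in> J" for x
      proof (cases x)
        case None
        then show ?thesis unfolding f_def using \<eta>None GL ZP[OF x]
          by (auto intro!: finsum_eq_zero simp: E_simps(4))
      next
        case (Some lk)
        then obtain l k' where lk: "l < m" "k' < d" "x = Some (l, k')" using x by (auto simp: J_def)
        show ?thesis
        proof (cases "l = i \<and> k' = k")
          case True
          have "f x = (\<Oplus>j\<in>{..<n}. if j = r then \<eta> (Some (i, k)) (v r) else \<zero>)"
            unfolding f_def using lk True \<eta>E[OF SJ] Gpc by (intro finsum_cong') (auto simp: Z_def)
          also have "\<dots> = \<eta> (Some (i, k)) (v r)" using r \<eta>E[OF SJ] by (intro finsum_delta) auto
          finally show ?thesis using lk True by simp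
        next
          case False
          then show ?thesis unfolding f_def using lk Gpc \<eta>E[OF x]
            by (auto intro!: finsum_eq_zero simp: Z_def)
        qed
      qed
      have "\<eta> (Some (i, k)) (v r) = (\<Oplus>x\<in>J. if x = Some (i, k) then \<eta> (Some (i, k)) (v r) else \<zero>)"
        using J SJ \<eta>E[OF SJ] r by (subst finsum_delta) auto
      also have "\<dots> = (\<Oplus>x\<in>J. f x)" using fx fL by (intro finsum_cong') auto
      also have "\<dots> = \<zero>" unfolding f_def by (rule rel[OF G])
      finally show "\<eta> (Some (i, k)) (v r) = \<zero>" .
    qed
  qed
  have "\<eta> x = \<zero>\<^bsub>E\<^esub>" if "x \<in> J" for x
    using that \<eta>None \<eta>Some by (auto simp: J_def)
  then show False using w(2) by (auto simp: \<eta>_def)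
qed

text \<open>Take a maximal free system. Its common kernel \<open>N\<close> is killed by some nonzero \<open>e\<close>, hence by the generator of a
  minimal ideal inside \<open>eE\<close>, so \<open>N\<close> vanishes. The system is not empty because \<open>E\<close> acts faithfully on \<open>P\<close>.\<close>

lemma ex_E_basis:
  obtains m p \<alpha> where "0 < m" "E.free_system m p \<alpha>" "\<And>x. x \<in> carrier P \<Longrightarrow> E.system_proj m p \<alpha> x = x"
proof -
  obtain m p \<alpha> e where fs: "E.free_system m p \<alpha>" and e: "e \<in> carrier E" "e \<noteq> \<zero>\<^bsub>E\<^esub>"
    and kill: "\<And>x. x \<in> carrier PE \<Longrightarrow> (\<And>i. i < m \<Longrightarrow> \<alpha> i x = \<zero>\<^bsub>E\<^esub>) \<Longrightarrow> e \<odot>\<^bsub>PE\<^esub> x = \<zero>\<^bsub>PE\<^esub>"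
  proof (rule E.ex_maximal_free_system[OF E_dcc E_free_system_bound])
    fix x assume "x \<in> carrier PE" "\<And>\<beta>. E.linear_form \<beta> \<Longrightarrow> \<beta> x = \<zero>\<^bsub>E\<^esub>"
    then show "x = \<zero>\<^bsub>PE\<^esub>" using E_forms_separate by simp
  next
    fix m p \<alpha> e
    assume "E.free_system m p \<alpha>" "e \<in> carrier E" "e \<noteq> \<zero>\<^bsub>E\<^esub>"
      "\<And>x. x \<in> carrier PE \<Longrightarrow> (\<And>i. i < m \<Longrightarrow> \<alpha> i x = \<zero>\<^bsub>E\<^esub>) \<Longrightarrow> e \<odot>\<^bsub>PE\<^esub> x = \<zero>\<^bsub>PE\<^esub>"
    then show thesis by (rule that)
  qed
  have m: "0 < m"
  proof (rule ccontr)
    assume "\<not> 0 < m"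
    then have "act e x = \<zero>\<^bsub>P\<^esub>" if "x \<in> carrier P" for x using kill[of x] that by simp
    then show False using E_faithful[OF e(1)] e(2) by blast
  qed
  obtain y where y: "y \<in> carrier E" "e \<otimes>\<^bsub>E\<^esub> y \<noteq> \<zero>\<^bsub>E\<^esub>"
    and min: "\<And>a. a \<in> carrier E \<Longrightarrow> e \<otimes>\<^bsub>E\<^esub> y \<otimes>\<^bsub>E\<^esub> a \<noteq> \<zero>\<^bsub>E\<^esub> \<Longrightarrow> \<exists>b\<in>carrier E. e \<otimes>\<^bsub>E\<^esub> y \<otimes>\<^bsub>E\<^esub> a \<otimes>\<^bsub>E\<^esub> b = e \<otimes>\<^bsub>E\<^esub> y"
    using E.R.ex_minimal_multiple[OF E_dcc e] by metis
  have ey: "e \<otimes>\<^bsub>E\<^esub> y \<in> carrier E" using e y by simp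
  have kill': "act (e \<otimes>\<^bsub>E\<^esub> y) x = \<zero>\<^bsub>P\<^esub>" if "x \<in> carrier P" "\<And>i. i < m \<Longrightarrow> \<alpha> i x = \<zero>\<^bsub>E\<^esub>" for x
  proof -
    have "act (e \<otimes>\<^bsub>E\<^esub> y) x = act (y \<otimes>\<^bsub>E\<^esub> e) x" using e y by (simp add: E.R.m_comm)
    also have "\<dots> = act y (act e x)" using E.smult_assoc1[of y e x] e y that by simp
    also have "act e x = \<zero>\<^bsub>P\<^esub>" using kill[of x] that by simp
    finally show ?thesis using E.smult_r_null[OF y(1)] by simp
  qed
  have "E.system_proj m p \<alpha> x = x" if x: "x \<in> carrier P" for x
  proof -
    define \<nu> where "\<nu> = x \<ominus>\<^bsub>PE\<^esub> E.system_proj m p \<alpha> x"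
    have px: "E.system_proj m p \<alpha> x \<in> carrier PE" using E.system_proj_closed[OF fs] x by simp
    have "\<nu> = \<zero>\<^bsub>P\<^esub>"
    proof (rule killed_kernel_trivial[OF fs m ey y(2) min kill'])
      show "\<nu> \<in> carrier P" using E.M.minus_closed[of x] x px by (simp add: \<nu>_def)
      fix i assume i: "i < m"
      have "\<alpha> i x \<in> carrier E" using E.linear_form_closed[OF E.free_systemD(2)[OF fs i]] x by simp
      then show "\<alpha> i \<nu> = \<zero>\<^bsub>E\<^esub>"
        using E.linear_form_minus[OF E.free_systemD(2)[OF fs i], of x] E.form_system_proj[OF fs i, of x] x px
        by (simp add: \<nu>_def E.R.minus_eq E.R.r_neg)
    qed
    then have "x \<ominus>\<^bsub>PE\<^esub> E.system_proj m p \<alpha> x = \<zero>\<^bsub>PE\<^esub>" by (simp add: \<nu>_def)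
    then show ?thesis using E.M.diff_eq_zero_iff[of x "E.system_proj m p \<alpha> x"] x px by simp
  qed
  then show ?thesis using that[OF m fs] by blast
qed

end

section \<open>The tensor product of bimodules\<close>

text \<open>The part of the structure on which the underlying group of the tensor product depends.\<close>

locale bimodule_pair =
  fixes K :: "'a set" and P :: "('a, 'b, 'm) bimodule_scheme" and Q :: "('a, 'c, 'n) bimodule_scheme"
  assumes P_group: "abelian_group P" and Q_group: "abelian_group Q"
    and P_right: "\<And>x k. x \<in> carrier P \<Longrightarrow> k \<in> K \<Longrightarrow> x \<odot>\<^sup>r\<^bsub>P\<^esub> k \<in> carrier P"
    and Q_left: "\<And>y k. y \<in> carrier Q \<Longrightarrow> k \<in> K \<Longrightarrow> k \<odot>\<^bsub>Q\<^esub> y \<in> carrier Q"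
begin

abbreviation F :: "(('b \<times> 'c) \<Rightarrow>\<^sub>0 int) monoid" where "F \<equiv> free_Abelian_group (carrier P \<times> carrier Q)"
abbreviation H :: "(('b \<times> 'c) \<Rightarrow>\<^sub>0 int) set" where "H \<equiv> generate F (tensor_relations K P Q)"
abbreviation T :: "('a, (('b \<times> 'c) \<Rightarrow>\<^sub>0 int) set) bimodule" where "T \<equiv> bimodule_tensor K P Q"

definition cls :: "(('b \<times> 'c) \<Rightarrow>\<^sub>0 int) \<Rightarrow> (('b \<times> 'c) \<Rightarrow>\<^sub>0 int) set" where "cls f = H #>\<^bsub>F\<^esub> f"
definition tens :: "'b \<Rightarrow> 'c \<Rightarrow> (('b \<times> 'c) \<Rightarrow>\<^sub>0 int) set" where "tens x y = cls (frag_of (x, y))"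

lemma F_diff: "f \<in> carrier F \<Longrightarrow> g \<in> carrier F \<Longrightarrow> f - g \<in> carrier F"
  using keys_diff[of f g] by auto

lemma F_add: "f \<in> carrier F \<Longrightarrow> g \<in> carrier F \<Longrightarrow> f + g \<in> carrier F"
  using Poly_Mapping.keys_add[of f g] by auto

lemma F_of: "x \<in> carrier P \<Longrightarrow> y \<in> carrier Q \<Longrightarrow> frag_of (x, y) \<in> carrier F"
  by simp

lemma rel_subset: "tensor_relations K P Q \<subseteq> carrier F"
proof -
  interpret P: abelian_group P by (rule P_group)
  interpret Q: abelian_group Q by (rule Q_group)
  show ?thesis
    unfolding tensor_relations_def
    by (auto intro!: F_diff F_of P_right Q_left simp del: carrier_free_Abelian_group_iff)
qed

lemma H_subgroup: "subgroup H F"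
  by (rule group.generate_is_subgroup[OF group_free_Abelian_group rel_subset])

lemma H_subset: "H \<subseteq> carrier F" by (rule subgroup.subset[OF H_subgroup])

lemma H_zero: "0 \<in> H"
  using subgroup.one_closed[OF H_subgroup] by simp

lemma H_add: "f \<in> H \<Longrightarrow> g \<in> H \<Longrightarrow> f + g \<in> H"
  using subgroup.m_closed[OF H_subgroup] by fastforce

lemma H_minus: "f \<in> H \<Longrightarrow> - f \<in> H"
  using subgroup.m_inv_closed[OF H_subgroup, of f] H_subset by fastforce

lemma H_diff: "f \<in> H \<Longrightarrow> g \<in> H \<Longrightarrow> f - g \<in> H"
  using H_add[of f "- g"] H_minus[of g] by simp

lemma cls_image: "cls f = (\<lambda>h. h + f) ` H"
  by (auto simp: cls_def r_coset_def)

lemma cls_eq_iff: "cls f = cls g \<longleftrightarrow> f - g \<in> H"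
proof
  assume "cls f = cls g"
  then have "f \<in> cls g" using H_zero by (force simp: cls_image)
  then show "f - g \<in> H" by (auto simp: cls_image)
next
  assume fg: "f - g \<in> H"
  have "h + f \<in> cls g" if "h \<in> H" for h
  proof -
    have "h + f = (h + (f - g)) + g" by simp
    then show ?thesis using H_add[OF that fg] unfolding cls_image by blast
  qed
  moreover have "h + g \<in> cls f" if "h \<in> H" for h
  proof -
    have "h + g = (h - (f - g)) + f" by simp
    then show ?thesis using H_diff[OF that fg] unfolding cls_image by blast
  qed
  ultimately have "(\<lambda>h. h + f) ` H \<subseteq> cls g" "(\<lambda>h. h + g) ` H \<subseteq> cls f" by blast+
  then show "cls f = cls g" unfolding cls_image[symmetric] by (rule subset_antisym)
qed

lemma T_carrier: "carrier T = cls ` carrier F"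
  by (auto simp: bimodule_tensor_def Let_def FactGroup_def RCOSETS_def cls_def)

lemma T_zero: "\<zero>\<^bsub>T\<^esub> = cls 0"
  by (auto simp: bimodule_tensor_def Let_def FactGroup_def cls_image)

lemma T_add: "cls f \<oplus>\<^bsub>T\<^esub> cls g = cls (f + g)"
proof -
  have "cls f \<oplus>\<^bsub>T\<^esub> cls g = {(h + f) + (h' + g) | h h'. h \<in> H \<and> h' \<in> H}"
    by (auto simp: bimodule_tensor_def Let_def FactGroup_def set_mult_def cls_image)
  also have "\<dots> = cls (f + g)"
  proof (intro equalityI subsetI)
    fix x assume "x \<in> {(h + f) + (h' + g) | h h'. h \<in> H \<and> h' \<in> H}"
    then obtain h h' where h: "h \<in> H" "h' \<in> H" "x = (h + f) + (h' + g)" by blast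
    have "x = (h + h') + (f + g)" using h(3) by (simp add: ac_simps)
    then show "x \<in> cls (f + g)" unfolding cls_image using H_add[OF h(1,2)] by blast
  next
    fix x assume "x \<in> cls (f + g)"
    then obtain h where "h \<in> H" "x = (h + f) + (0 + g)" by (auto simp: cls_image ac_simps)
    then show "x \<in> {(h + f) + (h' + g) | h h'. h \<in> H \<and> h' \<in> H}" using H_zero by blast
  qed
  finally show ?thesis .
qed

lemma T_group: "abelian_group T"
proof (rule abelian_groupI)
  show "\<zero>\<^bsub>T\<^esub> \<in> carrier T" unfolding T_zero T_carrier by (intro imageI) simp
  fix C assume "C \<in> carrier T"
  then obtain f where f: "f \<in> carrier F" "C = cls f" unfolding T_carrier by blast
  show "\<zero>\<^bsub>T\<^esub> \<oplus>\<^bsub>T\<^esub> C = C" unfolding f T_zero T_add by simp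
  have "cls (- f) \<in> carrier T" unfolding T_carrier using f(1) by simp
  moreover have "cls (- f) \<oplus>\<^bsub>T\<^esub> C = \<zero>\<^bsub>T\<^esub>" unfolding f T_zero T_add by simp
  ultimately show "\<exists>D\<in>carrier T. D \<oplus>\<^bsub>T\<^esub> C = \<zero>\<^bsub>T\<^esub>" by blast
  fix D assume "D \<in> carrier T"
  then obtain g where g: "g \<in> carrier F" "D = cls g" unfolding T_carrier by blast
  show "C \<oplus>\<^bsub>T\<^esub> D \<in> carrier T" unfolding f g T_add T_carrier by (intro imageI F_add f g)
  show "C \<oplus>\<^bsub>T\<^esub> D = D \<oplus>\<^bsub>T\<^esub> C" unfolding f g T_add by (simp add: add.commute)
  fix D' assume "D' \<in> carrier T"
  then obtain g' where g': "D' = cls g'" unfolding T_carrier by blast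
  show "C \<oplus>\<^bsub>T\<^esub> D \<oplus>\<^bsub>T\<^esub> D' = C \<oplus>\<^bsub>T\<^esub> (D \<oplus>\<^bsub>T\<^esub> D')"
    unfolding f g g' T_add by (simp add: add.assoc)
qed

sublocale T: abelian_group T by (rule T_group)

lemma tens_closed [simp, intro]: "x \<in> carrier P \<Longrightarrow> y \<in> carrier Q \<Longrightarrow> tens x y \<in> carrier T"
  unfolding tens_def T_carrier by (intro imageI F_of)

lemma tensor_relation_cases:
  assumes "r \<in> tensor_relations K P Q"
  obtains (left) x x' y where "r = frag_of (x \<oplus>\<^bsub>P\<^esub> x', y) - frag_of (x, y) - frag_of (x', y)"
      "x \<in> carrier P" "x' \<in> carrier P" "y \<in> carrier Q"
    | (right) x y y' where "r = frag_of (x, y \<oplus>\<^bsub>Q\<^esub> y') - frag_of (x, y) - frag_of (x, y')"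
      "x \<in> carrier P" "y \<in> carrier Q" "y' \<in> carrier Q"
    | (balance) x k y where "r = frag_of (x \<odot>\<^sup>r\<^bsub>P\<^esub> k, y) - frag_of (x, k \<odot>\<^bsub>Q\<^esub> y)"
      "x \<in> carrier P" "k \<in> K" "y \<in> carrier Q"
  using assms unfolding tensor_relations_def by blast

lemma rel_in_H: "r \<in> tensor_relations K P Q \<Longrightarrow> r \<in> H"
  by (rule generate.incl)

lemma tens_add_left:
  assumes "x \<in> carrier P" "x' \<in> carrier P" "y \<in> carrier Q"
  shows "tens (x \<oplus>\<^bsub>P\<^esub> x') y = tens x y \<oplus>\<^bsub>T\<^esub> tens x' y"
proof -
  have "frag_of (x \<oplus>\<^bsub>P\<^esub> x', y) - frag_of (x, y) - frag_of (x', y) \<in> H"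
    by (rule rel_in_H) (use assms in \<open>auto simp: tensor_relations_def\<close>)
  then show ?thesis unfolding tens_def T_add cls_eq_iff by (simp add: diff_diff_eq)
qed

lemma tens_add_right:
  assumes "x \<in> carrier P" "y \<in> carrier Q" "y' \<in> carrier Q"
  shows "tens x (y \<oplus>\<^bsub>Q\<^esub> y') = tens x y \<oplus>\<^bsub>T\<^esub> tens x y'"
proof -
  have "frag_of (x, y \<oplus>\<^bsub>Q\<^esub> y') - frag_of (x, y) - frag_of (x, y') \<in> H"
    by (rule rel_in_H) (use assms in \<open>auto simp: tensor_relations_def\<close>)
  then show ?thesis unfolding tens_def T_add cls_eq_iff by (simp add: diff_diff_eq)
qed

lemma tens_balanced:
  assumes "x \<in> carrier P" "y \<in> carrier Q" "k \<in> K"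
  shows "tens (x \<odot>\<^sup>r\<^bsub>P\<^esub> k) y = tens x (k \<odot>\<^bsub>Q\<^esub> y)"
proof -
  have "frag_of (x \<odot>\<^sup>r\<^bsub>P\<^esub> k, y) - frag_of (x, k \<odot>\<^bsub>Q\<^esub> y) \<in> H"
    by (rule rel_in_H) (use assms in \<open>unfold tensor_relations_def, blast\<close>)
  then show ?thesis unfolding tens_def cls_eq_iff .
qed

text \<open>Pure tensors generate the tensor product under addition alone, since \<open>-(x \<otimes> y) = (-x) \<otimes> y\<close>.\<close>

lemma tensor_induct [consumes 1, case_names zero add tens]:
  assumes "C \<in> carrier T" and z: "R \<zero>\<^bsub>T\<^esub>"
    and a: "\<And>C D. C \<in> carrier T \<Longrightarrow> D \<in> carrier T \<Longrightarrow> R C \<Longrightarrow> R D \<Longrightarrow> R (C \<oplus>\<^bsub>T\<^esub> D)"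
    and t: "\<And>x y. x \<in> carrier P \<Longrightarrow> y \<in> carrier Q \<Longrightarrow> R (tens x y)"
  shows "R C"
proof -
  interpret P: abelian_group P by (rule P_group)
  obtain f where f: "f \<in> carrier F" "C = cls f" using assms(1) unfolding T_carrier by blast
  have neg: "cls (- frag_of (x, y)) = tens (\<ominus>\<^bsub>P\<^esub> x) y" if "x \<in> carrier P" "y \<in> carrier Q" for x y
  proof -
    have 0: "tens (\<zero>\<^bsub>P\<^esub>) y = \<zero>\<^bsub>T\<^esub>"
      using tens_add_left[of "\<zero>\<^bsub>P\<^esub>" "\<zero>\<^bsub>P\<^esub>" y] that T.add.r_cancel_one'[of "tens \<zero>\<^bsub>P\<^esub> y" "tens \<zero>\<^bsub>P\<^esub> y"] by simp
    have "tens (\<ominus>\<^bsub>P\<^esub> x) y \<oplus>\<^bsub>T\<^esub> tens x y = \<zero>\<^bsub>T\<^esub>"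
      using tens_add_left[of "\<ominus>\<^bsub>P\<^esub> x" x y] that 0 by (simp add: P.l_neg)
    moreover have "cls (- frag_of (x, y)) \<oplus>\<^bsub>T\<^esub> tens x y = \<zero>\<^bsub>T\<^esub>"
      unfolding tens_def T_add T_zero by simp
    moreover have "cls (- frag_of (x, y)) \<in> carrier T" unfolding T_carrier using that by (intro imageI) simp
    ultimately show ?thesis
      using that T.add.right_cancel[of "tens x y" "cls (- frag_of (x, y))" "tens (\<ominus>\<^bsub>P\<^esub> x) y"] by simp
  qed
  have "Poly_Mapping.keys f \<subseteq> carrier P \<times> carrier Q" using f(1) by simp
  then have "R (cls f) \<and> R (cls (- f))"
  proof (rule free_Abelian_group_induct)
    show "R (cls 0) \<and> R (cls (- 0))" using z by (simp add: T_zero)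
  next
    fix f g
    assume fg: "Poly_Mapping.keys f \<subseteq> carrier P \<times> carrier Q" "Poly_Mapping.keys g \<subseteq> carrier P \<times> carrier Q"
      "R (cls f) \<and> R (cls (- f))" "R (cls g) \<and> R (cls (- g))"
    have c: "cls f \<in> carrier T" "cls g \<in> carrier T" "cls (- f) \<in> carrier T" "cls (- g) \<in> carrier T"
      unfolding T_carrier using fg(1,2) by (auto intro!: imageI)
    have "R (cls f \<oplus>\<^bsub>T\<^esub> cls (- g))" "R (cls (- f) \<oplus>\<^bsub>T\<^esub> cls g)"
      using fg(3,4) c by (auto intro!: a)
    then show "R (cls (f - g)) \<and> R (cls (- (f - g)))" by (simp add: T_add)
  next
    fix xy assume "xy \<in> carrier P \<times> carrier Q"
    then obtain x y where xy: "xy = (x, y)" "x \<in> carrier P" "y \<in> carrier Q" by blast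
    have "R (tens x y)" using t xy by blast
    moreover have "R (cls (- frag_of (x, y)))" using t[of "\<ominus>\<^bsub>P\<^esub> x" y] xy neg by simp
    ultimately show "R (cls (frag_of xy)) \<and> R (cls (- frag_of xy))" by (simp add: xy tens_def)
  qed
  then show ?thesis using f by simp
qed

text \<open>The universal property of the tensor product: the map induced on the free abelian group kills
  the relations, hence the subgroup that they generate.\<close>

lemma tensor_lift:
  assumes A: "abelian_group A"
    and cl: "\<And>x y. x \<in> carrier P \<Longrightarrow> y \<in> carrier Q \<Longrightarrow> G x y \<in> carrier A"
    and a1: "\<And>x x' y. x \<in> carrier P \<Longrightarrow> x' \<in> carrier P \<Longrightarrow> y \<in> carrier Q \<Longrightarrow> G (x \<oplus>\<^bsub>P\<^esub> x') y = G x y \<oplus>\<^bsub>A\<^esub> G x' y"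
    and a2: "\<And>x y y'. x \<in> carrier P \<Longrightarrow> y \<in> carrier Q \<Longrightarrow> y' \<in> carrier Q \<Longrightarrow> G x (y \<oplus>\<^bsub>Q\<^esub> y') = G x y \<oplus>\<^bsub>A\<^esub> G x y'"
    and b: "\<And>x y k. x \<in> carrier P \<Longrightarrow> y \<in> carrier Q \<Longrightarrow> k \<in> K \<Longrightarrow> G (x \<odot>\<^sup>r\<^bsub>P\<^esub> k) y = G x (k \<odot>\<^bsub>Q\<^esub> y)"
  obtains h where "\<And>C. C \<in> carrier T \<Longrightarrow> h C \<in> carrier A"
    "\<And>C D. C \<in> carrier T \<Longrightarrow> D \<in> carrier T \<Longrightarrow> h (C \<oplus>\<^bsub>T\<^esub> D) = h C \<oplus>\<^bsub>A\<^esub> h D"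
    "\<And>x y. x \<in> carrier P \<Longrightarrow> y \<in> carrier Q \<Longrightarrow> h (tens x y) = G x y"
proof -
  interpret A: abelian_group A by fact
  interpret P: abelian_group P by (rule P_group)
  interpret Q: abelian_group Q by (rule Q_group)
  have Ac: "comm_group (add_monoid A)" by (rule A.a_comm_group)
  have "(\<lambda>(x, y). G x y) ` (carrier P \<times> carrier Q) \<subseteq> carrier (add_monoid A)" using cl by auto
  then obtain h0 where h0: "h0 \<in> hom F (add_monoid A)"
    "\<And>xy. xy \<in> carrier P \<times> carrier Q \<Longrightarrow> h0 (frag_of xy) = (\<lambda>(x, y). G x y) xy"
    using comm_group.free_Abelian_group_universal[OF Ac] by metis
  have h0c: "h0 f \<in> carrier A" if "f \<in> carrier F" for f
    using hom_in_carrier[OF h0(1) that] by simp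
  have h0a: "h0 (f + g) = h0 f \<oplus>\<^bsub>A\<^esub> h0 g" if "f \<in> carrier F" "g \<in> carrier F" for f g
    using hom_mult[OF h0(1) that] by simp
  have h0d: "h0 f = h0 (f - g) \<oplus>\<^bsub>A\<^esub> h0 g" if "f \<in> carrier F" "g \<in> carrier F" for f g
    using h0a[OF F_diff[OF that] that(2)] by simp
  have h0of: "h0 (frag_of (x, y)) = G x y" if "x \<in> carrier P" "y \<in> carrier Q" for x y
    using h0(2)[of "(x, y)"] that by simp
  interpret h0: group_hom F "add_monoid A" h0
    by (intro group_hom.intro group_hom_axioms.intro h0(1) group_free_Abelian_group A.a_group)
  have rel: "h0 r = \<zero>\<^bsub>A\<^esub>" if r: "r \<in> tensor_relations K P Q" for r
  proof -
    have d3: "h0 (f - g - g') = \<zero>\<^bsub>A\<^esub>"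
      if "f \<in> carrier F" "g \<in> carrier F" "g' \<in> carrier F" "h0 f = h0 g \<oplus>\<^bsub>A\<^esub> h0 g'" for f g g'
    proof -
      have "h0 f = h0 (f - (g + g')) \<oplus>\<^bsub>A\<^esub> (h0 g \<oplus>\<^bsub>A\<^esub> h0 g')"
        using h0d[OF that(1) F_add[OF that(2,3)]] h0a[OF that(2,3)] by simp
      then show ?thesis
        using that(4) h0c that(1-3) F_diff F_add A.add.r_cancel_one'[of "h0 g \<oplus>\<^bsub>A\<^esub> h0 g'" "h0 (f - (g + g'))"]
        by (simp add: diff_diff_eq del: carrier_free_Abelian_group_iff)
    qed
    have d2: "h0 (f - g) = \<zero>\<^bsub>A\<^esub>" if "f \<in> carrier F" "g \<in> carrier F" "h0 f = h0 g" for f g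
      using h0d[OF that(1,2)] that(3) h0c[OF that(2)] h0c[OF F_diff[OF that(1,2)]]
        A.add.r_cancel_one'[of "h0 g" "h0 (f - g)"] by simp
    from r show ?thesis
    proof (cases rule: tensor_relation_cases)
      case left
      show ?thesis unfolding left(1) by (rule d3) (use left in \<open>auto simp: h0of a1\<close>)
    next
      case right
      show ?thesis unfolding right(1) by (rule d3) (use right in \<open>auto simp: h0of a2\<close>)
    next
      case balance
      show ?thesis unfolding balance(1) by (rule d2) (use balance P_right Q_left in \<open>auto simp: h0of b\<close>)
    qed
  qed
  have "tensor_relations K P Q \<subseteq> kernel F (add_monoid A) h0"
    using rel rel_subset unfolding kernel_def by (auto simp del: carrier_free_Abelian_group_iff)
  then have "H \<subseteq> kernel F (add_monoid A) h0"
    by (rule group.generate_subgroup_incl[OF group_free_Abelian_group _ h0.subgroup_kernel])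
  then have hH: "h0 f = \<zero>\<^bsub>A\<^esub>" if "f \<in> H" for f using that by (auto simp: kernel_def)
  define h where "h = (\<lambda>C. h0 (SOME f. f \<in> carrier F \<and> C = cls f))"
  have h: "h (cls f) = h0 f" if f: "f \<in> carrier F" for f
  proof -
    define g where "g = (SOME g. g \<in> carrier F \<and> cls f = cls g)"
    have g: "g \<in> carrier F" "cls f = cls g"
      using someI[of "\<lambda>g. g \<in> carrier F \<and> cls f = cls g" f] f by (auto simp: g_def)
    have "h0 (f - g) = \<zero>\<^bsub>A\<^esub>" using g(2) hH by (simp add: cls_eq_iff)
    then have "h0 f = h0 g" using h0d[OF f g(1)] h0c[OF g(1)] by simp
    then show ?thesis by (simp add: h_def g_def)
  qed
  show ?thesis
  proof (rule that)
    fix C assume "C \<in> carrier T"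
    then obtain f where f: "f \<in> carrier F" "C = cls f" unfolding T_carrier by blast
    show "h C \<in> carrier A" using h[OF f(1)] h0c[OF f(1)] f(2) by simp
    fix D assume "D \<in> carrier T"
    then obtain g where g: "g \<in> carrier F" "D = cls g" unfolding T_carrier by blast
    show "h (C \<oplus>\<^bsub>T\<^esub> D) = h C \<oplus>\<^bsub>A\<^esub> h D"
      using h[OF f(1)] h[OF g(1)] h[OF F_add[OF f(1) g(1)]] h0a[OF f(1) g(1)] f(2) g(2)
      by (simp add: T_add)
  next
    fix x y assume "x \<in> carrier P" "y \<in> carrier Q"
    then show "h (tens x y) = G x y" using h[OF F_of, of x y] h0of by (simp add: tens_def)
  qed
qed

text \<open>The actions on the tensor product send a coset \<open>C\<close> to \<open>H + \<phi> C\<close>. This is the coset of \<open>\<phi> f\<close> for any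
  representative \<open>f\<close> of \<open>C\<close>, because \<open>\<phi>\<close> preserves the relations and hence \<open>H\<close>.\<close>

lemma push_cls:
  fixes \<phi> :: "(('b \<times> 'c) \<Rightarrow>\<^sub>0 int) \<Rightarrow> (('b \<times> 'c) \<Rightarrow>\<^sub>0 int)"
  assumes add: "\<And>f g. \<phi> (f + g) = \<phi> f + \<phi> g" and diff: "\<And>f g. \<phi> (f - g) = \<phi> f - \<phi> g"
    and cl: "\<And>f. f \<in> carrier F \<Longrightarrow> \<phi> f \<in> carrier F"
    and rel: "\<And>r. r \<in> tensor_relations K P Q \<Longrightarrow> \<phi> r \<in> H"
  shows "H <#>\<^bsub>F\<^esub> \<phi> ` cls f = cls (\<phi> f)"
proof -
  have \<phi>H: "\<phi> h \<in> H" if "h \<in> H" for h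
    using that
  proof (induction h rule: generate.induct)
    case one
    have "\<phi> 0 = 0" using add[of 0 0] by simp
    then show ?case using H_zero by simp
  next
    case (incl h)
    then show ?case by (rule rel)
  next
    case (inv h)
    have "inv\<^bsub>F\<^esub> h = 0 - h" using inv rel_subset by auto
    then have "\<phi> (inv\<^bsub>F\<^esub> h) = \<phi> 0 - \<phi> h" by (simp only: diff)
    moreover have "\<phi> 0 = 0" using add[of 0 0] by simp
    ultimately show ?case using H_minus[OF rel[OF inv]] by simp
  next
    case (eng h1 h2)
    then show ?case by (simp add: add H_add)
  qed
  have "H <#>\<^bsub>F\<^esub> \<phi> ` cls f = {h + (\<phi> h' + \<phi> f) | h h'. h \<in> H \<and> h' \<in> H}"
    by (auto simp: set_mult_def cls_image add)
  also have "\<dots> = cls (\<phi> f)"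
  proof (intro equalityI subsetI)
    fix x assume "x \<in> {h + (\<phi> h' + \<phi> f) | h h'. h \<in> H \<and> h' \<in> H}"
    then obtain h h' where h: "h \<in> H" "h' \<in> H" "x = (h + \<phi> h') + \<phi> f" by (auto simp: ac_simps)
    then show "x \<in> cls (\<phi> f)" unfolding cls_image using H_add[OF h(1) \<phi>H[OF h(2)]] by blast
  next
    fix x assume "x \<in> cls (\<phi> f)"
    then obtain h where h: "h \<in> H" "x = h + \<phi> f" by (auto simp: cls_image)
    have "\<phi> 0 = 0" using add[of 0 0] by simp
    then have "x = h + (\<phi> 0 + \<phi> f)" using h by simp
    then show "x \<in> {h + (\<phi> h' + \<phi> f) | h h'. h \<in> H \<and> h' \<in> H}" using h H_zero by blast
  qed
  finally show ?thesis .
qed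

lemma frag_extend_closed:
  assumes "\<And>xy. xy \<in> carrier P \<times> carrier Q \<Longrightarrow> \<phi> xy \<in> carrier F" "f \<in> carrier F"
  shows "frag_extend \<phi> f \<in> carrier F"
proof -
  have "Poly_Mapping.keys f \<subseteq> carrier P \<times> carrier Q" using assms(2) by simp
  then show ?thesis
  proof (rule free_Abelian_group_induct)
    fix f g assume "frag_extend \<phi> f \<in> carrier F" "frag_extend \<phi> g \<in> carrier F"
    then show "frag_extend \<phi> (f - g) \<in> carrier F" unfolding frag_extend_diff by (rule F_diff)
  next
    fix xy assume "xy \<in> carrier P \<times> carrier Q"
    then show "frag_extend \<phi> (frag_of xy) \<in> carrier F" using assms(1) by simp
  qed simp
qed

lemma push_pair:
  assumes l: "\<And>x x'. x \<in> carrier P \<Longrightarrow> x' \<in> carrier P \<Longrightarrow> l (x \<oplus>\<^bsub>P\<^esub> x') = l x \<oplus>\<^bsub>P\<^esub> l x'"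
      "\<And>x. x \<in> carrier P \<Longrightarrow> l x \<in> carrier P"
      "\<And>x k. x \<in> carrier P \<Longrightarrow> k \<in> K \<Longrightarrow> l (x \<odot>\<^sup>r\<^bsub>P\<^esub> k) = l x \<odot>\<^sup>r\<^bsub>P\<^esub> k"
    and r: "\<And>y y'. y \<in> carrier Q \<Longrightarrow> y' \<in> carrier Q \<Longrightarrow> r (y \<oplus>\<^bsub>Q\<^esub> y') = r y \<oplus>\<^bsub>Q\<^esub> r y'"
      "\<And>y. y \<in> carrier Q \<Longrightarrow> r y \<in> carrier Q"
      "\<And>y k. y \<in> carrier Q \<Longrightarrow> k \<in> K \<Longrightarrow> r (k \<odot>\<^bsub>Q\<^esub> y) = k \<odot>\<^bsub>Q\<^esub> r y"
  shows "H <#>\<^bsub>F\<^esub> frag_extend (\<lambda>(x, y). frag_of (l x, r y)) ` cls f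
    = cls (frag_extend (\<lambda>(x, y). frag_of (l x, r y)) f)"
proof (rule push_cls)
  fix q assume "q \<in> tensor_relations K P Q"
  then show "frag_extend (\<lambda>(x, y). frag_of (l x, r y)) q \<in> H"
  proof (cases rule: tensor_relation_cases)
    case (left x x' y)
    have "frag_of (l x \<oplus>\<^bsub>P\<^esub> l x', r y) - frag_of (l x, r y) - frag_of (l x', r y) \<in> tensor_relations K P Q"
      unfolding tensor_relations_def using left l(2) r(2) by blast
    then show ?thesis using left by (intro rel_in_H) (simp add: frag_extend_diff l(1))
  next
    case (right x y y')
    have "frag_of (l x, r y \<oplus>\<^bsub>Q\<^esub> r y') - frag_of (l x, r y) - frag_of (l x, r y') \<in> tensor_relations K P Q"
      unfolding tensor_relations_def using right l(2) r(2) by blast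
    then show ?thesis using right by (intro rel_in_H) (simp add: frag_extend_diff r(1))
  next
    case (balance x k y)
    have "frag_of (l x \<odot>\<^sup>r\<^bsub>P\<^esub> k, r y) - frag_of (l x, k \<odot>\<^bsub>Q\<^esub> r y) \<in> tensor_relations K P Q"
      unfolding tensor_relations_def using balance l(2) r(2) by blast
    then show ?thesis using balance by (intro rel_in_H) (simp add: frag_extend_diff l(3) r(3))
  qed
next
  fix f assume f: "f \<in> carrier F"
  show "frag_extend (\<lambda>(x, y). frag_of (l x, r y)) f \<in> carrier F"
    by (rule frag_extend_closed[OF _ f]) (auto simp: l(2) r(2))
qed (simp_all add: frag_extend_add frag_extend_diff)

end

locale tensor_bimodule = P: bimodule L P + Q: bimodule L Q
  for L :: "('a, 'k) ring_scheme" (structure) and K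
    and P :: "('a, 'b, 'm) bimodule_scheme" and Q :: "('a, 'c, 'n) bimodule_scheme" +
  assumes K_sub: "K \<subseteq> carrier L"
begin

lemma K_closed: "k \<in> K \<Longrightarrow> k \<in> carrier L" using K_sub by blast

sublocale bimodule_pair K P Q
proof (rule bimodule_pair.intro)
  show "abelian_group P" by (rule P.left.M.abelian_group_axioms)
  show "abelian_group Q" by (rule Q.left.M.abelian_group_axioms)
next
  fix x k assume "x \<in> carrier P" "k \<in> K"
  then show "x \<odot>\<^sup>r\<^bsub>P\<^esub> k \<in> carrier P"
    using P.right.smult_closed[of k x] K_closed by (simp add: right_module_def)
next
  fix y k assume "y \<in> carrier Q" "k \<in> K"
  then show "k \<odot>\<^bsub>Q\<^esub> y \<in> carrier Q"
    using Q.left.smult_closed[of k y] K_closed by simp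
qed

lemma T_smult_cls:
  assumes "a \<in> carrier L"
  shows "a \<odot>\<^bsub>T\<^esub> cls f = cls (frag_extend (\<lambda>(x, y). frag_of (a \<odot>\<^bsub>P\<^esub> x, y)) f)"
proof -
  have "a \<odot>\<^bsub>T\<^esub> cls f = H <#>\<^bsub>F\<^esub> frag_extend (\<lambda>(x, y). frag_of (a \<odot>\<^bsub>P\<^esub> x, y)) ` cls f"
    by (simp add: bimodule_tensor_def Let_def)
  also have "\<dots> = cls (frag_extend (\<lambda>(x, y). frag_of (a \<odot>\<^bsub>P\<^esub> x, y)) f)"
    by (rule push_pair) (use assms K_closed in \<open>auto simp: P.left.smult_r_distr P.smult_rsmult\<close>)
  finally show ?thesis .
qed

lemma T_rsmult_cls:
  assumes "a \<in> carrier L"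
  shows "cls f \<odot>\<^sup>r\<^bsub>T\<^esub> a = cls (frag_extend (\<lambda>(x, y). frag_of (x, y \<odot>\<^sup>r\<^bsub>Q\<^esub> a)) f)"
proof -
  have "cls f \<odot>\<^sup>r\<^bsub>T\<^esub> a = H <#>\<^bsub>F\<^esub> frag_extend (\<lambda>(x, y). frag_of (x, y \<odot>\<^sup>r\<^bsub>Q\<^esub> a)) ` cls f"
    by (simp add: bimodule_tensor_def Let_def)
  also have "\<dots> = cls (frag_extend (\<lambda>(x, y). frag_of (x, y \<odot>\<^sup>r\<^bsub>Q\<^esub> a)) f)"
    by (rule push_pair)
      (use assms K_closed Q.right.smult_r_distr[of a] Q.right.smult_closed[of a]
        in \<open>auto simp: Q.smult_rsmult right_module_def\<close>)
  finally show ?thesis .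
qed

lemma T_smult_tens: "a \<in> carrier L \<Longrightarrow> a \<odot>\<^bsub>T\<^esub> tens x y = tens (a \<odot>\<^bsub>P\<^esub> x) y"
  by (simp add: tens_def T_smult_cls)

lemma T_rsmult_tens: "a \<in> carrier L \<Longrightarrow> tens x y \<odot>\<^sup>r\<^bsub>T\<^esub> a = tens x (y \<odot>\<^sup>r\<^bsub>Q\<^esub> a)"
  by (simp add: tens_def T_rsmult_cls)

lemma T_smult_add:
  assumes "a \<in> carrier L" "C \<in> carrier T" "D \<in> carrier T"
  shows "a \<odot>\<^bsub>T\<^esub> (C \<oplus>\<^bsub>T\<^esub> D) = a \<odot>\<^bsub>T\<^esub> C \<oplus>\<^bsub>T\<^esub> a \<odot>\<^bsub>T\<^esub> D"
  using assms unfolding T_carrier by (auto simp: T_add T_smult_cls frag_extend_add)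

lemma T_rsmult_add:
  assumes "a \<in> carrier L" "C \<in> carrier T" "D \<in> carrier T"
  shows "(C \<oplus>\<^bsub>T\<^esub> D) \<odot>\<^sup>r\<^bsub>T\<^esub> a = C \<odot>\<^sup>r\<^bsub>T\<^esub> a \<oplus>\<^bsub>T\<^esub> D \<odot>\<^sup>r\<^bsub>T\<^esub> a"
  using assms unfolding T_carrier by (auto simp: T_add T_rsmult_cls frag_extend_add)

lemma T_smult_closed:
  assumes "a \<in> carrier L" "C \<in> carrier T" shows "a \<odot>\<^bsub>T\<^esub> C \<in> carrier T"
proof -
  obtain f where f: "f \<in> carrier F" "C = cls f" using assms(2) unfolding T_carrier by blast
  show ?thesis unfolding f(2) T_smult_cls[OF assms(1)] T_carrier
    by (intro imageI frag_extend_closed[OF _ f(1)]) (use assms in auto)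
qed

lemma T_rsmult_closed:
  assumes "a \<in> carrier L" "C \<in> carrier T" shows "C \<odot>\<^sup>r\<^bsub>T\<^esub> a \<in> carrier T"
proof -
  obtain f where f: "f \<in> carrier F" "C = cls f" using assms(2) unfolding T_carrier by blast
  have "frag_extend (\<lambda>(x, y). frag_of (x, y \<odot>\<^sup>r\<^bsub>Q\<^esub> a)) f \<in> carrier F"
  proof (rule frag_extend_closed[OF _ f(1)])
    fix xy assume "xy \<in> carrier P \<times> carrier Q"
    then obtain x y where xy: "xy = (x, y)" "x \<in> carrier P" "y \<in> carrier Q" by blast
    have "y \<odot>\<^sup>r\<^bsub>Q\<^esub> a \<in> carrier Q"
      using Q.right.smult_closed[of a y] xy(3) assms(1) by (simp add: right_module_def)
    then show "(\<lambda>(x, y). frag_of (x, y \<odot>\<^sup>r\<^bsub>Q\<^esub> a)) xy \<in> carrier F" using xy by simp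
  qed
  then show ?thesis unfolding f(2) T_rsmult_cls[OF assms(1)] T_carrier by (rule imageI)
qed

end

section \<open>Coordinates of a Galois bimodule\<close>

lemma bimodule_power_simps:
  "carrier (bimodule_power P r) = {..<r} \<rightarrow>\<^sub>E carrier P"
  "x \<oplus>\<^bsub>bimodule_power P r\<^esub> y = (\<lambda>i\<in>{..<r}. x i \<oplus>\<^bsub>P\<^esub> y i)"
  "a \<odot>\<^bsub>bimodule_power P r\<^esub> x = (\<lambda>i\<in>{..<r}. a \<odot>\<^bsub>P\<^esub> x i)"
  "x \<odot>\<^sup>r\<^bsub>bimodule_power P r\<^esub> a = (\<lambda>i\<in>{..<r}. x i \<odot>\<^sup>r\<^bsub>P\<^esub> a)"
  by (simp_all add: bimodule_power_def)

lemma bimodule_isoD: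
  assumes "f \<in> bimodule_iso L P Q"
  shows "\<And>x. x \<in> carrier P \<Longrightarrow> f x \<in> carrier Q"
    and "\<And>x y. x \<in> carrier P \<Longrightarrow> y \<in> carrier P \<Longrightarrow> f (x \<oplus>\<^bsub>P\<^esub> y) = f x \<oplus>\<^bsub>Q\<^esub> f y"
    and "\<And>a x. a \<in> carrier L \<Longrightarrow> x \<in> carrier P \<Longrightarrow> f (a \<odot>\<^bsub>P\<^esub> x) = a \<odot>\<^bsub>Q\<^esub> f x"
    and "\<And>a x. a \<in> carrier L \<Longrightarrow> x \<in> carrier P \<Longrightarrow> f (x \<odot>\<^sup>r\<^bsub>P\<^esub> a) = f x \<odot>\<^sup>r\<^bsub>Q\<^esub> a"
    and "bij_betw f (carrier P) (carrier Q)"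
  using assms unfolding bimodule_iso_def module_hom_def by auto

lemma bimodule_isoI:
  assumes "\<And>x. x \<in> carrier P \<Longrightarrow> f x \<in> carrier Q"
    and "\<And>x y. x \<in> carrier P \<Longrightarrow> y \<in> carrier P \<Longrightarrow> f (x \<oplus>\<^bsub>P\<^esub> y) = f x \<oplus>\<^bsub>Q\<^esub> f y"
    and "\<And>a x. a \<in> carrier L \<Longrightarrow> x \<in> carrier P \<Longrightarrow> f (a \<odot>\<^bsub>P\<^esub> x) = a \<odot>\<^bsub>Q\<^esub> f x"
    and "\<And>a x. a \<in> carrier L \<Longrightarrow> x \<in> carrier P \<Longrightarrow> f (x \<odot>\<^sup>r\<^bsub>P\<^esub> a) = f x \<odot>\<^sup>r\<^bsub>Q\<^esub> a"
    and "bij_betw f (carrier P) (carrier Q)"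
  shows "f \<in> bimodule_iso L P Q"
  using assms unfolding bimodule_iso_def module_hom_def by auto

text \<open>A balanced form is a left linear map on the tensor product, hence on \<open>P\<^sup>d\<close> through the isomorphism
  \<open>f\<close>. Its restrictions to the summands are the forms \<open>g t\<close>.\<close>

lemma (in field_bimodule) balanced_lift_of_iso:
  assumes f: "f \<in> bimodule_iso L (bimodule_tensor (carrier L) P P) (bimodule_power P d)"
    and G: "balanced G"
  shows "\<exists>g. (\<forall>t<d. left.linear_form (g t)) \<and>
    (\<forall>p\<in>carrier P. \<forall>q\<in>carrier P. G p q = (\<Oplus>t\<in>{..<d}. g t (f (bimodule_pair.tens (carrier L) P P p q) t)))"
proof -
  interpret TB: tensor_bimodule L "carrier L" P P
    by (intro tensor_bimodule.intro tensor_bimodule_axioms.intro bimodule_axioms) simp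
  let ?T = "bimodule_tensor (carrier L) P P" and ?W = "bimodule_power P d"
  note fD = bimodule_isoD[OF f]
  note GD = G[unfolded balanced_def]
  obtain H where H: "\<And>C. C \<in> carrier ?T \<Longrightarrow> H C \<in> carrier L"
    "\<And>C D. C \<in> carrier ?T \<Longrightarrow> D \<in> carrier ?T \<Longrightarrow> H (C \<oplus>\<^bsub>?T\<^esub> D) = H C \<oplus> H D"
    "\<And>x y. x \<in> carrier P \<Longrightarrow> y \<in> carrier P \<Longrightarrow> H (TB.tens x y) = G x y"
    by (rule TB.tensor_lift[OF abelian_group_axioms, of G]) (use GD in auto)
  have H0: "H \<zero>\<^bsub>?T\<^esub> = \<zero>"
    using H(2)[OF TB.T.zero_closed TB.T.zero_closed] H(1)[OF TB.T.zero_closed]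
      add.r_cancel_one'[of "H \<zero>\<^bsub>?T\<^esub>" "H \<zero>\<^bsub>?T\<^esub>"] by simp
  have T0: "a \<odot>\<^bsub>?T\<^esub> \<zero>\<^bsub>?T\<^esub> = \<zero>\<^bsub>?T\<^esub>" if "a \<in> carrier L" for a
    using TB.T_smult_add[OF that TB.T.zero_closed TB.T.zero_closed] TB.T_smult_closed[OF that TB.T.zero_closed]
      TB.T.add.r_cancel_one'[of "a \<odot>\<^bsub>?T\<^esub> \<zero>\<^bsub>?T\<^esub>" "a \<odot>\<^bsub>?T\<^esub> \<zero>\<^bsub>?T\<^esub>"] by simp
  have Hl: "H (a \<odot>\<^bsub>?T\<^esub> C) = a \<otimes> H C" if a: "a \<in> carrier L" and C: "C \<in> carrier ?T" for a C
    using C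
  proof (induction rule: TB.tensor_induct)
    case zero
    then show ?case using a by (simp add: T0 H0)
  next
    case (add C D)
    then show ?case using a by (simp add: TB.T_smult_add TB.T_smult_closed H r_distr)
  next
    case (tens x y)
    then show ?case using a GD by (simp add: TB.T_smult_tens H)
  qed
  define k where "k = inv_into (carrier ?T) f"
  have k: "k Z \<in> carrier ?T" "f (k Z) = Z" if "Z \<in> carrier ?W" for Z
    using that fD(5) by (auto simp: k_def bij_betw_def inv_into_into f_inv_into_f)
  have kf: "k (f C) = C" if "C \<in> carrier ?T" for C
    using that fD(5) by (simp add: k_def bij_betw_def inv_into_f_f)
  have k_add: "k (Z \<oplus>\<^bsub>?W\<^esub> Z') = k Z \<oplus>\<^bsub>?T\<^esub> k Z'" if "Z \<in> carrier ?W" "Z' \<in> carrier ?W" for Z Z'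
    using kf[of "k Z \<oplus>\<^bsub>?T\<^esub> k Z'"] fD(2)[of "k Z" "k Z'"] k[OF that(1)] k[OF that(2)] by simp
  have k_l: "k (a \<odot>\<^bsub>?W\<^esub> Z) = a \<odot>\<^bsub>?T\<^esub> k Z" if "a \<in> carrier L" "Z \<in> carrier ?W" for a Z
    using kf[of "a \<odot>\<^bsub>?T\<^esub> k Z"] fD(3)[of a "k Z"] k[OF that(2)] TB.T_smult_closed[OF that(1)] that by simp
  \<comment> \<open>The map on \<open>P\<^sup>d\<close> that corresponds to \<open>G\<close>; the forms \<open>g t\<close> are its restrictions to the summands \<open>e t\<close>.\<close>
  define \<theta> where "\<theta> = (\<lambda>Z. H (k Z))"
  define e where "e = (\<lambda>t p. \<lambda>i\<in>{..<d}. if i = t then p else \<zero>\<^bsub>P\<^esub>)"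
  have e: "e t p \<in> carrier ?W" if "p \<in> carrier P" for t p
    using that by (auto simp: e_def bimodule_power_simps)
  have e_add: "e t (p \<oplus>\<^bsub>P\<^esub> q) = e t p \<oplus>\<^bsub>?W\<^esub> e t q" if "p \<in> carrier P" "q \<in> carrier P" for t p q
    unfolding bimodule_power_simps using that by (auto simp: e_def)
  have e_l: "e t (a \<triangleright> p) = a \<odot>\<^bsub>?W\<^esub> e t p" if "a \<in> carrier L" "p \<in> carrier P" for t a p
    unfolding bimodule_power_simps using that by (auto simp: e_def)
  have \<theta>_add: "\<theta> (Z \<oplus>\<^bsub>?W\<^esub> Z') = \<theta> Z \<oplus> \<theta> Z'" if "Z \<in> carrier ?W" "Z' \<in> carrier ?W" for Z Z'
    using that k by (simp add: \<theta>_def k_add H)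
  have \<theta>L: "\<theta> Z \<in> carrier L" if "Z \<in> carrier ?W" for Z using that k H by (simp add: \<theta>_def)
  define g where "g = (\<lambda>t p. \<theta> (e t p))"
  have form: "left.linear_form (g t)" for t
    unfolding left.linear_form_def
  proof (intro conjI ballI funcsetI)
    fix p assume p: "p \<in> carrier P"
    show "g t p \<in> carrier L" using p e \<theta>L by (simp add: g_def)
    show "g t (p \<oplus>\<^bsub>P\<^esub> q) = g t p \<oplus> g t q" if "q \<in> carrier P" for q
      using p that e by (simp add: g_def e_add \<theta>_add)
    show "g t (a \<triangleright> p) = a \<otimes> g t p" if "a \<in> carrier L" for a
      using p that e[OF p] k by (simp add: g_def e_l \<theta>_def k_l Hl)
  qed
  have decomp: "\<theta> Z = (\<Oplus>t\<in>{..<d}. g t (Z t))" if Z: "Z \<in> carrier ?W" for Z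
  proof -
    have ZP: "Z t \<in> carrier P" if "t < d" for t using Z that by (auto simp: bimodule_power_simps)
    \<comment> \<open>The tuple \<open>Z\<close> cut off after \<open>s\<close> entries, so that additivity can be used inductively.\<close>
    define Y where "Y = (\<lambda>s. \<lambda>i\<in>{..<d}. if i < s then Z i else \<zero>\<^bsub>P\<^esub>)"
    have Y: "Y s \<in> carrier ?W" for s using ZP by (auto simp: Y_def bimodule_power_simps)
    have "s \<le> d \<Longrightarrow> \<theta> (Y s) = (\<Oplus>t\<in>{..<s}. g t (Z t))" for s
    proof (induction s)
      case 0
      have "Y 0 \<oplus>\<^bsub>?W\<^esub> Y 0 = Y 0" unfolding bimodule_power_simps by (auto simp: Y_def)
      then have "\<theta> (Y 0) \<oplus> \<theta> (Y 0) = \<theta> (Y 0)" using \<theta>_add[OF Y Y, of 0 0] by simp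
      then show ?case using \<theta>L[OF Y, of 0] add.r_cancel_one'[of "\<theta> (Y 0)" "\<theta> (Y 0)"] by simp
    next
      case (Suc s)
      then have s: "s < d" by simp
      have "Y (Suc s) = e s (Z s) \<oplus>\<^bsub>?W\<^esub> Y s"
        unfolding bimodule_power_simps using ZP s by (auto simp: Y_def e_def less_Suc_eq)
      then have "\<theta> (Y (Suc s)) = g s (Z s) \<oplus> \<theta> (Y s)" using \<theta>_add[OF e[OF ZP[OF s]] Y, of s s] by (simp add: g_def)
      also have "\<dots> = (\<Oplus>t\<in>{..<Suc s}. g t (Z t))"
        unfolding lessThan_Suc using Suc s ZP form
        by (subst finsum_insert) (auto intro!: left.linear_form_closed)
      finally show ?case .
    qed
    then have "\<theta> (Y d) = (\<Oplus>t\<in>{..<d}. g t (Z t))" by simp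
    moreover have "Y d = Z"
    proof
      show "Y d i = Z i" for i using Z by (cases "i < d") (auto simp: Y_def bimodule_power_simps PiE_iff extensional_def)
    qed
    ultimately show ?thesis by simp
  qed
  have "G p q = (\<Oplus>t\<in>{..<d}. g t (f (TB.tens p q) t))" if pq: "p \<in> carrier P" "q \<in> carrier P" for p q
  proof -
    have C: "TB.tens p q \<in> carrier ?T" using pq by simp
    have "\<theta> (f (TB.tens p q)) = G p q" using kf[OF C] H(3)[OF pq] by (simp add: \<theta>_def)
    then show ?thesis using decomp[OF fD(1)[OF C]] by simp
  qed
  then show ?thesis using form by blast
qed

lemma ex_galois_data:
  assumes "field L" and gb: "galois_bimodule L P d"
  obtains b h c \<kappa> \<beta> where "galois_data L P d b h c \<kappa> \<beta>"
proof -
  have bm: "bimodule L P" and d: "1 \<le> d" using gb by (auto simp: galois_bimodule_def)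
  interpret field_bimodule L P by (intro field_bimodule.intro assms(1) bm)
  interpret TB: tensor_bimodule L "carrier L" P P
    by (intro tensor_bimodule.intro tensor_bimodule_axioms.intro bm) simp
  have vl: "vectorspace L P" by (intro vectorspace.intro left.module_axioms field_axioms)
  have vr: "vectorspace L (right_module P)" by (intro vectorspace.intro right.module_axioms field_axioms)
  have dl: "vectorspace.fin_dim L P" "vectorspace.dim L P = d"
    and dr: "vectorspace.fin_dim L (right_module P)" "vectorspace.dim L (right_module P) = d"
    using gb by (auto simp: galois_bimodule_def has_dimension_def)
  obtain b h where bh: "left.free_system d b h" "\<And>p. p \<in> carrier P \<Longrightarrow> left.system_proj d b h p = p"
    using vectorspace.ex_coordinates[OF vl dl] by blast
  obtain c \<kappa> where ck: "right.free_system d c \<kappa>"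
    "\<And>p. p \<in> carrier (right_module P) \<Longrightarrow> right.system_proj d c \<kappa> p = p"
    using vectorspace.ex_coordinates[OF vr dr] by blast
  let ?T = "bimodule_tensor (carrier L) P P" and ?W = "bimodule_power P d"
  obtain f where f: "f \<in> bimodule_iso L ?T ?W"
    using gb by (auto simp: galois_bimodule_def bimodule_isomorphic_def)
  note fD = bimodule_isoD[OF f]
  show ?thesis
  proof (rule that[of b h c \<kappa> "\<lambda>t p q. f (TB.tens p q) t"], unfold_locales)
    show "0 < d" using d by simp
    show "left.free_system d b h" by (rule bh)
    show "right.free_system d c \<kappa>" by (rule ck)
  next
    fix p assume p: "p \<in> carrier P"
    show "left.system_proj d b h p = p" by (rule bh(2)[OF p])
    show "right.system_proj d c \<kappa> p = p" using ck(2)[of p] p by simp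
  next
    fix t p q assume tpq: "t < d" "p \<in> carrier P" "q \<in> carrier P"
    show "f (TB.tens p q) t \<in> carrier P"
      using fD(1)[OF TB.tens_closed[OF tpq(2,3)]] tpq(1) by (auto simp: bimodule_power_simps)
  next
    fix t x p q assume tpq: "t < d" "x \<in> carrier L" "p \<in> carrier P" "q \<in> carrier P"
    show "f (TB.tens p (q \<triangleleft> x)) t = f (TB.tens p q) t \<triangleleft> x"
      using fD(4)[OF tpq(2) TB.tens_closed[OF tpq(3,4)]] tpq(1) TB.T_rsmult_tens[OF tpq(2)]
      by (simp add: bimodule_power_simps)
  next
    fix G assume "balanced G"
    then show "\<exists>g. (\<forall>t<d. left.linear_form (g t)) \<and>
      (\<forall>p\<in>carrier P. \<forall>q\<in>carrier P. G p q = (\<Oplus>\<^bsub>L\<^esub>t\<in>{..<d}. g t (f (TB.tens p q) t)))"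
      by (rule balanced_lift_of_iso[OF f])
  qed
qed

section \<open>Degree, rank and the isomorphism\<close>

lemma (in cring) regular_bimodule: "bimodule R (regular_bimodule R)"
proof -
  have ab: "abelian_group (regular_bimodule R)"
  proof (rule abelian_groupI)
    fix x assume "x \<in> carrier (regular_bimodule R)"
    then show "\<exists>y\<in>carrier (regular_bimodule R). y \<oplus>\<^bsub>regular_bimodule R\<^esub> x = \<zero>\<^bsub>regular_bimodule R\<^esub>"
      by (intro bexI[of _ "\<ominus> x"]) (auto simp: regular_bimodule_def l_neg)
  qed (auto simp: regular_bimodule_def a_ac)
  have ab': "abelian_group (right_module (regular_bimodule R))"
  proof (rule abelian_groupI)
    fix x assume "x \<in> carrier (right_module (regular_bimodule R))"
    then show "\<exists>y\<in>carrier (right_module (regular_bimodule R)).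
        y \<oplus>\<^bsub>right_module (regular_bimodule R)\<^esub> x = \<zero>\<^bsub>right_module (regular_bimodule R)\<^esub>"
      by (intro bexI[of _ "\<ominus> x"]) (auto simp: regular_bimodule_def l_neg)
  qed (auto simp: regular_bimodule_def a_ac)
  have m1: "module R (regular_bimodule R)"
    by (rule moduleI[OF is_cring ab]) (auto simp: regular_bimodule_def l_distr r_distr m_assoc)
  have m2: "module R (right_module (regular_bimodule R))"
    by (rule moduleI[OF is_cring ab']) (auto simp: regular_bimodule_def l_distr r_distr m_ac)
  show ?thesis
    by (intro bimodule.intro bimodule_axioms.intro m1 m2) (simp add: regular_bimodule_def m_assoc)
qed

lemma (in ring) combine_map_upt:
  assumes "length Ks = n" "set Ks \<subseteq> carrier R" "\<And>i. i < n \<Longrightarrow> u i \<in> carrier R"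
  shows "combine Ks (map u [0..<n]) = (\<Oplus>i\<in>{..<n}. Ks ! i \<otimes> u i)"
  using assms
proof (induction n arbitrary: Ks)
  case 0
  then show ?case by simp
next
  case (Suc n)
  obtain Ks' k where Ks: "Ks = Ks' @ [k]" "length Ks' = n" using Suc.prems(1) by (metis length_Suc_conv_rev)
  have c: "set Ks' \<subseteq> carrier R" "k \<in> carrier R" using Suc.prems(2) Ks by auto
  have uc: "u i \<in> carrier R" if "i \<le> n" for i using Suc.prems(3) that by simp
  have "combine Ks (map u [0..<Suc n]) = combine Ks' (map u [0..<n]) \<oplus> combine [k] [u n]"
  proof -
    have "set (map u [0..<n]) \<subseteq> carrier R" using uc by auto
    from combine_append[OF _ c(1) this, of "[k]" "[u n]"] show ?thesis
      unfolding Ks(1) using c(2) uc[of n] Ks(2) by simp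
  qed
  also have "combine Ks' (map u [0..<n]) = (\<Oplus>i\<in>{..<n}. Ks' ! i \<otimes> u i)"
    using Suc.IH[OF Ks(2) c(1)] uc by simp
  also have "\<dots> = (\<Oplus>i\<in>{..<n}. Ks ! i \<otimes> u i)"
    using Ks c uc by (intro finsum_cong') (auto simp: nth_append subset_iff)
  also have "\<dots> \<oplus> combine [k] [u n] = (\<Oplus>i\<in>{..<Suc n}. Ks ! i \<otimes> u i)"
  proof -
    have "Ks ! i \<in> carrier R" if "i \<le> n" for i using Suc.prems(1,2) that by (auto simp: subset_iff)
    then show ?thesis unfolding lessThan_Suc using uc c Ks
      by (subst finsum_insert) (auto intro!: finsum_closed a_comm)
  qed
  finally show ?case .
qed

context galois_dual
begin

lemma dimension_center: "dimension n center (carrier L)"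
proof -
  define Us where "Us = map u [0..<n]"
  have Us: "set Us \<subseteq> carrier L" "length Us = n" by (auto simp: Us_def)
  have cL: "center \<subseteq> carrier L" using center_closed by blast
  have "independent center Us"
  proof (rule trivial_combine_imp_independent[OF subfield_center Us(1)])
    fix Ks assume Ks: "set Ks \<subseteq> center" "combine Ks Us = \<zero>"
    obtain Ks' where Ks': "set (take (length Us) Ks) \<subseteq> set Ks'" "set Ks' \<subseteq> set (take (length Us) Ks) \<union> {\<zero>}"
      "length Ks' = length Us" "combine Ks' Us = \<zero>"
      using combine_normalize[OF _ Us(1) Ks(2)] Ks(1) cL by (metis order_trans)
    have zc: "\<zero> \<in> center" using subringE(2)[OF subfieldE(1)[OF subfield_center]] .
    have K'c: "set Ks' \<subseteq> center" using Ks'(2) Ks(1) zc set_take_subset[of "length Us" Ks] by blast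
    have nc: "Ks' ! i \<in> center" if "i < n" for i using K'c Ks'(3) Us(2) that by auto
    have eq: "(\<Oplus>i\<in>{..<n}. Ks' ! i \<otimes> u i) = \<zero>"
      using combine_map_upt[of Ks' n u] Ks' K'c cL Us by (auto simp: Us_def)
    have "Ks' ! k = \<zero>" if k: "k < n" for k
    proof -
      have "\<zero> = \<tau> (v k \<otimes> (\<Oplus>i\<in>{..<n}. Ks' ! i \<otimes> u i))"
        unfolding eq using k coeff_maps_zero_arg[OF tau_coeff] by simp
      also have "\<dots> = \<tau> (\<Oplus>i\<in>{..<n}. v k \<otimes> (Ks' ! i \<otimes> u i))"
        using k nc center_closed by (subst finsum_rdistr) auto
      also have "\<dots> = (\<Oplus>i\<in>{..<n}. \<tau> (v k \<otimes> (Ks' ! i \<otimes> u i)))"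
        using k nc center_closed by (intro klin_finsum[OF klin_tau]) auto
      also have "\<dots> = (\<Oplus>i\<in>{..<n}. if i = k then Ks' ! k else \<zero>)"
      proof (rule finsum_cong')
        fix i assume i: "i \<in> {..<n}"
        have nL: "Ks' ! i \<in> carrier L" using nc center_closed i by blast
        have "v k \<otimes> (Ks' ! i \<otimes> u i) = Ks' ! i \<otimes> (v k \<otimes> u i)" using i k nL by (simp add: m_lcomm)
        then have "\<tau> (v k \<otimes> (Ks' ! i \<otimes> u i)) = Ks' ! i \<otimes> \<tau> (v k \<otimes> u i)"
          using klin_center[OF klin_tau nc, of i "v k \<otimes> u i"] i k by simp
        then show "\<tau> (v k \<otimes> (Ks' ! i \<otimes> u i)) = (if i = k then Ks' ! k else \<zero>)"
          using tau_dual[OF k, of i] i nL by auto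
      qed (use nc center_closed k in auto)
      also have "\<dots> = Ks' ! k" using k nc center_closed by (intro finsum_delta) auto
      finally show ?thesis by simp
    qed
    then have "set Ks' \<subseteq> {\<zero>}" using Ks'(3) Us(2) by (auto simp: in_set_conv_nth)
    then show "set (take (length Us) Ks) \<subseteq> {\<zero>}" using Ks'(1) by blast
  qed
  moreover have "Span center Us = carrier L"
  proof (intro equalityI subsetI)
    show "y \<in> carrier L" if "y \<in> Span center Us" for y
      using Span_in_carrier[OF cL Us(1)] that by blast
    show "y \<in> Span center Us" if y: "y \<in> carrier L" for y
    proof -
      define Ks where "Ks = map (\<lambda>i. \<tau> (v i \<otimes> y)) [0..<n]"
      have Ks: "set Ks \<subseteq> center" "length Ks = n" using tau_center y by (auto simp: Ks_def)
      have "combine Ks Us = (\<Oplus>i\<in>{..<n}. Ks ! i \<otimes> u i)"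
        unfolding Us_def using Ks cL by (intro combine_map_upt) auto
      also have "\<dots> = (\<Oplus>i\<in>{..<n}. \<tau> (v i \<otimes> y) \<otimes> u i)"
        using y by (intro finsum_cong') (auto simp: Ks_def)
      also have "\<dots> = y" using u_expand[OF y] by (rule sym)
      finally have "combine Ks Us = y" .
      then show ?thesis
        unfolding Span_mem_iff_length_version[OF subfield_center Us(1)]
        by (intro exI[of _ Ks]) (simp add: Ks Us(2))
    qed
  qed
  ultimately show ?thesis using dimensionI[OF subfield_center, of Us "carrier L"] Us(2) by simp
qed

context
  fixes m p \<alpha>
  assumes fs: "E.free_system m p \<alpha>" and proj: "\<And>x. x \<in> carrier P \<Longrightarrow> E.system_proj m p \<alpha> x = x"
begin

lemma p_closed: "i < m \<Longrightarrow> p i \<in> carrier P"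
  and alpha_form: "i < m \<Longrightarrow> E.linear_form (\<alpha> i)"
  and alpha_p: "i < m \<Longrightarrow> j < m \<Longrightarrow> \<alpha> i (p j) = (if i = j then \<one>\<^bsub>E\<^esub> else \<zero>\<^bsub>E\<^esub>)"
  using E.free_systemD[OF fs] by auto

lemma alpha_closed: "i < m \<Longrightarrow> x \<in> carrier P \<Longrightarrow> \<alpha> i x \<in> carrier E"
  using E.linear_form_closed[OF alpha_form] by simp

text \<open>The elements \<open>p\<^sub>i u\<^sub>j\<close> form a left basis of \<open>P\<close> with coordinate forms \<open>x \<mapsto> \<alpha>\<^sub>i(x)(v\<^sub>j)\<close>: substitute
  \<open>x = \<Sum>\<^sub>i \<alpha>\<^sub>i(x) p\<^sub>i\<close> and the definition of the action of \<open>E\<close>.\<close>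

lemma form_via_E_basis:
  assumes g: "left.linear_form g" and x: "x \<in> carrier P"
  shows "g x = (\<Oplus>y\<in>{..<m} \<times> {..<n}. \<alpha> (fst y) x (v (snd y)) \<otimes> g (p (fst y) \<triangleleft> u (snd y)))"
proof -
  have "g x = g (\<Oplus>\<^bsub>P\<^esub>i\<in>{..<m}. act (\<alpha> i x) (p i))"
    using proj[OF x] by (simp add: E.system_proj_def)
  also have "\<dots> = (\<Oplus>i\<in>{..<m}. g (act (\<alpha> i x) (p i)))"
    using g x p_closed alpha_closed E_klin by (intro left.linear_form_finsum) auto
  also have "\<dots> = (\<Oplus>i\<in>{..<m}. \<Oplus>j\<in>{..<n}. \<alpha> i x (v j) \<otimes> g (p i \<triangleleft> u j))"
    using g x p_closed alpha_closed E_klin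
    by (intro finsum_cong') (auto simp: form_act intro!: finsum_closed)
  also have "\<dots> = (\<Oplus>y\<in>{..<m} \<times> {..<n}. \<alpha> (fst y) x (v (snd y)) \<otimes> g (p (fst y) \<triangleleft> u (snd y)))"
    using g x p_closed alpha_closed by (intro finsum_Sigma) auto
  finally show ?thesis .
qed

text \<open>The left basis \<open>b\<close> and the elements \<open>p\<^sub>i u\<^sub>j\<close>, each with its coordinate forms, are two dual systems that span the
  left linear forms, so they have the same length.\<close>

lemma rank_eq: "d = m * n"
proof (rule antisym)
  let ?V = "{g. left.linear_form g}"
  have "dual_system (carrier P) ?V d h b"
    using left_basis(1) by (auto simp: dual_system_def left.free_system_def)
  then have "d \<le> card ({..<m} \<times> {..<n})"
  proof (rule dual_system_bound[where b = "\<lambda>y x. \<alpha> (fst y) x (v (snd y))"])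
    fix g assume "g \<in> ?V"
    then have g: "left.linear_form g" by simp
    have "g x = (\<Oplus>y\<in>{..<m} \<times> {..<n}. g (p (fst y) \<triangleleft> u (snd y)) \<otimes> \<alpha> (fst y) x (v (snd y)))"
      if x: "x \<in> carrier P" for x
      unfolding form_via_E_basis[OF g x] using g x p_closed alpha_closed
      by (intro finsum_cong') (auto simp: m_comm)
    then show "\<exists>a\<in>{..<m} \<times> {..<n} \<rightarrow> carrier L. \<forall>x\<in>carrier P.
        g x = (\<Oplus>y\<in>{..<m} \<times> {..<n}. a y \<otimes> \<alpha> (fst y) x (v (snd y)))"
      using g p_closed by (intro bexI[of _ "\<lambda>y. g (p (fst y) \<triangleleft> u (snd y))"]) auto
  qed (use alpha_closed in auto)
  then show "d \<le> m * n" by simp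
next
  let ?V = "{g. left.linear_form g}"
  have dm: "i div n < m" "i mod n < n" if "i < m * n" for i
    using that n_pos by (auto simp: less_mult_imp_div_less)
  have "dual_system (carrier P) ?V (m * n) (\<lambda>i x. \<alpha> (i div n) x (v (i mod n))) (\<lambda>i. p (i div n) \<triangleleft> u (i mod n))"
    unfolding dual_system_def
  proof (intro conjI allI impI)
    fix i assume i: "i < m * n"
    show "(\<lambda>x. \<alpha> (i div n) x (v (i mod n))) \<in> ?V"
      using E_form_eval[OF alpha_form v_closed] dm[OF i] by simp
    show "p (i div n) \<triangleleft> u (i mod n) \<in> carrier P" using dm[OF i] p_closed by simp
    fix j assume j: "j < m * n"
    have "\<alpha> (i div n) (p (j div n) \<triangleleft> u (j mod n)) (v (i mod n))
        = \<alpha> (i div n) (p (j div n)) (u (j mod n) \<otimes> v (i mod n))"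
      using dm[OF i] dm[OF j] p_closed by (intro E_form_ract alpha_form) auto
    also have "\<dots> = (if i div n = j div n \<and> i mod n = j mod n then \<one> else \<zero>)"
      using alpha_p[OF dm(1)[OF i] dm(1)[OF j]] tau_dual[OF dm(2)[OF i] dm(2)[OF j]] dm(2)[OF i] dm(2)[OF j]
      by (auto simp: E_simps(3,4) m_comm)
    also have "(i div n = j div n \<and> i mod n = j mod n) \<longleftrightarrow> i = j"
      by (metis div_mult_mod_eq)
    finally show "\<alpha> (i div n) (p (j div n) \<triangleleft> u (j mod n)) (v (i mod n)) = (if i = j then \<one> else \<zero>)" .
  qed
  then show "m * n \<le> d" by (rule forms_dual_system_bound)
qed

text \<open>The map \<open>s\<close>, sending \<open>\<phi>\<close> to \<open>\<Sum>\<^sub>j \<phi> (v\<^sub>j) \<otimes> u\<^sub>j\<close>, identifies \<open>E\<close> with \<open>L \<otimes>\<^sub>K L\<close> as a bimodule. Applied to the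
  coordinates \<open>\<alpha>\<^sub>i x\<close> in the \<open>E\<close>-basis of \<open>P\<close> it gives the isomorphism.\<close>

lemma E_basis_isomorphism:
  "bimodule_isomorphic L P (bimodule_power (bimodule_tensor center (regular_bimodule L) (regular_bimodule L)) m)"
proof -
  let ?R = "regular_bimodule L"
  interpret TB: tensor_bimodule L center ?R ?R
    by (intro tensor_bimodule.intro tensor_bimodule_axioms.intro regular_bimodule) (auto simp: center_closed)
  have R: "carrier ?R = carrier L" "\<And>x y. x \<oplus>\<^bsub>?R\<^esub> y = x \<oplus> y" "\<And>x y. x \<odot>\<^bsub>?R\<^esub> y = x \<otimes> y" "\<And>x y. x \<odot>\<^sup>r\<^bsub>?R\<^esub> y = x \<otimes> y"
    by (simp_all add: regular_bimodule_def)
  let ?T = "bimodule_tensor center ?R ?R"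
  note t_closed = TB.tens_closed[unfolded R] and t_add1 = TB.tens_add_left[unfolded R]
    and t_add2 = TB.tens_add_right[unfolded R] and t_bal = TB.tens_balanced[unfolded R]
    and t_l = TB.T_smult_tens[unfolded R] and t_r = TB.T_rsmult_tens[unfolded R]
  have t_bal': "TB.tens (z \<otimes> x) y = TB.tens x (z \<otimes> y)" if "x \<in> carrier L" "y \<in> carrier L" "z \<in> center" for x y z
    using t_bal[OF that] m_comm[OF that(1) center_closed[OF that(3)]] by simp
  define s where "s = (\<lambda>\<phi>. \<Oplus>\<^bsub>?T\<^esub>j\<in>{..<n}. TB.tens (\<phi> (v j)) (u j))"
  have s_closed: "s \<phi> \<in> carrier ?T" if "\<phi> \<in> carrier E" for \<phi>
    unfolding s_def using that by (intro TB.T.finsum_closed) (auto intro!: t_closed)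
  have s_add: "s (\<phi> \<oplus>\<^bsub>E\<^esub> \<psi>) = s \<phi> \<oplus>\<^bsub>?T\<^esub> s \<psi>" if "\<phi> \<in> carrier E" "\<psi> \<in> carrier E" for \<phi> \<psi>
  proof -
    have "s (\<phi> \<oplus>\<^bsub>E\<^esub> \<psi>) = (\<Oplus>\<^bsub>?T\<^esub>j\<in>{..<n}. TB.tens (\<phi> (v j)) (u j) \<oplus>\<^bsub>?T\<^esub> TB.tens (\<psi> (v j)) (u j))"
      unfolding s_def using that
      by (intro TB.T.finsum_cong') (auto simp: E_simps(5) t_add1 intro!: t_closed)
    also have "\<dots> = s \<phi> \<oplus>\<^bsub>?T\<^esub> s \<psi>"
      unfolding s_def using that by (intro TB.T.finsum_addf) (auto intro!: t_closed)
    finally show ?thesis .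
  qed
  \<comment> \<open>The value \<open>\<phi> y\<close> is recovered from \<open>s \<phi>\<close> by the map \<open>x \<otimes> w \<mapsto> x \<tau> (w y)\<close>.\<close>
  have s_inj: "\<phi> = \<psi>" if "\<phi> \<in> carrier E" "\<psi> \<in> carrier E" "s \<phi> = s \<psi>" for \<phi> \<psi>
  proof (rule E_eqI[OF that(1,2)])
    fix y assume y: "y \<in> carrier L"
    obtain H where H: "\<And>C. C \<in> carrier ?T \<Longrightarrow> H C \<in> carrier L"
      "\<And>C D. C \<in> carrier ?T \<Longrightarrow> D \<in> carrier ?T \<Longrightarrow> H (C \<oplus>\<^bsub>?T\<^esub> D) = H C \<oplus> H D"
      "\<And>x w. x \<in> carrier ?R \<Longrightarrow> w \<in> carrier ?R \<Longrightarrow> H (TB.tens x w) = x \<otimes> \<tau> (w \<otimes> y)"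
    proof (rule TB.tensor_lift[OF abelian_group_axioms, of "\<lambda>x w. x \<otimes> \<tau> (w \<otimes> y)"])
      fix x w z assume x: "x \<in> carrier ?R" "w \<in> carrier ?R" and z: "z \<in> center"
      have zL: "z \<in> carrier L" using z by (rule center_closed)
      have "\<tau> (z \<otimes> w \<otimes> y) = z \<otimes> \<tau> (w \<otimes> y)"
        using klin_center[OF klin_tau z, of "w \<otimes> y"] x y zL by (simp add: R m_assoc)
      then show "x \<odot>\<^sup>r\<^bsub>?R\<^esub> z \<otimes> \<tau> (w \<otimes> y) = x \<otimes> \<tau> (z \<odot>\<^bsub>?R\<^esub> w \<otimes> y)"
        using x y zL by (simp add: R m_assoc)
    qed (use y that in \<open>auto simp: R l_distr r_distr klin_add[OF klin_tau]\<close>)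
    have Hs: "H (s \<phi>) = \<phi> y" if "\<phi> \<in> carrier E" for \<phi>
    proof -
      have "H (s \<phi>) = (\<Oplus>j\<in>{..<n}. H (TB.tens (\<phi> (v j)) (u j)))"
        unfolding s_def
        by (rule additive_finsum[OF TB.T.abelian_group_axioms abelian_group_axioms])
          (use H that in \<open>auto intro!: t_closed\<close>)
      also have "\<dots> = (\<Oplus>j\<in>{..<n}. \<phi> (v j) \<otimes> \<tau> (u j \<otimes> y))"
        using H(3) that y by (intro finsum_cong') (auto simp: R)
      also have "\<dots> = \<phi> y" using klin_v_expand[OF E_klin[OF that] y] by simp
      finally show ?thesis .
    qed
    show "\<phi> y = \<psi> y" using Hs[OF that(1)] Hs[OF that(2)] that(3) by simp
  qed
  have s_surj: "\<exists>\<phi>\<in>carrier E. s \<phi> = C" if "C \<in> carrier ?T" for C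
    using that
  proof (induction rule: TB.tensor_induct)
    case zero
    have "s \<zero>\<^bsub>E\<^esub> \<oplus>\<^bsub>?T\<^esub> s \<zero>\<^bsub>E\<^esub> = s \<zero>\<^bsub>E\<^esub>"
      using s_add[OF E_zero_closed E_zero_closed] by simp
    then have "s \<zero>\<^bsub>E\<^esub> = \<zero>\<^bsub>?T\<^esub>"
      using TB.T.add.r_cancel_one'[of "s \<zero>\<^bsub>E\<^esub>" "s \<zero>\<^bsub>E\<^esub>"] s_closed[OF E_zero_closed] by simp
    then show ?case using E_zero_closed by blast
  next
    case (add C D)
    then show ?case using s_add E_add_closed by metis
  next
    case (tens x y)
    then have xy: "x \<in> carrier L" "y \<in> carrier L" by (auto simp: R)
    \<comment> \<open>The element of \<open>E\<close> that stands for \<open>x \<otimes> y\<close>.\<close>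
    define \<phi> where "\<phi> = (\<lambda>w\<in>carrier L. x \<otimes> \<tau> (y \<otimes> w))"
    have \<phi>: "\<phi> \<in> carrier E"
      unfolding \<phi>_def using xy by (intro E_restrictI klin_coeff_maps coeff_maps_scale[of "\<lambda>w. \<tau> (y \<otimes> w)"] coeff_maps_rmult tau_coeff)
    have "s \<phi> = (\<Oplus>\<^bsub>?T\<^esub>j\<in>{..<n}. TB.tens x (\<tau> (v j \<otimes> y) \<otimes> u j))"
      unfolding s_def
    proof (rule TB.T.finsum_cong')
      fix j assume j: "j \<in> {..<n}"
      have "\<phi> (v j) = \<tau> (v j \<otimes> y) \<otimes> x" using j xy by (simp add: \<phi>_def m_comm)
      then show "TB.tens (\<phi> (v j)) (u j) = TB.tens x (\<tau> (v j \<otimes> y) \<otimes> u j)"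
        using j xy tau_center by (simp add: t_bal')
    qed (use xy in \<open>auto intro!: t_closed\<close>)
    also have "\<dots> = TB.tens x (\<Oplus>j\<in>{..<n}. \<tau> (v j \<otimes> y) \<otimes> u j)"
      by (rule additive_finsum[OF abelian_group_axioms TB.T.abelian_group_axioms, symmetric])
        (use xy in \<open>auto simp: t_add2 intro!: t_closed\<close>)
    also have "\<dots> = TB.tens x y" using u_expand[OF xy(2)] by simp
    finally show ?case using \<phi> by blast
  qed
  have s_l: "s (lam a \<otimes>\<^bsub>E\<^esub> \<phi>) = a \<odot>\<^bsub>?T\<^esub> s \<phi>" if a: "a \<in> carrier L" and \<phi>: "\<phi> \<in> carrier E" for a \<phi>
  proof -
    have "s (lam a \<otimes>\<^bsub>E\<^esub> \<phi>) = (\<Oplus>\<^bsub>?T\<^esub>j\<in>{..<n}. a \<odot>\<^bsub>?T\<^esub> TB.tens (\<phi> (v j)) (u j))"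
      unfolding s_def using a \<phi>
      by (intro TB.T.finsum_cong')
        (auto simp: E_simps(2) conv_lam[OF E_klin[OF \<phi>] a] t_l intro!: t_closed)
    also have "\<dots> = a \<odot>\<^bsub>?T\<^esub> s \<phi>"
      unfolding s_def
      by (rule additive_finsum[where h = "\<lambda>C. a \<odot>\<^bsub>?T\<^esub> C", OF TB.T.abelian_group_axioms TB.T.abelian_group_axioms, symmetric])
        (use a \<phi> in \<open>auto simp: TB.T_smult_add TB.T_smult_closed intro!: t_closed\<close>)
    finally show ?thesis .
  qed
  \<comment> \<open>Right linearity is the Casimir identity, as \<open>rho a\<close> moves \<open>a\<close> into the left factor.\<close>
  have s_r: "s (rho a \<otimes>\<^bsub>E\<^esub> \<phi>) = s \<phi> \<odot>\<^sup>r\<^bsub>?T\<^esub> a" if a: "a \<in> carrier L" and \<phi>: "\<phi> \<in> carrier E" for a \<phi>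
  proof -
    note kl = E_klin[OF \<phi>]
    have "s (rho a \<otimes>\<^bsub>E\<^esub> \<phi>) = (\<Oplus>\<^bsub>?T\<^esub>j\<in>{..<n}. TB.tens (\<phi> (a \<otimes> v j)) (u j))"
      unfolding s_def using a \<phi>
      by (intro TB.T.finsum_cong') (auto simp: E_simps(2) conv_rho[OF kl a] intro!: t_closed)
    also have "\<dots> = (\<Oplus>\<^bsub>?T\<^esub>j\<in>{..<n}. TB.tens (\<phi> (v j)) (u j \<otimes> a))"
    proof (rule casimir[where T = "\<lambda>x y. TB.tens (\<phi> x) y", OF TB.T.abelian_group_axioms])
      fix x y z assume "x \<in> carrier L" "y \<in> carrier L" "z \<in> center"
      then show "TB.tens (\<phi> (z \<otimes> x)) y = TB.tens (\<phi> x) (z \<otimes> y)"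
        using kl by (simp add: klin_center t_bal')
    qed (use a kl in \<open>auto simp: klin_add t_add1 t_add2 intro!: t_closed\<close>)
    also have "\<dots> = (\<Oplus>\<^bsub>?T\<^esub>j\<in>{..<n}. TB.tens (\<phi> (v j)) (u j) \<odot>\<^sup>r\<^bsub>?T\<^esub> a)"
      using a \<phi> by (intro TB.T.finsum_cong') (auto simp: t_r intro!: t_closed)
    also have "\<dots> = s \<phi> \<odot>\<^sup>r\<^bsub>?T\<^esub> a"
      unfolding s_def
      by (rule additive_finsum[where h = "\<lambda>C. C \<odot>\<^sup>r\<^bsub>?T\<^esub> a", OF TB.T.abelian_group_axioms TB.T.abelian_group_axioms, symmetric])
        (use a \<phi> in \<open>auto simp: TB.T_rsmult_add TB.T_rsmult_closed intro!: t_closed\<close>)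
    finally show ?thesis .
  qed
  define f where "f = (\<lambda>x. \<lambda>i\<in>{..<m}. s (\<alpha> i x))"
  have "f \<in> bimodule_iso L P (bimodule_power ?T m)"
  proof (rule bimodule_isoI)
    fix x assume x: "x \<in> carrier P"
    show "f x \<in> carrier (bimodule_power ?T m)"
      using x s_closed alpha_closed by (auto simp: f_def bimodule_power_simps)
    show "f (x \<oplus>\<^bsub>P\<^esub> y) = f x \<oplus>\<^bsub>bimodule_power ?T m\<^esub> f y" if y: "y \<in> carrier P" for y
    proof -
      have "s (\<alpha> i (x \<oplus>\<^bsub>P\<^esub> y)) = s (\<alpha> i x) \<oplus>\<^bsub>?T\<^esub> s (\<alpha> i y)" if i: "i < m" for i
        using E.linear_form_add[OF alpha_form[OF i], of x y] x y s_add alpha_closed[OF i] by simp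
      then show ?thesis unfolding bimodule_power_simps f_def by (intro restrict_ext) simp
    qed
    show "f (a \<triangleright> x) = a \<odot>\<^bsub>bimodule_power ?T m\<^esub> f x" if a: "a \<in> carrier L" for a
    proof -
      have "s (\<alpha> i (a \<triangleright> x)) = a \<odot>\<^bsub>?T\<^esub> s (\<alpha> i x)" if i: "i < m" for i
        using E.linear_form_smult[OF alpha_form[OF i] lam_closed[OF a], of x] x a s_l[OF a alpha_closed[OF i x]]
        by (simp add: act_lam)
      then show ?thesis unfolding bimodule_power_simps f_def by (intro restrict_ext) simp
    qed
    show "f (x \<triangleleft> a) = f x \<odot>\<^sup>r\<^bsub>bimodule_power ?T m\<^esub> a" if a: "a \<in> carrier L" for a
    proof -
      have "s (\<alpha> i (x \<triangleleft> a)) = s (\<alpha> i x) \<odot>\<^sup>r\<^bsub>?T\<^esub> a" if i: "i < m" for i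
        using E.linear_form_smult[OF alpha_form[OF i] rho_closed[OF a], of x] x a s_r[OF a alpha_closed[OF i x]]
        by (simp add: act_rho)
      then show ?thesis unfolding bimodule_power_simps f_def by (intro restrict_ext) simp
    qed
  next
    show "bij_betw f (carrier P) (carrier (bimodule_power ?T m))"
      unfolding bij_betw_def
    proof (intro conjI inj_onI equalityI subsetI)
      fix x y assume xy: "x \<in> carrier P" "y \<in> carrier P" "f x = f y"
      have "\<alpha> i x = \<alpha> i y" if i: "i < m" for i
      proof (rule s_inj[OF alpha_closed[OF i xy(1)] alpha_closed[OF i xy(2)]])
        show "s (\<alpha> i x) = s (\<alpha> i y)" using fun_cong[OF xy(3), of i] i by (simp add: f_def)
      qed
      then have "E.system_proj m p \<alpha> x = E.system_proj m p \<alpha> y"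
        unfolding E.system_proj_def using xy p_closed alpha_closed E_klin
        by (intro E.M.finsum_cong') auto
      then show "x = y" using proj xy by simp
    next
      fix Z assume "Z \<in> f ` carrier P"
      then show "Z \<in> carrier (bimodule_power ?T m)"
        using s_closed alpha_closed by (auto simp: f_def bimodule_power_simps)
    next
      fix Z assume Z: "Z \<in> carrier (bimodule_power ?T m)"
      have "\<forall>i\<in>{..<m}. \<exists>\<phi>. \<phi> \<in> carrier E \<and> s \<phi> = Z i"
      proof
        fix i assume "i \<in> {..<m}"
        then have "Z i \<in> carrier ?T" using Z by (auto simp: bimodule_power_simps)
        then show "\<exists>\<phi>. \<phi> \<in> carrier E \<and> s \<phi> = Z i" using s_surj by blast
      qed
      from bchoice[OF this] obtain \<phi> where \<phi>: "\<And>i. i < m \<Longrightarrow> \<phi> i \<in> carrier E" "\<And>i. i < m \<Longrightarrow> s (\<phi> i) = Z i"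
        by auto
      define x where "x = (\<Oplus>\<^bsub>P\<^esub>i\<in>{..<m}. act (\<phi> i) (p i))"
      have ap: "act (\<phi> i) (p i) \<in> carrier P" if "i < m" for i using E_klin[OF \<phi>(1)[OF that]] p_closed[OF that] by simp
      have x: "x \<in> carrier P" unfolding x_def using ap by (intro left.M.finsum_closed) auto
      have "\<alpha> k x = \<phi> k" if k: "k < m" for k
      proof -
        have "\<alpha> k x = (\<Oplus>\<^bsub>E\<^esub>i\<in>{..<m}. \<alpha> k (act (\<phi> i) (p i)))"
          unfolding x_def using E.linear_form_finsum[OF alpha_form[OF k], of "{..<m}" "\<lambda>i. act (\<phi> i) (p i)"] ap by simp
        also have "\<dots> = (\<Oplus>\<^bsub>E\<^esub>i\<in>{..<m}. if i = k then \<phi> k else \<zero>\<^bsub>E\<^esub>)"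
        proof (rule E.R.finsum_cong')
          fix i assume "i \<in> {..<m}"
          then have i: "i < m" by simp
          have "\<alpha> k (act (\<phi> i) (p i)) = \<phi> i \<otimes>\<^bsub>E\<^esub> \<alpha> k (p i)"
            using E.linear_form_smult[OF alpha_form[OF k] \<phi>(1)[OF i], of "p i"] p_closed[OF i] by simp
          then show "\<alpha> k (act (\<phi> i) (p i)) = (if i = k then \<phi> k else \<zero>\<^bsub>E\<^esub>)"
            using alpha_p[OF k i] \<phi>(1)[OF i] by auto
        qed (use \<phi>(1) k in auto)
        also have "\<dots> = \<phi> k" using k \<phi>(1) by (intro E.R.finsum_delta) auto
        finally show ?thesis .
      qed
      then have "f x i = Z i" for i
        using Z \<phi>(2) by (cases "i < m") (auto simp: f_def bimodule_power_simps PiE_iff extensional_def)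
      then have "f x = Z" by (rule ext)
      then show "Z \<in> f ` carrier P" using x by blast
    qed
  qed
  then show ?thesis unfolding bimodule_isomorphic_def by blast
qed

end

end

theorem theorem2p32:
  fixes L :: "('a, 'k) ring_scheme" and P :: "('a, 'b, 'm) bimodule_scheme" and d :: nat
  assumes "field L" and "galois_bimodule L P d"
  shows "(\<exists>r::nat. r \<ge> 1 \<and>
      bimodule_isomorphic L P
        (bimodule_power
          (bimodule_tensor (bimodule_center L P) (regular_bimodule L) (regular_bimodule L)) r)) \<and>
    ring.finite_dimension L (bimodule_center L P) (carrier L) \<and>
    ring.dim L (bimodule_center L P) (carrier L) dvd d"
proof -
  obtain b h c \<kappa> \<beta> where "galois_data L P d b h c \<kappa> \<beta>" using ex_galois_data[OF assms] .
  then interpret galois_data L P d b h c \<kappa> \<beta> .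
  obtain \<tau> n u v where "galois_dual L P d b h c \<kappa> \<beta> \<tau> n u v"
  proof (rule ex_dual_bases)
    fix \<tau> and n :: nat and u v :: "nat \<Rightarrow> 'a"
    assume "\<tau> \<in> coeff_maps" "\<And>y. y \<in> carrier L \<Longrightarrow> \<tau> y \<in> center"
      "\<And>i. i < n \<Longrightarrow> u i \<in> carrier L" "\<And>i. i < n \<Longrightarrow> v i \<in> carrier L"
      "\<And>i j. i < n \<Longrightarrow> j < n \<Longrightarrow> \<tau> (v i \<otimes>\<^bsub>L\<^esub> u j) = (if i = j then \<one>\<^bsub>L\<^esub> else \<zero>\<^bsub>L\<^esub>)"
      "\<And>y. y \<in> carrier L \<Longrightarrow> y = (\<Oplus>\<^bsub>L\<^esub>i\<in>{..<n}. \<tau> (v i \<otimes>\<^bsub>L\<^esub> y) \<otimes>\<^bsub>L\<^esub> u i)"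
      "\<And>y. y \<in> carrier L \<Longrightarrow> y = (\<Oplus>\<^bsub>L\<^esub>i\<in>{..<n}. \<tau> (u i \<otimes>\<^bsub>L\<^esub> y) \<otimes>\<^bsub>L\<^esub> v i)"
      "0 < n"
    then have "galois_dual L P d b h c \<kappa> \<beta> \<tau> n u v"
      by (intro galois_dual.intro galois_dual_axioms.intro galois_data_axioms)
    then show thesis by (rule that)
  qed
  then interpret galois_dual L P d b h c \<kappa> \<beta> \<tau> n u v .
  obtain m p \<alpha> where m: "0 < m" and fs: "E.free_system m p \<alpha>"
    and proj: "\<And>x. x \<in> carrier P \<Longrightarrow> E.system_proj m p \<alpha> x = x"
    using ex_E_basis by blast
  have "dim center (carrier L) = n"
    using dimI[OF subfield_center dimension_center] by (simp add: over_def)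
  then show ?thesis
    using E_basis_isomorphism[OF fs proj] m finite_dimensionI[OF dimension_center] rank_eq[OF fs proj]
    by (intro conjI exI[of _ m]) auto
qed

end
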